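(* Let $\Phi$ be a Young function with $\Phi\in\Delta_2$. A convex subset $C\subset L_{\Phi^*}$ is $\sigma(L_{\Phi^*},L_\Phi)$-closed if and only if for every $\zeta\in L_{\Phi^*}$, the intersection $C\cap[-\zeta,\zeta]$ is closed in $L_0$.
   Context: $(\Omega,\mathcal F,\mathbb P)$ is a probability space, $L_0$ is the space of $\mathbb P$-a.s. equivalence classes of finite real measurable functions, equipped with the topology of convergence in probability; $\mathbb E$ is expectation. A (finite coercive) Young function is an even convex function $\Phi:\mathbb R\to\mathbb R$ with $\Phi(0)=0$ and $\lim_{x\to+\infty}\Phi(x)/x=+\infty$; its conjugate $\Phi^*(y)=\sup_x(xy-\Phi(x))$ is again such a function. $\Phi\in\Delta_2$ means $\limsup_{x\to\infty}\Phi(2x)/\Phi(x)<\infty$. For a Young function $\Psi$, $\mathbb B_\Psi=\{\xi\in L_0:\mathbb E[\Psi(\xi)]\le 1\}$, and the Orlicz space is $L_\Psi=\bigcup_{\lambda>0}\lambda\mathbb B_\Psi$ with norm $\|\xi\|_\Psi=\inf\{\lambda>0:\xi\in\lambda\mathbb B_\Psi\}$ and the a.s. pointwise order. $\sigma(L_{\Phi^*},L_\Phi)$ is the weak topology on $L_{\Phi^*}$ for the duality $\langle\eta,\xi\rangle=\mathbb E[\eta\xi]$, $\eta\in L_\Phi$, $\xi\in L_{\Phi^*}$ (for $\Phi\in\Delta_2$, $L_{\Phi^*}$ is via this pairing the norm dual of $L_\Phi$, up to an equivalent norm). Order interval: $[-\zeta,\zeta]=\{\xi:-\zeta\le\xi\le\zeta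 \text{ a.s.}\}$. *)

theory Defs
  imports "HOL-Probability.Probability"
begin

definition young_function :: "(real \<Rightarrow> real) \<Rightarrow> bool" where
  "young_function \<Phi> \<longleftrightarrow>
     (\<forall>x. \<Phi> (- x) = \<Phi> x) \<and> convex_on UNIV \<Phi> \<and> \<Phi> 0 = 0 \<and>
     filterlim (\<lambda>x. \<Phi> x / x) at_top at_top"

text \<open>The real-valued supremum is meaningful because it is only taken for Young functions, where
  coercivity makes the set bounded above.\<close>

definition young_conjugate :: "(real \<Rightarrow> real) \<Rightarrow> real \<Rightarrow> real" where
  "young_conjugate \<Phi> y = (SUP x. x * y - \<Phi> x)"

definition Delta2 :: "(real \<Rightarrow> real) \<Rightarrow> bool" where
  "Delta2 \<Phi> \<longleftrightarrow> Limsup at_top (\<lambda>x. ereal (\<Phi> (2 * x) / \<Phi> x)) < \<infinity>"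

text \<open>Elements of \<open>L\<^sub>0\<close> are genuine a.s.-equivalence classes, i.e. sets of measurable functions.
  Operations on classes go through a chosen representative; none of them depends on the choice.\<close>

definition as_eq :: "'a measure \<Rightarrow> (('a \<Rightarrow> real) \<times> ('a \<Rightarrow> real)) set" where
  "as_eq M = {(f, g). f \<in> borel_measurable M \<and> g \<in> borel_measurable M \<and> (AE \<omega> in M. f \<omega> = g \<omega>)}"

definition L0 :: "'a measure \<Rightarrow> ('a \<Rightarrow> real) set set" where
  "L0 M = borel_measurable M // as_eq M"

definition L0_class :: "'a measure \<Rightarrow> ('a \<Rightarrow> real) \<Rightarrow> ('a \<Rightarrow> real) set" where
  "L0_class M f = as_eq M `` {f}"

definition rep :: "('a \<Rightarrow> real) set \<Rightarrow> 'a \<Rightarrow> real" where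
  "rep \<xi> = (SOME f. f \<in> \<xi>)"

definition L0_add :: "'a measure \<Rightarrow> ('a \<Rightarrow> real) set \<Rightarrow> ('a \<Rightarrow> real) set \<Rightarrow> ('a \<Rightarrow> real) set" where
  "L0_add M \<xi> \<eta> = L0_class M (\<lambda>\<omega>. rep \<xi> \<omega> + rep \<eta> \<omega>)"

definition L0_scale :: "'a measure \<Rightarrow> real \<Rightarrow> ('a \<Rightarrow> real) set \<Rightarrow> ('a \<Rightarrow> real) set" where
  "L0_scale M c \<xi> = L0_class M (\<lambda>\<omega>. c * rep \<xi> \<omega>)"

definition L0_convex :: "'a measure \<Rightarrow> ('a \<Rightarrow> real) set set \<Rightarrow> bool" where
  "L0_convex M C \<longleftrightarrow>
     (\<forall>\<xi>\<in>C. \<forall>\<eta>\<in>C. \<forall>u\<ge>0. \<forall>v\<ge>0. u + v = 1 \<longrightarrow>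
        L0_add M (L0_scale M u \<xi>) (L0_scale M v \<eta>) \<in> C)"

definition order_interval :: "'a measure \<Rightarrow> ('a \<Rightarrow> real) set \<Rightarrow> ('a \<Rightarrow> real) set set" where
  "order_interval M \<zeta> =
     {\<xi> \<in> L0 M. AE \<omega> in M. - rep \<zeta> \<omega> \<le> rep \<xi> \<omega> \<and> rep \<xi> \<omega> \<le> rep \<zeta> \<omega>}"

text \<open>The topology of convergence in probability: the sets
  \<open>{\<eta>. P(\<bar>\<eta> - \<xi>\<bar> > \<epsilon>) < \<epsilon>}\<close>, for positive \<open>\<epsilon>\<close>, form a neighbourhood base at \<open>\<xi>\<close>.\<close>

definition L0_topology :: "'a measure \<Rightarrow> ('a \<Rightarrow> real) set topology" where
  "L0_topology M = topology (\<lambda>U. U \<subseteq> L0 M \<and>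
     (\<forall>\<xi>\<in>U. \<exists>\<epsilon>>0. \<forall>\<eta>\<in>L0 M.
        measure M {\<omega> \<in> space M. \<bar>rep \<eta> \<omega> - rep \<xi> \<omega>\<bar> > \<epsilon>} < \<epsilon> \<longrightarrow> \<eta> \<in> U))"

text \<open>The expectation is an extended nonnegative integral, since \<open>\<Psi>\<close> of a random variable need not
  be integrable; Young functions are nonnegative, so \<open>ennreal\<close> does not truncate.\<close>

definition orlicz_ball :: "'a measure \<Rightarrow> (real \<Rightarrow> real) \<Rightarrow> ('a \<Rightarrow> real) set set" where
  "orlicz_ball M \<Psi> = {\<xi> \<in> L0 M. (\<integral>\<^sup>+ \<omega>. ennreal (\<Psi> (rep \<xi> \<omega>)) \<partial>M) \<le> 1}"

definition orlicz_space :: "'a measure \<Rightarrow> (real \<Rightarrow> real) \<Rightarrow> ('a \<Rightarrow> real) set set" where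
  "orlicz_space M \<Psi> = (\<Union>c\<in>{0<..}. L0_scale M c ` orlicz_ball M \<Psi>)"

definition pairing :: "'a measure \<Rightarrow> ('a \<Rightarrow> real) set \<Rightarrow> ('a \<Rightarrow> real) set \<Rightarrow> real" where
  "pairing M \<eta> \<xi> = (\<integral>\<omega>. rep \<eta> \<omega> * rep \<xi> \<omega> \<partial>M)"

text \<open>\<open>weak_topology M E F\<close> is \<open>\<sigma>(E, F)\<close>: the coarsest topology on \<open>E\<close> for which pairing with every
  element of \<open>F\<close> is continuous.\<close>

definition weak_topology ::
  "'a measure \<Rightarrow> ('a \<Rightarrow> real) set set \<Rightarrow> ('a \<Rightarrow> real) set set \<Rightarrow> ('a \<Rightarrow> real) set topology" where
  "weak_topology M E F =
     topology_generated_by {{\<xi> \<in> E. pairing M \<eta> \<xi> \<in> U} | \<eta> U. \<eta> \<in> F \<and> open U}"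

lemma (in prob_space) openin_L0_topology:
  "openin (L0_topology M) U \<longleftrightarrow> U \<subseteq> L0 M \<and>
     (\<forall>\<xi>\<in>U. \<exists>\<epsilon>>0. \<forall>\<eta>\<in>L0 M.
        measure M {\<omega> \<in> space M. \<bar>rep \<eta> \<omega> - rep \<xi> \<omega>\<bar> > \<epsilon>} < \<epsilon> \<longrightarrow> \<eta> \<in> U)"
proof -
  have rep_meas: "rep \<xi> \<in> borel_measurable M" if \<xi>: "\<xi> \<in> L0 M" for \<xi>
  proof -
    obtain f where f: "f \<in> borel_measurable M" "\<xi> = as_eq M `` {f}"
      using \<xi> unfolding L0_def quotient_def by blast
    then have "f \<in> \<xi>" by (simp add: as_eq_def)
    then have "rep \<xi> \<in> \<xi>" unfolding rep_def by (rule someI[where P="\<lambda>f. f \<in> \<xi>"])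
    then show ?thesis using f by (auto simp: as_eq_def)
  qed
  have mono: "measure M {\<omega> \<in> space M. \<bar>rep \<eta> \<omega> - rep \<xi> \<omega>\<bar> > b}
      \<le> measure M {\<omega> \<in> space M. \<bar>rep \<eta> \<omega> - rep \<xi> \<omega>\<bar> > a}"
    if "\<xi> \<in> L0 M" "\<eta> \<in> L0 M" "a \<le> b" for \<xi> \<eta> a b
  proof (rule finite_measure_mono)
    have [measurable]: "rep \<xi> \<in> borel_measurable M" "rep \<eta> \<in> borel_measurable M"
      using that rep_meas by auto
    show "{\<omega> \<in> space M. \<bar>rep \<eta> \<omega> - rep \<xi> \<omega>\<bar> > a} \<in> sets M" by measurable
  qed (use that in auto)
  define P where "P \<epsilon> \<xi> \<eta> \<longleftrightarrow> measure M {\<omega> \<in> space M. \<bar>rep \<eta> \<omega> - rep \<xi> \<omega>\<bar> > \<epsilon>} < \<epsilon>" for \<epsilon> \<xi> \<eta>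
  define Q where "Q U \<longleftrightarrow> U \<subseteq> L0 M \<and> (\<forall>\<xi>\<in>U. \<exists>\<epsilon>>0. \<forall>\<eta>\<in>L0 M. P \<epsilon> \<xi> \<eta> \<longrightarrow> \<eta> \<in> U)" for U
  have P_mono: "P b \<xi> \<eta>" if "\<xi> \<in> L0 M" "\<eta> \<in> L0 M" "a \<le> b" "P a \<xi> \<eta>" for \<xi> \<eta> a b
    using mono[OF that(1-3)] that(3,4) unfolding P_def by linarith
  have Q_Int: "Q (S \<inter> T)" if S: "Q S" and T: "Q T" for S T
    unfolding Q_def
  proof (intro conjI ballI)
    show "S \<inter> T \<subseteq> L0 M" using S unfolding Q_def by blast
    fix \<xi> assume \<xi>: "\<xi> \<in> S \<inter> T"
    then have \<xi>0: "\<xi> \<in> L0 M" using S unfolding Q_def by blast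
    obtain a where a: "a > 0" "\<And>\<eta>. \<eta> \<in> L0 M \<Longrightarrow> P a \<xi> \<eta> \<Longrightarrow> \<eta> \<in> S"
      using S \<xi> unfolding Q_def by (meson IntE)
    obtain b where b: "b > 0" "\<And>\<eta>. \<eta> \<in> L0 M \<Longrightarrow> P b \<xi> \<eta> \<Longrightarrow> \<eta> \<in> T"
      using T \<xi> unfolding Q_def by (meson IntE)
    show "\<exists>\<epsilon>>0. \<forall>\<eta>\<in>L0 M. P \<epsilon> \<xi> \<eta> \<longrightarrow> \<eta> \<in> S \<inter> T"
    proof (intro exI[of _ "min a b"] conjI ballI impI IntI)
      show "min a b > 0" using a b by simp
      fix \<eta> assume \<eta>: "\<eta> \<in> L0 M" "P (min a b) \<xi> \<eta>"
      show "\<eta> \<in> S" by (rule a(2)[OF \<eta>(1) P_mono[OF \<xi>0 \<eta>(1) _ \<eta>(2)]]) simp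
      show "\<eta> \<in> T" by (rule b(2)[OF \<eta>(1) P_mono[OF \<xi>0 \<eta>(1) _ \<eta>(2)]]) simp
    qed
  qed
  have Q_Union: "Q (\<Union>K)" if "\<forall>S\<in>K. Q S" for K
    using that unfolding Q_def by (meson UnionE UnionI Union_least)
  have "istopology Q" using Q_Int Q_Union by (simp add: istopology_def)
  moreover have "L0_topology M = topology Q"
    unfolding L0_topology_def Q_def P_def by (rule refl)
  ultimately have "openin (L0_topology M) U = Q U" by simp
  then show ?thesis unfolding Q_def P_def .
qed

end

theory Submission
  imports Defs
begin

text \<open>If \<open>C\<close> is weakly closed, dominated convergence makes every \<open>C \<inter> [-\<zeta>, \<zeta>]\<close> closed under
  almost sure limits, hence closed in \<open>L\<^sub>0\<close>.

  Conversely, let \<open>F\<close> be the conjugate of \<open>\<Phi>\<close> and translate so that the point to be separated from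
  \<open>C\<close> is \<open>0\<close>. The doubling condition says that averaging elements with nearly disjoint large parts
  contracts the modular $E[F(\cdot)]$. So a modular-bounded sequence in \<open>C\<close> that converges almost
  surely can be replaced by elements of \<open>C\<close> at summable modular distance from the limit; these are
  order bounded, and the limit lies in \<open>C\<close>. With this and a Komlos-type compactness lemma, the
  induction of Krein and Smulian yields a convex function \<open>\<Theta>\<close> growing more slowly than every
  \<open>F (c * y)\<close> with $E[\Theta(\xi)]$ bounded away from \<open>0\<close> on \<open>C\<close>. Smoothing \<open>\<Theta>\<close> to \<open>G\<close> and minimising
  $E[G(\xi)]$ over \<open>C\<close>, the derivative of \<open>G\<close> at the minimiser belongs to $L_\Phi$ and separates
  \<open>0\<close> from \<open>C\<close>. No Hahn--Banach theorem and no weak compactness is needed.\<close>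

subsection \<open>Even convex functions\<close>

text \<open>Doubling is assumed for \<Phi> and may fail for its conjugate \<open>F\<close>: if
  \<Phi> grows like x log x, then \<open>F\<close> grows exponentially. So E[F(k * \<xi>)] can be
  infinite for elements \<xi> of the dual space, dominated almost sure convergence need not be norm
  convergence, and neither the norm nor \<open>F\<close> itself can serve as the functional to
  minimise. Two devices answer this. Convergence is only ever asked for in modular at one fixed
  scale, and summability of the modulars alone yields the order bound, because E[F(sup)] is at most
  the sum. And \<Theta> is assembled from truncated conjugates of linear growth, each step leaving
  what remains to \<open>F\<close> at a smaller scale; as the scales tend to 0, \<Theta> stays
  integrable along every multiple of every element of the space. That is what allows a tangent
  inequality at twice a point of the set, and with it the integrability of the derivative against
  the minimiser.\<close>

definition even_convex :: "(real \<Rightarrow> real) \<Rightarrow> bool" where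
  "even_convex g \<longleftrightarrow> (\<forall>x. g (- x) = g x) \<and> convex_on UNIV g \<and> g 0 = 0"

lemma even_convexD:
  assumes "even_convex g"
  shows "g (- x) = g x" "g 0 = 0"
    and "0 \<le> u \<Longrightarrow> 0 \<le> v \<Longrightarrow> u + v = 1 \<Longrightarrow> g (u * x + v * y) \<le> u * g x + v * g y"
  using assms by (auto simp: even_convex_def convex_on_def)

lemma even_convexI:
  assumes "\<And>x. g (- x) = g x" "g 0 = 0"
    and "\<And>u v x y. 0 \<le> u \<Longrightarrow> 0 \<le> v \<Longrightarrow> u + v = 1 \<Longrightarrow> g (u * x + v * y) \<le> u * g x + v * g y"
  shows "even_convex g"
  using assms by (auto simp: even_convex_def convex_on_def)

lemma even_convex_midpoint:
  assumes "even_convex g"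
  shows "g ((x + y) / 2) \<le> g x / 2 + g y / 2"
  using even_convexD(3)[OF assms, of "1/2" "1/2" x y] by (simp add: add_divide_distrib)

lemma even_convex_nonneg:
  assumes "even_convex g"
  shows "0 \<le> g x"
  using even_convex_midpoint[OF assms, of x "- x"] even_convexD[OF assms] by simp

lemma even_convex_scale_le:
  assumes "even_convex g" "0 \<le> t" "t \<le> 1"
  shows "g (t * x) \<le> t * g x"
  using even_convexD(3)[OF assms(1), of t "1 - t" x 0] even_convexD(2)[OF assms(1)] assms by simp

lemma even_convex_abs:
  assumes "even_convex g"
  shows "g \<bar>x\<bar> = g x"
  using even_convexD(1)[OF assms, of x] by (simp add: abs_if)

lemma even_convex_mono:
  assumes "even_convex g" "\<bar>x\<bar> \<le> \<bar>y\<bar>"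
  shows "g x \<le> g y"
proof (cases "y = 0")
  case True
  then show ?thesis using assms by simp
next
  case False
  have "g (\<bar>x\<bar> / \<bar>y\<bar> * \<bar>y\<bar>) \<le> \<bar>x\<bar> / \<bar>y\<bar> * g \<bar>y\<bar>"
    using assms False by (intro even_convex_scale_le) auto
  also have "\<dots> \<le> 1 * g \<bar>y\<bar>"
    using assms False even_convex_nonneg[OF assms(1)] by (intro mult_right_mono) auto
  finally show ?thesis using False even_convex_abs[OF assms(1)] by simp
qed

lemma even_convex_continuous:
  assumes "even_convex g"
  shows "continuous_on A g"
proof -
  have "continuous_on UNIV g"
    using assms by (intro convex_on_continuous) (auto simp: even_convex_def)
  then show ?thesis by (rule continuous_on_subset) simp
qed

lemma even_convex_isCont:
  assumes "even_convex g"
  shows "isCont g x"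
  using even_convex_continuous[OF assms, of UNIV] by (simp add: continuous_on_eq_continuous_at)

lemma even_convex_tendsto:
  assumes "even_convex g" "(f \<longlongrightarrow> l) F"
  shows "((\<lambda>x. g (f x)) \<longlongrightarrow> g l) F"
  using isCont_tendsto_compose[OF even_convex_isCont[OF assms(1)] assms(2)] .

lemma even_convex_measurable:
  assumes "even_convex g" "f \<in> borel_measurable M"
  shows "(\<lambda>x. g (f x)) \<in> borel_measurable M"
  using measurable_compose[OF assms(2) borel_measurable_continuous_onI[OF even_convex_continuous[OF assms(1)]]] .

lemma even_convex_comp_scale:
  assumes "even_convex g"
  shows "even_convex (\<lambda>x. g (c * x))"
proof (rule even_convexI)
  fix u v x y :: real
  assume "0 \<le> u" "0 \<le> v" "u + v = 1"
  then have "g (u * (c * x) + v * (c * y)) \<le> u * g (c * x) + v * g (c * y)"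
    by (rule even_convexD(3)[OF assms])
  then show "g (c * (u * x + v * y)) \<le> u * g (c * x) + v * g (c * y)"
    by (simp add: algebra_simps)
qed (use even_convexD[OF assms] in auto)

lemma even_convex_max:
  assumes "even_convex g" "even_convex h"
  shows "even_convex (\<lambda>x. max (g x) (h x))"
proof (rule even_convexI)
  fix u v x y :: real
  assume uv: "0 \<le> u" "0 \<le> v" "u + v = 1"
  have "g (u * x + v * y) \<le> u * g x + v * g y" "h (u * x + v * y) \<le> u * h x + v * h y"
    using even_convexD(3) assms uv by blast+
  moreover have "u * g x \<le> u * max (g x) (h x)" "v * g y \<le> v * max (g y) (h y)"
    "u * h x \<le> u * max (g x) (h x)" "v * h y \<le> v * max (g y) (h y)"
    using uv by (auto intro: mult_left_mono)
  ultimately show "max (g (u * x + v * y)) (h (u * x + v * y)) \<le>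
      u * max (g x) (h x) + v * max (g y) (h y)"
    by linarith
qed (simp_all add: even_convexD(1,2)[OF assms(1)] even_convexD(1,2)[OF assms(2)])

lemma even_convex_abs_fun: "even_convex (\<lambda>x. \<bar>x\<bar>)"
proof (rule even_convexI)
  fix u v x y :: real
  assume "0 \<le> u" "0 \<le> v" "u + v = 1"
  then show "\<bar>u * x + v * y\<bar> \<le> u * \<bar>x\<bar> + v * \<bar>y\<bar>"
    using abs_triangle_ineq[of "u * x" "v * y"] by (simp add: abs_mult)
qed auto

lemma even_convex_SUP:
  fixes g :: "'i \<Rightarrow> real \<Rightarrow> real"
  assumes ne: "I \<noteq> {}" and ec: "\<And>i. i \<in> I \<Longrightarrow> even_convex (g i)"
    and bdd: "\<And>x. bdd_above ((\<lambda>i. g i x) ` I)"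
  shows "even_convex (\<lambda>x. SUP i\<in>I. g i x)"
proof (rule even_convexI)
  fix u v x y :: real
  assume uv: "0 \<le> u" "0 \<le> v" "u + v = 1"
  show "(SUP i\<in>I. g i (u * x + v * y)) \<le> u * (SUP i\<in>I. g i x) + v * (SUP i\<in>I. g i y)"
  proof (rule cSUP_least[OF ne])
    fix i assume i: "i \<in> I"
    have "g i (u * x + v * y) \<le> u * g i x + v * g i y"
      using even_convexD(3)[OF ec[OF i]] uv by blast
    also have "\<dots> \<le> u * (SUP i\<in>I. g i x) + v * (SUP i\<in>I. g i y)"
      using uv i bdd by (intro add_mono mult_left_mono cSUP_upper) auto
    finally show "g i (u * x + v * y) \<le> u * (SUP i\<in>I. g i x) + v * (SUP i\<in>I. g i y)" .
  qed
next
  fix x show "(SUP i\<in>I. g i (- x)) = (SUP i\<in>I. g i x)"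
    using even_convexD(1)[OF ec] by (intro SUP_cong) auto
next
  have "(SUP i\<in>I. g i 0) = (SUP i\<in>I. 0)"
    using even_convexD(2)[OF ec] by (intro SUP_cong) auto
  then show "(SUP i\<in>I. g i 0) = 0" using ne by simp
qed

lemma convex_supporting_line:
  fixes g :: "real \<Rightarrow> real"
  assumes "convex_on UNIV g"
  obtains m where "\<And>y. g y \<ge> g x + m * (y - x)"
  using convex_le_Inf_differential[OF assms, of x] that by auto

subsection \<open>Young functions and their conjugates\<close>

lemma young_function_even_convex: "young_function \<Phi> \<Longrightarrow> even_convex \<Phi>"
  by (simp add: young_function_def even_convex_def)

text \<open>Coercivity, kept apart from \<open>even_convex\<close> because the truncated conjugates
  below grow only linearly. The additive form integrates at once over a probability space to an L1
  bound in terms of the modular.\<close>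

definition superlinear :: "(real \<Rightarrow> real) \<Rightarrow> bool" where
  "superlinear g \<longleftrightarrow> (\<forall>K. \<exists>T. \<forall>y. K * \<bar>y\<bar> \<le> g y + T)"

lemma superlinearD:
  assumes "superlinear g"
  obtains T where "0 \<le> T" "\<And>y. K * \<bar>y\<bar> \<le> g y + T"
proof -
  obtain T where T: "\<And>y. K * \<bar>y\<bar> \<le> g y + T" using assms unfolding superlinear_def by blast
  have "K * \<bar>y\<bar> \<le> g y + max T 0" for y using T[of y] by linarith
  then show ?thesis using that[of "max T 0"] by simp
qed

lemma young_function_superlinear:
  assumes "young_function \<Phi>"
  shows "superlinear \<Phi>"
  unfolding superlinear_def
proof
  fix K :: real
  have ec: "even_convex \<Phi>" using assms by (rule young_function_even_convex)
  have "eventually (\<lambda>x. \<Phi> x / x \<ge> K) at_top"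
    using assms unfolding young_function_def filterlim_at_top by blast
  then obtain N where N: "\<And>x. x \<ge> N \<Longrightarrow> \<Phi> x / x \<ge> K" by (auto simp: eventually_at_top_linorder)
  have "K * \<bar>y\<bar> \<le> \<Phi> y + \<bar>K\<bar> * \<bar>max N 1\<bar>" for y
  proof (cases "\<bar>y\<bar> \<ge> max N 1")
    case True
    then have "K \<le> \<Phi> \<bar>y\<bar> / \<bar>y\<bar>" using N by simp
    then have "K * \<bar>y\<bar> \<le> \<Phi> y" using True even_convex_abs[OF ec] by (simp add: field_simps)
    then show ?thesis by (smt (verit) zero_le_mult_iff)
  next
    case False
    have "K * \<bar>y\<bar> \<le> \<bar>K\<bar> * \<bar>y\<bar>" by (intro mult_right_mono) auto
    also have "\<dots> \<le> \<bar>K\<bar> * \<bar>max N 1\<bar>" using False by (intro mult_left_mono) auto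
    finally show ?thesis using even_convex_nonneg[OF ec, of y] by linarith
  qed
  then show "\<exists>T. \<forall>y. K * \<bar>y\<bar> \<le> \<Phi> y + T" by blast
qed

text \<open>This is the conjugate of \<Phi> made infinite off \<open>X\<close>. For
  \<open>X = {-c..c}\<close> it is a convex minorant of the full conjugate with slopes at most
  \<open>c\<close>: a truncation that stays convex and grows linearly.\<close>

definition conjugate_on :: "real set \<Rightarrow> (real \<Rightarrow> real) \<Rightarrow> real \<Rightarrow> real" where
  "conjugate_on X \<Phi> y = (SUP x\<in>X. x * y - \<Phi> x)"

lemma young_conjugate_eq: "young_conjugate \<Phi> = conjugate_on UNIV \<Phi>"
  by (simp add: young_conjugate_def conjugate_on_def fun_eq_iff)

lemma conjugate_on_bdd:
  assumes "young_function \<Phi>"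
  shows "bdd_above ((\<lambda>x. x * y - \<Phi> x) ` X)"
proof -
  obtain T where T: "\<And>x. \<bar>y\<bar> * \<bar>x\<bar> \<le> \<Phi> x + T"
    using superlinearD[OF young_function_superlinear[OF assms]] by blast
  have "x * y - \<Phi> x \<le> T" for x
    using T[of x] abs_ge_self[of "x * y"] by (simp add: abs_mult mult.commute)
  then show ?thesis by (auto simp: bdd_above_def)
qed

lemma conjugate_on_ge:
  assumes "young_function \<Phi>" "x \<in> X"
  shows "x * y - \<Phi> x \<le> conjugate_on X \<Phi> y"
  unfolding conjugate_on_def using assms by (intro cSUP_upper conjugate_on_bdd)

lemma conjugate_on_least:
  assumes "X \<noteq> {}" "\<And>x. x \<in> X \<Longrightarrow> x * y - \<Phi> x \<le> c"
  shows "conjugate_on X \<Phi> y \<le> c"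
  unfolding conjugate_on_def using assms by (intro cSUP_least)

lemma conjugate_on_mono:
  assumes "young_function \<Phi>" "X \<subseteq> Y" "X \<noteq> {}"
  shows "conjugate_on X \<Phi> y \<le> conjugate_on Y \<Phi> y"
  using assms by (intro conjugate_on_least conjugate_on_ge) auto

lemma even_convex_conjugate_on:
  assumes \<Phi>: "young_function \<Phi>" and X: "0 \<in> X" "\<And>x. x \<in> X \<Longrightarrow> - x \<in> X"
  shows "even_convex (conjugate_on X \<Phi>)"
proof (rule even_convexI)
  note ec = young_function_even_convex[OF \<Phi>]
  have ne: "X \<noteq> {}" using X by blast
  have le: "conjugate_on X \<Phi> (- y) \<le> conjugate_on X \<Phi> y" for y
  proof (rule conjugate_on_least[OF ne])
    fix x assume "x \<in> X"
    then show "x * - y - \<Phi> x \<le> conjugate_on X \<Phi> y"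
      using conjugate_on_ge[OF \<Phi> X(2), of x y] even_convexD(1)[OF ec] by simp
  qed
  show "conjugate_on X \<Phi> (- y) = conjugate_on X \<Phi> y" for y
    using le[of y] le[of "- y"] by simp
  show "conjugate_on X \<Phi> 0 = 0"
    using conjugate_on_ge[OF \<Phi> X(1), of 0] even_convexD(2)[OF ec] even_convex_nonneg[OF ec]
    by (intro antisym conjugate_on_least[OF ne]) auto
  fix u v x y :: real
  assume uv: "0 \<le> u" "0 \<le> v" "u + v = 1"
  show "conjugate_on X \<Phi> (u * x + v * y) \<le> u * conjugate_on X \<Phi> x + v * conjugate_on X \<Phi> y"
  proof (rule conjugate_on_least[OF ne])
    fix z assume z: "z \<in> X"
    have "z * (u * x + v * y) - \<Phi> z = u * (z * x - \<Phi> z) + v * (z * y - \<Phi> z) + (u + v - 1) * \<Phi> z"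
      by (simp add: algebra_simps)
    also have "\<dots> = u * (z * x - \<Phi> z) + v * (z * y - \<Phi> z)" using uv by simp
    also have "\<dots> \<le> u * conjugate_on X \<Phi> x + v * conjugate_on X \<Phi> y"
      using uv z by (intro add_mono mult_left_mono conjugate_on_ge[OF \<Phi>]) auto
    finally show "z * (u * x + v * y) - \<Phi> z \<le> u * conjugate_on X \<Phi> x + v * conjugate_on X \<Phi> y" .
  qed
qed

lemma even_convex_young_conjugate: "young_function \<Phi> \<Longrightarrow> even_convex (young_conjugate \<Phi>)"
  unfolding young_conjugate_eq by (rule even_convex_conjugate_on) auto

text \<open>Only the term x = K of the supremum is used: since \<Phi> is finite,
  \<open>\<Phi> K\<close> is an admissible constant.\<close>

lemma young_conjugate_superlinear:
  assumes "young_function \<Phi>"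
  shows "superlinear (young_conjugate \<Phi>)"
  unfolding superlinear_def
proof
  fix K :: real
  have "K * \<bar>y\<bar> \<le> young_conjugate \<Phi> y + \<Phi> K" for y
    using conjugate_on_ge[OF assms UNIV_I, of K "\<bar>y\<bar>"]
    unfolding young_conjugate_eq[symmetric]
    by (simp add: even_convex_abs even_convex_young_conjugate assms)
  then show "\<exists>T. \<forall>y. K * \<bar>y\<bar> \<le> young_conjugate \<Phi> y + T" by blast
qed

lemma young_inequality:
  assumes "young_function \<Phi>"
  shows "\<bar>x * y\<bar> \<le> \<Phi> x + young_conjugate \<Phi> y"
  using conjugate_on_ge[OF assms UNIV_I, of "\<bar>x\<bar>" "\<bar>y\<bar>"]
  unfolding young_conjugate_eq[symmetric]
  by (simp add: even_convex_abs even_convex_young_conjugate young_function_even_convex assms abs_mult)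

text \<open>\<open>y\<close> is a subgradient of \<Phi> at \<open>x\<close>. Equality lets a bound
  involving the conjugate at a single point control \<Phi>, which is how the separating functional
  is shown to lie in the Orlicz space of \<Phi>.\<close>

lemma young_equality:
  assumes "young_function \<Phi>"
  obtains y where "\<Phi> x + young_conjugate \<Phi> y = x * y"
proof -
  obtain y where y: "\<And>z. \<Phi> z \<ge> \<Phi> x + y * (z - x)"
    using assms unfolding young_function_def by (metis convex_supporting_line)
  have "young_conjugate \<Phi> y \<le> x * y - \<Phi> x"
    unfolding young_conjugate_eq
    using y by (intro conjugate_on_least) (auto simp: algebra_simps)
  moreover have "x * y - \<Phi> x \<le> young_conjugate \<Phi> y"
    unfolding young_conjugate_eq using assms by (intro conjugate_on_ge) auto
  ultimately show ?thesis using that[of y] by simp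
qed

lemma conjugate_on_interval_le:
  assumes "young_function \<Phi>" "0 \<le> c"
  shows "conjugate_on {-c..c} \<Phi> y \<le> c * \<bar>y\<bar>"
proof (rule conjugate_on_least)
  fix x assume "x \<in> {-c..c}"
  then have "\<bar>x\<bar> * \<bar>y\<bar> \<le> c * \<bar>y\<bar>" by (intro mult_right_mono) auto
  then show "x * y - \<Phi> x \<le> c * \<bar>y\<bar>"
    using even_convex_nonneg[OF young_function_even_convex[OF assms(1)], of x]
      abs_ge_self[of "x * y"] by (simp add: abs_mult)
qed (use assms in auto)

text \<open>For fixed y the sequence is eventually constant: coercivity gives x * y - \<Phi> x \<le>
  T - |x|, so points with |x| \<ge> T do not beat the value 0 attained at the origin.\<close>

lemma conjugate_on_interval_tendsto:
  assumes \<Phi>: "young_function \<Phi>"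
  shows "(\<lambda>n. conjugate_on {- real n..real n} \<Phi> y) \<longlonglongrightarrow> young_conjugate \<Phi> y"
proof -
  obtain T where T: "\<And>x. (\<bar>y\<bar> + 1) * \<bar>x\<bar> \<le> \<Phi> x + T"
    using superlinearD[OF young_function_superlinear[OF \<Phi>]] by blast
  obtain N where N: "real N \<ge> T" using real_arch_simple by blast
  have "conjugate_on {- real n..real n} \<Phi> y = young_conjugate \<Phi> y" if n: "n \<ge> N" for n
  proof (rule antisym)
    show "conjugate_on {- real n..real n} \<Phi> y \<le> young_conjugate \<Phi> y"
      unfolding young_conjugate_eq using \<Phi> by (intro conjugate_on_mono) auto
    show "young_conjugate \<Phi> y \<le> conjugate_on {- real n..real n} \<Phi> y"
      unfolding young_conjugate_eq
    proof (rule conjugate_on_least)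
      fix x :: real
      show "x * y - \<Phi> x \<le> conjugate_on {- real n..real n} \<Phi> y"
      proof (cases "x \<in> {- real n..real n}")
        case True
        then show ?thesis by (intro conjugate_on_ge \<Phi>)
      next
        case False
        then have "\<bar>x\<bar> \<ge> T" using N n by auto
        then have "x * y - \<Phi> x \<le> 0"
          using T[of x] abs_ge_self[of "x * y"] by (simp add: abs_mult algebra_simps)
        also have "0 \<le> conjugate_on {- real n..real n} \<Phi> y"
          by (intro even_convex_nonneg even_convex_conjugate_on \<Phi>) auto
        finally show ?thesis .
      qed
    qed simp
  qed
  then show ?thesis by (intro tendsto_eventually) (auto simp: eventually_sequentially)
qed

text \<open>The dual form of the doubling condition; convexity alone would only give \<open>q = 1\<close>.\<close>

lemma young_conjugate_contract:
  assumes \<Phi>: "young_function \<Phi>" and d2: "Delta2 \<Phi>"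
  obtains q A where "0 < q" "q < 1" "0 \<le> A"
    "\<And>y. young_conjugate \<Phi> (2/3 * y) \<le> 2/3 * q * young_conjugate \<Phi> y + A * \<bar>y\<bar>"
proof -
  note ec = young_function_even_convex[OF \<Phi>]
  note ecF = even_convex_young_conjugate[OF \<Phi>]
  obtain K0 :: real where "Limsup at_top (\<lambda>x. ereal (\<Phi> (2 * x) / \<Phi> x)) < ereal K0"
    using d2 ereal_dense2 unfolding Delta2_def by metis
  then have "eventually (\<lambda>x. ereal (\<Phi> (2 * x) / \<Phi> x) < ereal K0) at_top"
    using Limsup_lessD by blast
  moreover have "eventually (\<lambda>x. \<Phi> x / x \<ge> 1) at_top"
    using \<Phi> unfolding young_function_def filterlim_at_top by blast
  moreover have "eventually (\<lambda>x::real. x > 0) at_top" by (rule eventually_gt_at_top)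
  ultimately have "eventually (\<lambda>x. \<Phi> (2 * x) \<le> K0 * \<Phi> x \<and> x > 0) at_top"
  proof eventually_elim
    case (elim x)
    then have "\<Phi> x > 0" by (smt (verit) divide_le_0_iff)
    then show ?case using elim by (simp add: field_simps)
  qed
  then obtain x0 where x0: "\<And>x. x \<ge> x0 \<Longrightarrow> \<Phi> (2 * x) \<le> K0 * \<Phi> x \<and> x > 0"
    by (auto simp: eventually_at_top_linorder)
  define K where "K = max K0 3"
  have K: "\<Phi> (2 * x) \<le> K * \<Phi> x" if "x \<ge> x0" for x
    using x0[OF that] even_convex_nonneg[OF ec, of x] mult_right_mono[of K0 K "\<Phi> x"]
    by (auto simp: K_def)
  have x0p: "x0 > 0" using x0 by blast
  \<comment> \<open>Since (1 + \<epsilon>) * |x| is a convex combination of |x| and 2 * |x|, its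
    \<Phi>-value is at most (1 + \<epsilon> * (K - 1)) * \<Phi> x. The choice makes this factor 3/2,
    the inverse of the dilation 2/3 in the claim; K \<ge> 3 keeps \<epsilon> \<le> 1.\<close>
  define \<epsilon> where "\<epsilon> = 1 / (2 * (K - 1))"
  have K3: "K \<ge> 3" by (simp add: K_def)
  have \<epsilon>: "0 < \<epsilon>" "\<epsilon> \<le> 1" "\<epsilon> * (K - 1) = 1/2" using K3 by (auto simp: \<epsilon>_def field_simps)
  define q where "q = 1 / (1 + \<epsilon>)"
  have q: "0 < q" "q < 1" "q * (1 + \<epsilon>) = 1" using \<epsilon> by (auto simp: q_def)
  have bound: "2/3 * (x * y) - \<Phi> x \<le> 2/3 * q * young_conjugate \<Phi> y + 2/3 * x0 * \<bar>y\<bar>" for x y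
  proof (cases "\<bar>x\<bar> \<ge> x0")
    case True
    have "\<Phi> ((1 + \<epsilon>) * \<bar>x\<bar>) = \<Phi> ((1 - \<epsilon>) * \<bar>x\<bar> + \<epsilon> * (2 * \<bar>x\<bar>))" by (simp add: algebra_simps)
    also have "\<dots> \<le> (1 - \<epsilon>) * \<Phi> \<bar>x\<bar> + \<epsilon> * \<Phi> (2 * \<bar>x\<bar>)"
      using \<epsilon> by (intro even_convexD(3)[OF ec]) auto
    also have "\<dots> \<le> (1 - \<epsilon>) * \<Phi> \<bar>x\<bar> + \<epsilon> * (K * \<Phi> \<bar>x\<bar>)"
      using \<epsilon> True K by (intro add_mono mult_left_mono) auto
    also have "\<dots> = (1 + \<epsilon> * (K - 1)) * \<Phi> x"
      using even_convex_abs[OF ec] by (simp add: algebra_simps)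
    also have "\<dots> = 3/2 * \<Phi> x" using \<epsilon> by simp
    finally have 1: "\<Phi> ((1 + \<epsilon>) * x) \<le> 3/2 * \<Phi> x"
      using even_convex_abs[OF ec, of "(1 + \<epsilon>) * x"] \<epsilon> by (simp add: abs_mult)
    have "(1 + \<epsilon>) * x * y - \<Phi> ((1 + \<epsilon>) * x) \<le> young_conjugate \<Phi> y"
      unfolding young_conjugate_eq using \<Phi> by (intro conjugate_on_ge) auto
    then have "q * ((1 + \<epsilon>) * x * y - 3/2 * \<Phi> x) \<le> q * young_conjugate \<Phi> y"
      using q 1 by (intro mult_left_mono) auto
    moreover have "q * ((1 + \<epsilon>) * x * y - 3/2 * \<Phi> x) = (q * (1 + \<epsilon>)) * (x * y) - 3/2 * q * \<Phi> x"
      by (simp add: algebra_simps)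
    ultimately have "x * y - 3/2 * q * \<Phi> x \<le> q * young_conjugate \<Phi> y" unfolding q(3) by linarith
    moreover have "q * \<Phi> x \<le> \<Phi> x"
      using q even_convex_nonneg[OF ec, of x] mult_right_mono[of q 1 "\<Phi> x"] by simp
    moreover have "0 \<le> 2/3 * x0 * \<bar>y\<bar>" using x0p by simp
    ultimately show ?thesis by (simp add: field_simps)
  next
    case False
    then have "x * y \<le> x0 * \<bar>y\<bar>"
      using abs_ge_self[of "x * y"] mult_right_mono[of "\<bar>x\<bar>" x0 "\<bar>y\<bar>"] by (simp add: abs_mult)
    moreover have "0 \<le> q * young_conjugate \<Phi> y"
      using q even_convex_nonneg[OF ecF, of y] by simp
    ultimately show ?thesis using even_convex_nonneg[OF ec, of x] by simp
  qed
  have "young_conjugate \<Phi> (2/3 * y) \<le> 2/3 * q * young_conjugate \<Phi> y + (2/3 * x0) * \<bar>y\<bar>" for y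
    unfolding young_conjugate_eq[of \<Phi>, THEN fun_cong, of "2/3 * y"]
    using bound[of _ y] by (intro conjugate_on_least) (auto simp: algebra_simps)
  then show ?thesis using that[of q "2/3 * x0"] q x0p by auto
qed

text \<open>Convexity applies to (x + y) / 2 = 3/4 * (2/3 * x) + 1/4 * (2 * y) and to the same
  identity with x and y exchanged; the one with the smaller value at scale 2 is kept. Since 3/4 *
  2/3 = 1/2, a factor q gained by g at the dilation 2/3 becomes a gain q over the plain midpoint
  bound, up to the overlap term \<open>min\<close>.\<close>

lemma even_convex_midpoint_min:
  assumes "even_convex g"
  shows "g ((x + y) / 2) \<le> 3/4 * g (2/3 * x) + 3/4 * g (2/3 * y) + 1/4 * min (g (2 * x)) (g (2 * y))"
proof -
  have *: "g ((x + y) / 2) \<le> 3/4 * g (2/3 * x) + 1/4 * g (2 * y)" for x y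
    using even_convexD(3)[OF assms, of "3/4" "1/4" "2/3 * x" "2 * y"] by (simp add: algebra_simps add_divide_distrib)
  show ?thesis
    using *[of x y] *[of y x] even_convex_nonneg[OF assms, of "2/3 * x"]
      even_convex_nonneg[OF assms, of "2/3 * y"]
    by (simp add: min_def add.commute split: if_splits)
qed

subsection \<open>Modulars and almost sure limits\<close>

text \<open>The bounds may vary with \<open>k\<close>, so that a minimising sequence passes its
  infimum on to the limit.\<close>

lemma nn_integral_Fatou_le:
  fixes h :: "nat \<Rightarrow> 'a \<Rightarrow> real" and c :: "nat \<Rightarrow> ennreal"
  assumes meas: "\<And>k. h k \<in> borel_measurable M"
    and lim: "AE \<omega> in M. (\<lambda>k. h k \<omega>) \<longlonglongrightarrow> h0 \<omega>"
    and le: "\<And>k. (\<integral>\<^sup>+\<omega>. ennreal (h k \<omega>) \<partial>M) \<le> c k" and c: "c \<longlonglongrightarrow> c0"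
  shows "(\<integral>\<^sup>+\<omega>. ennreal (h0 \<omega>) \<partial>M) \<le> c0"
proof -
  have "(\<integral>\<^sup>+\<omega>. ennreal (h0 \<omega>) \<partial>M) = (\<integral>\<^sup>+\<omega>. liminf (\<lambda>k. ennreal (h k \<omega>)) \<partial>M)"
  proof (rule nn_integral_cong_AE)
    show "AE \<omega> in M. ennreal (h0 \<omega>) = liminf (\<lambda>k. ennreal (h k \<omega>))"
      using lim
    proof eventually_elim
      case (elim \<omega>)
      then have "(\<lambda>k. ennreal (h k \<omega>)) \<longlonglongrightarrow> ennreal (h0 \<omega>)" by (rule tendsto_ennrealI)
      then show ?case by (metis lim_imp_Liminf sequentially_bot)
    qed
  qed
  also have "\<dots> \<le> liminf (\<lambda>k. \<integral>\<^sup>+\<omega>. ennreal (h k \<omega>) \<partial>M)"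
    using meas by (intro nn_integral_liminf) auto
  also have "\<dots> \<le> liminf c" using le by (intro Liminf_mono) auto
  also have "\<dots> = c0" using c by (metis lim_imp_Liminf sequentially_bot)
  finally show ?thesis .
qed

text \<open>Valued in \<open>ennreal\<close>: without doubling for \<open>g\<close> the modular may
  be infinite on the Orlicz space of \<open>g\<close>, and becomes finite only after a rescaling
  that depends on the function.\<close>

definition modular :: "'a measure \<Rightarrow> (real \<Rightarrow> real) \<Rightarrow> ('a \<Rightarrow> real) \<Rightarrow> ennreal" where
  "modular M g f = (\<integral>\<^sup>+\<omega>. ennreal (g (f \<omega>)) \<partial>M)"

lemma modular_mono:
  assumes "AE \<omega> in M. g (f \<omega>) \<le> h (f' \<omega>)"
  shows "modular M g f \<le> modular M h f'"
  unfolding modular_def using assms by (intro nn_integral_mono_AE) (auto intro: ennreal_leI)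

lemma modular_cong_AE:
  assumes "AE \<omega> in M. f \<omega> = f' \<omega>"
  shows "modular M g f = modular M g f'"
  unfolding modular_def using assms by (intro nn_integral_cong_AE) auto

lemma modular_Fatou:
  assumes "even_convex g" "\<And>k. f k \<in> borel_measurable M"
    "AE \<omega> in M. (\<lambda>k. f k \<omega>) \<longlonglongrightarrow> f0 \<omega>" "\<And>k. modular M g (f k) \<le> c k" "c \<longlonglongrightarrow> c0"
  shows "modular M g f0 \<le> c0"
  unfolding modular_def
proof (rule nn_integral_Fatou_le)
  show "(\<lambda>\<omega>. g (f k \<omega>)) \<in> borel_measurable M" for k
    by (rule even_convex_measurable[OF assms(1,2)])
  show "AE \<omega> in M. (\<lambda>k. g (f k \<omega>)) \<longlonglongrightarrow> g (f0 \<omega>)"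
    using assms(3) by eventually_elim (rule even_convex_tendsto[OF assms(1)])
  show "(\<integral>\<^sup>+\<omega>. ennreal (g (f k \<omega>)) \<partial>M) \<le> c k" for k using assms(4) by (simp add: modular_def)
qed (fact assms(5))

lemma modular_convex:
  assumes g: "even_convex g" and uv: "0 \<le> u" "0 \<le> v" "u + v = 1"
    and f: "f \<in> borel_measurable M" "f' \<in> borel_measurable M"
  shows "modular M g (\<lambda>\<omega>. u * f \<omega> + v * f' \<omega>) \<le> ennreal u * modular M g f + ennreal v * modular M g f'"
proof -
  have [measurable]: "(\<lambda>\<omega>. g (f \<omega>)) \<in> borel_measurable M" "(\<lambda>\<omega>. g (f' \<omega>)) \<in> borel_measurable M"
    using g f by (auto intro: even_convex_measurable)
  have "modular M g (\<lambda>\<omega>. u * f \<omega> + v * f' \<omega>) \<le>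
      (\<integral>\<^sup>+\<omega>. ennreal u * ennreal (g (f \<omega>)) + ennreal v * ennreal (g (f' \<omega>)) \<partial>M)"
    unfolding modular_def
  proof (rule nn_integral_mono)
    fix \<omega>
    have "ennreal (g (u * f \<omega> + v * f' \<omega>)) \<le> ennreal (u * g (f \<omega>) + v * g (f' \<omega>))"
      using even_convexD(3)[OF g uv] by (rule ennreal_leI)
    also have "\<dots> = ennreal u * ennreal (g (f \<omega>)) + ennreal v * ennreal (g (f' \<omega>))"
      using uv even_convex_nonneg[OF g] by (simp add: ennreal_plus ennreal_mult)
    finally show "ennreal (g (u * f \<omega> + v * f' \<omega>)) \<le> ennreal u * ennreal (g (f \<omega>)) + ennreal v * ennreal (g (f' \<omega>))" .
  qed
  also have "\<dots> = ennreal u * modular M g f + ennreal v * modular M g f'"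
    unfolding modular_def by (simp add: nn_integral_add nn_integral_cmult)
  finally show ?thesis .
qed

lemma modular_convex_le:
  assumes g: "even_convex g" and uv: "0 \<le> u" "0 \<le> v" "u + v = 1"
    and f: "f \<in> borel_measurable M" "f' \<in> borel_measurable M"
    and le: "modular M g f \<le> c" "modular M g f' \<le> c"
  shows "modular M g (\<lambda>\<omega>. u * f \<omega> + v * f' \<omega>) \<le> c"
proof -
  have "modular M g (\<lambda>\<omega>. u * f \<omega> + v * f' \<omega>) \<le> ennreal u * c + ennreal v * c"
    using modular_convex[OF g uv f] le by (meson add_mono mult_left_mono order_trans zero_le)
  also have "\<dots> = (ennreal u + ennreal v) * c" by (simp add: distrib_right)
  also have "ennreal u + ennreal v = 1" using uv by (simp flip: ennreal_plus)
  finally show ?thesis by simp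
qed

lemma AE_summable_abs:
  fixes d :: "nat \<Rightarrow> 'a \<Rightarrow> real"
  assumes [measurable]: "\<And>k. d k \<in> borel_measurable M"
    and le: "\<And>k. (\<integral>\<^sup>+\<omega>. ennreal \<bar>d k \<omega>\<bar> \<partial>M) \<le> ennreal (e k)"
    and e: "summable e" "\<And>k. 0 \<le> e k"
  shows "AE \<omega> in M. summable (\<lambda>k. \<bar>d k \<omega>\<bar>)"
proof -
  have "(\<integral>\<^sup>+\<omega>. (\<Sum>k. ennreal \<bar>d k \<omega>\<bar>) \<partial>M) = (\<Sum>k. \<integral>\<^sup>+\<omega>. ennreal \<bar>d k \<omega>\<bar> \<partial>M)"
    by (intro nn_integral_suminf) auto
  also have "\<dots> \<le> (\<Sum>k. ennreal (e k))" using le by (intro suminf_le) auto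
  also have "\<dots> < \<infinity>" using e by (simp add: suminf_ennreal2 ennreal_less_top)
  finally have "AE \<omega> in M. (\<Sum>k. ennreal \<bar>d k \<omega>\<bar>) \<noteq> \<infinity>"
    by (intro nn_integral_noteq_infinite) auto
  then show ?thesis
    by eventually_elim (rule summable_suminf_not_top, auto)
qed

lemma AE_tendsto_0_abs:
  fixes d :: "nat \<Rightarrow> 'a \<Rightarrow> real"
  assumes "\<And>k. d k \<in> borel_measurable M"
    and "\<And>k. (\<integral>\<^sup>+\<omega>. ennreal \<bar>d k \<omega>\<bar> \<partial>M) \<le> ennreal (e k)"
    and "summable e" "\<And>k. 0 \<le> e k"
  shows "AE \<omega> in M. (\<lambda>k. d k \<omega>) \<longlonglongrightarrow> 0"
  using AE_summable_abs[OF assms]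
  by eventually_elim (metis summable_LIMSEQ_zero tendsto_rabs_zero_iff)

context prob_space
begin

lemma nn_integral_le_modular:
  assumes g: "even_convex g" and T: "\<And>y. K * \<bar>y\<bar> \<le> g y + T" and "0 \<le> T" "0 < K"
    and f: "f \<in> borel_measurable M" and le: "modular M g f \<le> ennreal c" "0 \<le> c"
  shows "(\<integral>\<^sup>+\<omega>. ennreal \<bar>f \<omega>\<bar> \<partial>M) \<le> ennreal ((c + T) / K)"
proof -
  have [measurable]: "(\<lambda>\<omega>. g (f \<omega>)) \<in> borel_measurable M" by (rule even_convex_measurable[OF g f])
  have "(\<integral>\<^sup>+\<omega>. ennreal \<bar>f \<omega>\<bar> \<partial>M) \<le> (\<integral>\<^sup>+\<omega>. ennreal (1/K) * (ennreal (g (f \<omega>)) + ennreal T) \<partial>M)"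
  proof (rule nn_integral_mono)
    fix \<omega>
    have "\<bar>f \<omega>\<bar> \<le> (1/K) * (g (f \<omega>) + T)" using T[of "f \<omega>"] \<open>0 < K\<close> by (simp add: field_simps)
    then show "ennreal \<bar>f \<omega>\<bar> \<le> ennreal (1/K) * (ennreal (g (f \<omega>)) + ennreal T)"
      using even_convex_nonneg[OF g] assms by (metis ennreal_leI ennreal_mult' ennreal_plus zero_le_divide_1_iff less_imp_le)
  qed
  also have "\<dots> = ennreal (1/K) * (modular M g f + ennreal T)"
    unfolding modular_def by (simp add: nn_integral_cmult nn_integral_add emeasure_space_1)
  also have "\<dots> \<le> ennreal (1/K) * (ennreal c + ennreal T)"
    using le by (intro mult_left_mono add_right_mono) auto
  also have "\<dots> = ennreal ((c + T) / K)"
    using assms by (simp add: ennreal_plus[symmetric] ennreal_mult'[symmetric] del: ennreal_plus)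
  finally show ?thesis .
qed

text \<open>De la Vallee-Poussin: superlinear growth and bounded modulars give uniform
  integrability. In \<open>split\<close> the truncated part tends to 0 by dominated convergence, and
  the rest costs at most \<epsilon> / 2 because the modulars are at most 1.\<close>

lemma Vitali_modular:
  assumes g: "even_convex g" "superlinear g" and u: "\<And>k. u k \<in> borel_measurable M"
    and lim: "AE \<omega> in M. (\<lambda>k. u k \<omega>) \<longlonglongrightarrow> 0" and le: "\<And>k. modular M g (u k) \<le> 1"
    and \<epsilon>: "0 < \<epsilon>"
  shows "\<exists>k. (\<integral>\<^sup>+\<omega>. ennreal \<bar>u k \<omega>\<bar> \<partial>M) \<le> ennreal \<epsilon>"
proof -
  have [measurable]: "\<And>k. (\<lambda>\<omega>. g (u k \<omega>)) \<in> borel_measurable M" "\<And>k. u k \<in> borel_measurable M"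
    using u by (auto intro: even_convex_measurable[OF g(1)])
  obtain T where T: "0 \<le> T" "\<And>y. 2 * 2 / \<epsilon> * \<bar>y\<bar> \<le> g y + T" using superlinearD[OF g(2)] by blast
  have split: "\<bar>y\<bar> \<le> min \<bar>y\<bar> (T * \<epsilon>) + \<epsilon> / 2 * g y" for y
  proof (cases "\<bar>y\<bar> \<le> T * \<epsilon>")
    case True
    then show ?thesis using even_convex_nonneg[OF g(1), of y] \<epsilon> by simp
  next
    case False
    have 1: "\<bar>y\<bar> \<le> \<epsilon> / 4 * g y + \<epsilon> / 4 * T" using T(2)[of y] \<epsilon> by (simp add: field_simps)
    have "0 \<le> \<epsilon> * T" "0 \<le> \<epsilon> * g y" using \<epsilon> T even_convex_nonneg[OF g(1)] by auto
    then show ?thesis using 1 False by (simp add: field_simps)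
  qed
  have "(\<lambda>k. \<integral>\<^sup>+\<omega>. ennreal (min \<bar>u k \<omega>\<bar> (T * \<epsilon>)) \<partial>M) \<longlonglongrightarrow> (\<integral>\<^sup>+\<omega>. 0 \<partial>M)"
  proof (rule nn_integral_dominated_convergence[where w="\<lambda>_. ennreal (T * \<epsilon>)"])
    show "AE \<omega> in M. (\<lambda>k. ennreal (min \<bar>u k \<omega>\<bar> (T * \<epsilon>))) \<longlonglongrightarrow> 0"
      using lim
    proof eventually_elim
      case (elim \<omega>)
      have "(\<lambda>k. min \<bar>u k \<omega>\<bar> (T * \<epsilon>)) \<longlonglongrightarrow> min \<bar>0\<bar> (T * \<epsilon>)"
        by (intro tendsto_intros elim)
      then have "(\<lambda>k. min \<bar>u k \<omega>\<bar> (T * \<epsilon>)) \<longlonglongrightarrow> 0" using T \<epsilon> by simp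
      then show ?case using tendsto_ennrealI[of _ 0] by fastforce
    qed
    show "(\<integral>\<^sup>+\<omega>. ennreal (T * \<epsilon>) \<partial>M) < \<infinity>"
      by (simp add: emeasure_space_1)
    show "AE \<omega> in M. ennreal (min \<bar>u j \<omega>\<bar> (T * \<epsilon>)) \<le> ennreal (T * \<epsilon>)" for j
      by (intro AE_I2 ennreal_leI) simp
  qed auto
  then have "eventually (\<lambda>k. (\<integral>\<^sup>+\<omega>. ennreal (min \<bar>u k \<omega>\<bar> (T * \<epsilon>)) \<partial>M) < ennreal (\<epsilon> / 2)) sequentially"
    using \<epsilon> by (intro order_tendstoD(2)[where y="\<integral>\<^sup>+\<omega>. 0 \<partial>M"]) auto
  then obtain k where k: "(\<integral>\<^sup>+\<omega>. ennreal (min \<bar>u k \<omega>\<bar> (T * \<epsilon>)) \<partial>M) < ennreal (\<epsilon> / 2)"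
    by (auto simp: eventually_sequentially)
  have "(\<integral>\<^sup>+\<omega>. ennreal \<bar>u k \<omega>\<bar> \<partial>M) \<le>
      (\<integral>\<^sup>+\<omega>. ennreal (min \<bar>u k \<omega>\<bar> (T * \<epsilon>)) + ennreal (\<epsilon> / 2) * ennreal (g (u k \<omega>)) \<partial>M)"
  proof (rule nn_integral_mono)
    fix \<omega>
    have "ennreal \<bar>u k \<omega>\<bar> \<le> ennreal (min \<bar>u k \<omega>\<bar> (T * \<epsilon>) + \<epsilon> / 2 * g (u k \<omega>))"
      using split by (rule ennreal_leI)
    also have "\<dots> = ennreal (min \<bar>u k \<omega>\<bar> (T * \<epsilon>)) + ennreal (\<epsilon> / 2 * g (u k \<omega>))"
      using even_convex_nonneg[OF g(1)] \<epsilon> T by (intro ennreal_plus) auto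
    also have "ennreal (\<epsilon> / 2 * g (u k \<omega>)) = ennreal (\<epsilon> / 2) * ennreal (g (u k \<omega>))"
      using even_convex_nonneg[OF g(1)] \<epsilon> by (intro ennreal_mult) auto
    finally show "ennreal \<bar>u k \<omega>\<bar> \<le> ennreal (min \<bar>u k \<omega>\<bar> (T * \<epsilon>)) + ennreal (\<epsilon> / 2) * ennreal (g (u k \<omega>))" .
  qed
  also have "\<dots> = (\<integral>\<^sup>+\<omega>. ennreal (min \<bar>u k \<omega>\<bar> (T * \<epsilon>)) \<partial>M) + ennreal (\<epsilon> / 2) * modular M g (u k)"
    unfolding modular_def by (subst nn_integral_add) (auto simp: nn_integral_cmult)
  also have "\<dots> \<le> ennreal (\<epsilon> / 2) + ennreal (\<epsilon> / 2) * 1"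
    using k le by (intro add_mono mult_left_mono) auto
  also have "\<dots> = ennreal \<epsilon>" using \<epsilon> by (simp flip: ennreal_plus)
  finally show ?thesis by blast
qed

end

section \<open>Strong convexity of sqrt (1 + y^2) and almost sure convergence\<close>

text \<open>The right-hand side is the Bregman distance of sqrt (1 + y^2). It equals a * S / 2,
  where S is the squared distance between the unit vectors (1, x) / a and (1, z) / b. Then a \<ge> 1
  is used, and the left-hand side keeps only the second coordinate.\<close>

lemma sqrt_bregman:
  fixes x z :: real
  shows "(x / sqrt (1 + x\<^sup>2) - z / sqrt (1 + z\<^sup>2))\<^sup>2 / 2
    \<le> sqrt (1 + x\<^sup>2) - sqrt (1 + z\<^sup>2) - z / sqrt (1 + z\<^sup>2) * (x - z)"
proof -
  define a b where "a = sqrt (1 + x\<^sup>2)" and "b = sqrt (1 + z\<^sup>2)"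
  have a: "a \<ge> 1" "a\<^sup>2 = 1 + x\<^sup>2" and b: "b \<ge> 1" "b\<^sup>2 = 1 + z\<^sup>2" by (auto simp: a_def b_def)
  define S where "S = (1/a - 1/b)\<^sup>2 + (x/a - z/b)\<^sup>2"
  have unit: "1/a^2 + x^2/a^2 = 1" "1/b^2 + z^2/b^2 = 1"
    unfolding add_divide_distrib[symmetric] a(2)[symmetric] b(2)[symmetric] using a(1) b(1) by auto
  have "S = (1/a^2 + x^2/a^2) + (1/b^2 + z^2/b^2) - 2 * (1 + x*z) / (a*b)"
    unfolding S_def by (simp add: power2_diff power_divide add_divide_distrib algebra_simps)
  then have S: "S = 2 - 2 * (1 + x*z) / (a*b)" using unit by simp
  have "a - b - z / b * (x - z) = a - (b^2 + z*x - z^2) / b"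
    using b by (simp add: field_simps power2_eq_square)
  also have "\<dots> = a - (1 + x*z) / b" using b by (simp add: mult.commute)
  also have "\<dots> = a * (S / 2)" unfolding S using a b by (simp add: field_simps)
  finally have "a - b - z / b * (x - z) = a * (S / 2)" .
  moreover have "1 * (S/2) \<le> a * (S / 2)" using a by (intro mult_right_mono) (auto simp: S_def)
  moreover have "(x/a - z/b)\<^sup>2 \<le> S" by (simp add: S_def)
  ultimately show ?thesis unfolding a_def[symmetric] b_def[symmetric] by linarith
qed

text \<open>\<open>sqrt_bregman\<close> is applied with the midpoint z as base point, to x and to y,
  so that the linear terms cancel. The resulting convexity gain is measured in the derivative and
  not in x - y, because sqrt (1 + y^2) is nearly linear far out.\<close>

lemma sqrt_midpoint_gap:
  fixes x y :: real
  shows "(x / sqrt (1 + x\<^sup>2) - y / sqrt (1 + y\<^sup>2))\<^sup>2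
    \<le> 8 * (sqrt (1 + x\<^sup>2) / 2 + sqrt (1 + y\<^sup>2) / 2 - sqrt (1 + ((x + y) / 2)\<^sup>2))"
proof -
  define z where "z = (x + y) / 2"
  define t where "t = z / sqrt (1 + z\<^sup>2)"
  have "(x / sqrt (1 + x\<^sup>2) - t)\<^sup>2 / 2 \<le> sqrt (1 + x\<^sup>2) - sqrt (1 + z\<^sup>2) - t * (x - z)"
    "(y / sqrt (1 + y\<^sup>2) - t)\<^sup>2 / 2 \<le> sqrt (1 + y\<^sup>2) - sqrt (1 + z\<^sup>2) - t * (y - z)"
    unfolding t_def by (rule sqrt_bregman)+
  moreover have "t * (y - z) = - (t * (x - z))" by (simp add: z_def field_simps)
  moreover have "(a - b)\<^sup>2 \<le> 2 * ((a - t)\<^sup>2 + (b - t)\<^sup>2)" for a b :: real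
    using zero_le_power2[of "a + b - 2 * t"] by (simp add: power2_eq_square algebra_simps)
  then have "(x / sqrt (1 + x\<^sup>2) - y / sqrt (1 + y\<^sup>2))\<^sup>2
      \<le> 2 * ((x / sqrt (1 + x\<^sup>2) - t)\<^sup>2 + (y / sqrt (1 + y\<^sup>2) - t)\<^sup>2)" .
  moreover have "W \<le> 8 * (X / 2 + Y / 2 - Z)"
    if "P / 2 \<le> X - Z - r" "Q / 2 \<le> Y - Z - r'" "r' = - r" "W \<le> 2 * (P + Q)" for P Q W X Y Z r r' :: real
    using that by argo
  ultimately show ?thesis unfolding z_def[symmetric] by blast
qed

text \<open>The transform is a homeomorphism of the line onto (-1, 1), so the only obstacle is a
  limit of modulus 1. A finite \<open>liminf\<close> excludes it: |g j| < K for infinitely many j,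
  which keeps the limit in [-q, q]. The hypothesis has this form because a finite
  \<open>liminf\<close> is what Fatou delivers.\<close>

lemma tendsto_of_bounded_transform:
  fixes g :: "nat \<Rightarrow> real"
  assumes conv: "convergent (\<lambda>j. g j / sqrt (1 + (g j)\<^sup>2))"
    and fin: "liminf (\<lambda>j. ennreal \<bar>g j\<bar>) \<noteq> \<infinity>"
  shows "convergent g"
proof -
  define T where "T y = y / sqrt (1 + y\<^sup>2)" for y :: real
  have T1: "\<bar>T y\<bar> = sqrt (1 - 1 / (1 + y\<^sup>2))" for y
  proof -
    have "1 + y\<^sup>2 \<noteq> 0" by (smt (verit) zero_le_power2)
    then have "1 - 1 / (1 + y\<^sup>2) = y\<^sup>2 / (1 + y\<^sup>2)" by (simp add: field_simps)
    then show ?thesis by (simp add: T_def real_sqrt_divide)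
  qed
  have inv: "y = T y / sqrt (1 - (T y)\<^sup>2)" for y
  proof -
    have p: "1 + y\<^sup>2 > 0" by (smt (verit) zero_le_power2)
    have "(T y)\<^sup>2 = 1 - 1 / (1 + y\<^sup>2)"
      using p by (simp add: T_def power_divide field_simps)
    then have "1 - (T y)\<^sup>2 = 1 / (1 + y\<^sup>2)" by simp
    then have "sqrt (1 - (T y)\<^sup>2) = 1 / sqrt (1 + y\<^sup>2)" by (simp add: real_sqrt_divide)
    then show ?thesis using p by (simp add: T_def)
  qed
  obtain t where t: "(\<lambda>j. T (g j)) \<longlonglongrightarrow> t" using conv by (auto simp: convergent_def T_def)
  obtain r where r: "liminf (\<lambda>j. ennreal \<bar>g j\<bar>) = ennreal r" "0 \<le> r"
    using fin by (cases "liminf (\<lambda>j. ennreal \<bar>g j\<bar>)") auto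
  define K where "K = r + 1"
  have K: "liminf (\<lambda>j. ennreal \<bar>g j\<bar>) < ennreal K" "0 \<le> K"
    using r by (auto simp: K_def ennreal_less_iff)
  have freq: "\<exists>\<^sub>F j in sequentially. \<bar>g j\<bar> < K"
  proof (rule ccontr)
    assume "\<not> ?thesis"
    then have "\<forall>\<^sub>F j in sequentially. ennreal K \<le> ennreal \<bar>g j\<bar>"
      by (auto simp: not_frequently not_less intro: ennreal_leI elim: eventually_mono)
    then have "ennreal K \<le> liminf (\<lambda>j. ennreal \<bar>g j\<bar>)" by (rule Liminf_bounded)
    then show False using K by simp
  qed
  define q where "q = sqrt (1 - 1 / (1 + K\<^sup>2))"
  have q: "q < 1"
  proof -
    have "0 < 1 / (1 + K\<^sup>2)" by (smt (verit) zero_le_power2 divide_pos_pos)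
    then show ?thesis unfolding q_def by simp
  qed
  have "\<bar>t\<bar> \<le> q"
  proof (rule ccontr)
    assume "\<not> ?thesis"
    then have "\<forall>\<^sub>F j in sequentially. q < \<bar>T (g j)\<bar>"
      using order_tendstoD(1)[OF tendsto_rabs[OF t]] by auto
    with freq have "\<exists>\<^sub>F j in sequentially. \<bar>g j\<bar> < K \<and> q < \<bar>T (g j)\<bar>"
      by (rule frequently_eventually_frequently)
    then obtain j where j: "\<bar>g j\<bar> < K" "q < \<bar>T (g j)\<bar>" using frequently_ex by blast
    have "(g j)\<^sup>2 \<le> K\<^sup>2" using j(1) by (simp add: abs_le_square_iff[symmetric])
    then have "1 / (1 + K\<^sup>2) \<le> 1 / (1 + (g j)\<^sup>2)"
      by (smt (verit) frac_le zero_le_power2)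
    then have "\<bar>T (g j)\<bar> \<le> q" unfolding T1 q_def by simp
    then show False using j by simp
  qed
  then have "\<bar>t\<bar> < 1" using q by simp
  then have "t\<^sup>2 < 1" by (simp add: abs_square_less_1)
  then have "sqrt (1 - t\<^sup>2) \<noteq> 0" by simp
  then have "(\<lambda>j. T (g j) / sqrt (1 - (T (g j))\<^sup>2)) \<longlonglongrightarrow> t / sqrt (1 - t\<^sup>2)"
    by (intro tendsto_intros t)
  then show ?thesis unfolding inv[symmetric] convergent_def by blast
qed

lemma convergent_of_summable_increments:
  fixes x :: "nat \<Rightarrow> real"
  assumes "summable (\<lambda>k. \<bar>x (Suc k) - x k\<bar>)"
  shows "convergent x"
proof -
  have "summable (\<lambda>k. x (Suc k) - x k)" using assms by (rule summable_rabs_cancel)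
  then have "convergent (\<lambda>n. \<Sum>k<n. x (Suc k) - x k)" by (simp add: summable_iff_convergent)
  then have "convergent (\<lambda>n. x n - x 0)" by (simp add: sum_lessThan_telescope)
  then have "convergent (\<lambda>n. (x n - x 0) + x 0)" by (rule convergent_add) (rule convergent_const)
  then show ?thesis by simp
qed

text \<open>A substitute for Komlos' theorem. Near-minimisers of $E \sqrt{1 + f^2}$ over the sets
  \<open>D k\<close> are Cauchy in the bounded transform $f / \sqrt{1 + f^2}$, the derivative of the integrand.\<close>

lemma (in prob_space) decreasing_convex_AE_convergent:
  fixes D :: "nat \<Rightarrow> ('a \<Rightarrow> real) set" and B :: real
  assumes ne: "\<And>k. D k \<noteq> {}" and dec: "decseq D"
    and mid: "\<And>k f g. f \<in> D k \<Longrightarrow> g \<in> D k \<Longrightarrow> (\<lambda>\<omega>. (f \<omega> + g \<omega>) / 2) \<in> D k"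
    and meas: "\<And>k f. f \<in> D k \<Longrightarrow> f \<in> borel_measurable M"
    and bnd: "\<And>k f. f \<in> D k \<Longrightarrow> (\<integral>\<^sup>+\<omega>. ennreal \<bar>f \<omega>\<bar> \<partial>M) \<le> ennreal B"
  obtains f f0 where "\<And>k. f k \<in> D k" "f0 \<in> borel_measurable M"
    "AE \<omega> in M. (\<lambda>k. f k \<omega>) \<longlonglongrightarrow> f0 \<omega>"
proof -
  define \<phi> :: "real \<Rightarrow> real" where "\<phi> y = sqrt (1 + y\<^sup>2)" for y
  define T :: "real \<Rightarrow> real" where "T y = y / sqrt (1 + y\<^sup>2)" for y
  define I where "I f = (\<integral>\<omega>. \<phi> (f \<omega>) \<partial>M)" for f
  have \<phi>_le: "\<phi> y \<le> 1 + \<bar>y\<bar>" for y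
    unfolding \<phi>_def by (rule real_le_lsqrt) (auto simp: power2_eq_square algebra_simps abs_mult_self_eq)
  have \<phi>_0: "0 \<le> \<phi> y" for y by (simp add: \<phi>_def)
  have [measurable]: "\<phi> \<in> borel_measurable borel" "T \<in> borel_measurable borel"
    unfolding \<phi>_def T_def by measurable
  have B: "0 \<le> max B 0" by simp
  have intf: "integrable M f" if "f \<in> D k" for f k
    using meas[OF that] le_less_trans[OF bnd[OF that] ennreal_less_top]
    by (simp add: integrable_iff_bounded)
  have int\<phi>: "integrable M (\<lambda>\<omega>. \<phi> (f \<omega>))" if "f \<in> D k" for f k
  proof (rule Bochner_Integration.integrable_bound)
    show "integrable M (\<lambda>\<omega>. 1 + \<bar>f \<omega>\<bar>)" using intf[OF that] by auto
    show "(\<lambda>\<omega>. \<phi> (f \<omega>)) \<in> borel_measurable M" using meas[OF that] by measurable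
  qed (use \<phi>_le \<phi>_0 in auto)
  have I0: "0 \<le> I f" for f unfolding I_def using \<phi>_0 by simp
  have IB: "I f \<le> 1 + max B 0" if "f \<in> D k" for f k
  proof -
    have "ennreal (\<integral>\<omega>. \<bar>f \<omega>\<bar> \<partial>M) \<le> ennreal B"
      using bnd[OF that] intf[OF that] by (subst nn_integral_eq_integral[symmetric]) auto
    then have "(\<integral>\<omega>. \<bar>f \<omega>\<bar> \<partial>M) \<le> max B 0"
      by (smt (verit) B ennreal_le_iff ennreal_leI order_trans)
    moreover have "I f \<le> (\<integral>\<omega>. 1 + \<bar>f \<omega>\<bar> \<partial>M)"
      unfolding I_def using int\<phi>[OF that] intf[OF that] \<phi>_le by (intro integral_mono) auto
    ultimately show ?thesis using intf[OF that] by (simp add: prob_space)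
  qed
  define m where "m k = (INF f\<in>D k. I f)" for k
  have bddb: "bdd_below (I ` D k)" for k using I0 by (auto simp: bdd_below_def)
  have m_le: "m k \<le> I f" if "f \<in> D k" for f k
    unfolding m_def using that bddb by (intro cINF_lower) auto
  have "incseq m"
    unfolding incseq_def m_def
    using dec ne bddb by (auto simp: decseq_def intro!: cINF_superset_mono)
  moreover have mB: "m k \<le> 1 + max B 0" for k
    using ne[of k] m_le IB by (metis ex_in_conv order_trans)
  ultimately have lim_m: "m \<longlonglongrightarrow> (SUP k. m k)" by (intro LIMSEQ_incseq_SUP) (auto simp: bdd_above_def)
  define m0 where "m0 = (SUP k. m k)"
  have m_m0: "m k \<le> m0" for k
    unfolding m0_def using mB by (intro cSUP_upper) (auto simp: bdd_above_def)
  have "\<exists>N. \<forall>k\<ge>N. m k \<ge> m0 - (1/4)^j" for j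
  proof -
    have "m0 - (1/4)^j < m0" by simp
    then have "eventually (\<lambda>k. m0 - (1/4)^j < m k) sequentially"
      using lim_m unfolding m0_def by (rule order_tendstoD(1)[rotated])
    then show ?thesis unfolding eventually_sequentially by (meson less_imp_le)
  qed
  then obtain N where N: "\<And>j k. k \<ge> N j \<Longrightarrow> m k \<ge> m0 - (1/4)^j" by metis
  \<comment> \<open>Adding \<open>j\<close> and summing makes \<open>n\<close> increasing with
    \<open>n j\<close> at least both \<open>N j\<close> and \<open>j\<close>: consecutive terms can
    be averaged inside \<open>D (n j)\<close>, and \<open>f j\<close> still lies in
    \<open>D j\<close>.\<close>
  define n where "n j = j + (\<Sum>i\<le>j. N i)" for j
  have n_ge: "n j \<ge> N j" "n j \<ge> j" for j
    unfolding n_def using member_le_sum[of j "{..j}" N] by auto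
  have n_mono: "n j \<le> n (Suc j)" for j unfolding n_def by simp
  have "\<exists>f\<in>D (n j). I f < m (n j) + (1/4)^j" for j
    using cInf_lessD[of "I ` D (n j)" "m (n j) + (1/4)^j"] ne unfolding m_def by auto
  then obtain f where f: "\<And>j. f j \<in> D (n j)" "\<And>j. I (f j) < m (n j) + (1/4)^j" by metis
  have fD: "f j \<in> D j" for j using f(1) dec n_ge unfolding decseq_def by blast
  have [measurable]: "f j \<in> borel_measurable M" for j using meas fD by blast
  define d where "d j \<omega> = T (f (Suc j) \<omega>) - T (f j \<omega>)" for j \<omega>
  have d_bound: "(\<integral>\<^sup>+\<omega>. ennreal \<bar>d j \<omega>\<bar> \<partial>M) \<le> ennreal (9 * (1/2)^j)" for j
  proof -
    define gap where "gap \<omega> = \<phi> (f (Suc j) \<omega>) / 2 + \<phi> (f j \<omega>) / 2 - \<phi> ((f (Suc j) \<omega> + f j \<omega>) / 2)" for \<omega>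
    have midD: "(\<lambda>\<omega>. (f (Suc j) \<omega> + f j \<omega>) / 2) \<in> D (n j)"
      using f(1) dec n_mono[of j] by (intro mid) (auto simp: decseq_def)
    have int_gap: "integrable M gap"
      unfolding gap_def using int\<phi>[OF fD[of "Suc j"]] int\<phi>[OF fD[of j]] int\<phi>[OF midD] by auto
    have "(\<integral>\<omega>. gap \<omega> \<partial>M) = I (f (Suc j)) / 2 + I (f j) / 2 - I (\<lambda>\<omega>. (f (Suc j) \<omega> + f j \<omega>) / 2)"
      unfolding gap_def I_def using int\<phi>[OF fD[of "Suc j"]] int\<phi>[OF fD[of j]] int\<phi>[OF midD] by simp
    also have "\<dots> \<le> (m0 + (1/4)^j) / 2 + (m0 + (1/4)^j) / 2 - (m0 - (1/4)^j)"
    proof -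
      have "(1/4::real) ^ Suc j \<le> (1/4) ^ j" by simp
      then have "I (f (Suc j)) \<le> m0 + (1/4)^j" "I (f j) \<le> m0 + (1/4)^j"
        using f(2)[of "Suc j"] f(2)[of j] m_m0[of "n j"] m_m0[of "n (Suc j)"] by argo+
      moreover have "m0 - (1/4)^j \<le> I (\<lambda>\<omega>. (f (Suc j) \<omega> + f j \<omega>) / 2)"
        using m_le[OF midD] N[OF n_ge(1), of j] by (rule order_trans[rotated])
      ultimately show ?thesis by (intro diff_mono add_mono divide_right_mono) auto
    qed
    finally have gap2: "(\<integral>\<omega>. gap \<omega> \<partial>M) \<le> 2 * (1/4)^j" by simp
    \<comment> \<open>Weighted arithmetic-geometric mean: the gap integrates to O(4^-j), and the
      weight 2^j balances the two terms, so that both are of order 2^-j and hence summable.\<close>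
    have pt: "\<bar>d j \<omega>\<bar> \<le> (1/2)^j / 2 + 4 * 2^j * gap \<omega>" for \<omega>
    proof -
      have "(d j \<omega>)\<^sup>2 \<le> 8 * gap \<omega>" unfolding d_def gap_def \<phi>_def T_def by (rule sqrt_midpoint_gap)
      then have "2^j * (d j \<omega>)\<^sup>2 \<le> 2^j * (8 * gap \<omega>)" by (intro mult_left_mono) auto
      moreover have "2 * \<bar>d j \<omega>\<bar> \<le> (1/2)^j + 2^j * (d j \<omega>)\<^sup>2"
      proof -
        have "0 \<le> 2^j * ((1/2)^j - \<bar>d j \<omega>\<bar>)\<^sup>2" by simp
        also have "\<dots> = 2^j * (1/2)^j * (1/2)^j - 2 * (2^j * (1/2)^j) * \<bar>d j \<omega>\<bar> + 2^j * (d j \<omega>)\<^sup>2"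
          by (simp add: power2_diff algebra_simps power2_eq_square)
        also have "(2::real)^j * (1/2)^j = 1" by (simp add: power_mult_distrib[symmetric])
        finally show ?thesis by simp
      qed
      ultimately show ?thesis by linarith
    qed
    have int_rhs: "integrable M (\<lambda>\<omega>. (1/2)^j / 2 + 4 * 2^j * gap \<omega>)" using int_gap by auto
    have "(\<integral>\<^sup>+\<omega>. ennreal \<bar>d j \<omega>\<bar> \<partial>M) \<le> (\<integral>\<^sup>+\<omega>. ennreal ((1/2)^j / 2 + 4 * 2^j * gap \<omega>) \<partial>M)"
      using pt by (intro nn_integral_mono ennreal_leI) auto
    also have "\<dots> = ennreal (\<integral>\<omega>. (1/2)^j / 2 + 4 * 2^j * gap \<omega> \<partial>M)"
      using int_rhs by (rule nn_integral_eq_integral) (use pt in \<open>auto intro: order_trans[OF abs_ge_zero]\<close>)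
    also have "(\<integral>\<omega>. (1/2)^j / 2 + 4 * 2^j * gap \<omega> \<partial>M) = (1/2)^j / 2 + 4 * 2^j * (\<integral>\<omega>. gap \<omega> \<partial>M)"
      using int_gap by (simp add: prob_space)
    also have "ennreal \<dots> \<le> ennreal ((1/2)^j / 2 + 4 * 2^j * (2 * (1/4)^j))"
      using gap2 by (intro ennreal_leI add_left_mono mult_left_mono) auto
    also have "(1/2)^j / 2 + 4 * 2^j * (2 * (1/4)^j) = (17/2) * (1/2::real)^j"
    proof -
      have "(2::real)^j * (1/4)^j = (1/2)^j" by (simp add: power_mult_distrib[symmetric])
      then show ?thesis by simp
    qed
    also have "ennreal \<dots> \<le> ennreal (9 * (1/2)^j)" by (intro ennreal_leI) auto
    finally show ?thesis .
  qed
  have "AE \<omega> in M. summable (\<lambda>j. \<bar>d j \<omega>\<bar>)"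
    by (rule AE_summable_abs[OF _ d_bound]) (auto simp: d_def intro!: summable_mult summable_geometric)
  then have convT: "AE \<omega> in M. convergent (\<lambda>j. T (f j \<omega>))"
    unfolding d_def by eventually_elim (rule convergent_of_summable_increments)
  have "(\<integral>\<^sup>+\<omega>. liminf (\<lambda>j. ennreal \<bar>f j \<omega>\<bar>) \<partial>M) \<le> liminf (\<lambda>j. \<integral>\<^sup>+\<omega>. ennreal \<bar>f j \<omega>\<bar> \<partial>M)"
    by (intro nn_integral_liminf) auto
  also have "\<dots> \<le> liminf (\<lambda>j. ennreal B)" using bnd fD by (intro Liminf_mono always_eventually) blast
  also have "\<dots> < \<infinity>" by (simp add: Liminf_const)
  finally have "AE \<omega> in M. liminf (\<lambda>j. ennreal \<bar>f j \<omega>\<bar>) \<noteq> \<infinity>"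
    by (intro nn_integral_noteq_infinite) auto
  \<comment> \<open>The transforms could still converge to a point of modulus 1 while the functions
    escape to infinity; the \<open>liminf\<close> just shown to be finite rules this out.\<close>
  with convT have conv: "AE \<omega> in M. convergent (\<lambda>j. f j \<omega>)"
    unfolding T_def by eventually_elim (rule tendsto_of_bounded_transform)
  show ?thesis
  proof (rule that[of f "\<lambda>\<omega>. lim (\<lambda>j. f j \<omega>)"])
    show "(\<lambda>\<omega>. lim (\<lambda>j. f j \<omega>)) \<in> borel_measurable M" by measurable
    show "AE \<omega> in M. (\<lambda>k. f k \<omega>) \<longlonglongrightarrow> lim (\<lambda>j. f j \<omega>)"
      using conv by eventually_elim (simp add: convergent_LIMSEQ_iff)
  qed (fact fD)
qed

subsection \<open>Modular-bounded limits\<close>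

text \<open>The Orlicz space on the level of functions. Finiteness of the modular at one scale is
  easier to check than membership in a multiple of the unit ball, and by
  \<open>orlicz_fun_ball\<close> it amounts to the same for even convex \<open>g\<close>.\<close>

definition orlicz_fun :: "'a measure \<Rightarrow> (real \<Rightarrow> real) \<Rightarrow> ('a \<Rightarrow> real) set" where
  "orlicz_fun M g = {f \<in> borel_measurable M. \<exists>c>0. modular M g (\<lambda>\<omega>. c * f \<omega>) < \<infinity>}"

lemma orlicz_funI:
  "f \<in> borel_measurable M \<Longrightarrow> 0 < c \<Longrightarrow> modular M g (\<lambda>\<omega>. c * f \<omega>) < \<infinity> \<Longrightarrow> f \<in> orlicz_fun M g"
  by (auto simp: orlicz_fun_def)

lemma orlicz_funE:
  assumes "f \<in> orlicz_fun M g"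
  obtains c where "0 < c" "modular M g (\<lambda>\<omega>. c * f \<omega>) < \<infinity>" "f \<in> borel_measurable M"
  using assms by (auto simp: orlicz_fun_def)

lemma modular_solid:
  assumes "even_convex g" "AE \<omega> in M. \<bar>f \<omega>\<bar> \<le> \<bar>h \<omega>\<bar>"
  shows "modular M g f \<le> modular M g h"
  using assms(2) by (intro modular_mono) (auto intro: even_convex_mono[OF assms(1)])

lemma modular_scale_le:
  assumes g: "even_convex g" and t: "0 \<le> t" "t \<le> 1" and f: "f \<in> borel_measurable M"
  shows "modular M g (\<lambda>\<omega>. t * f \<omega>) \<le> ennreal t * modular M g f"
proof -
  have [measurable]: "(\<lambda>\<omega>. g (f \<omega>)) \<in> borel_measurable M" by (rule even_convex_measurable[OF g f])
  have "modular M g (\<lambda>\<omega>. t * f \<omega>) \<le> (\<integral>\<^sup>+\<omega>. ennreal t * ennreal (g (f \<omega>)) \<partial>M)"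
    unfolding modular_def
    using even_convex_scale_le[OF g t] t even_convex_nonneg[OF g]
    by (intro nn_integral_mono) (simp add: ennreal_mult[symmetric] ennreal_leI)
  also have "\<dots> = ennreal t * modular M g f"
    unfolding modular_def by (simp add: nn_integral_cmult)
  finally show ?thesis .
qed

lemma orlicz_fun_solid:
  assumes g: "even_convex g" and h: "h \<in> orlicz_fun M g"
    and f: "f \<in> borel_measurable M" "AE \<omega> in M. \<bar>f \<omega>\<bar> \<le> \<bar>h \<omega>\<bar>"
  shows "f \<in> orlicz_fun M g"
proof -
  obtain c where c: "0 < c" "modular M g (\<lambda>\<omega>. c * h \<omega>) < \<infinity>" using h by (rule orlicz_funE)
  have "AE \<omega> in M. \<bar>c * f \<omega>\<bar> \<le> \<bar>c * h \<omega>\<bar>"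
    using f(2) by eventually_elim (use c(1) in \<open>simp add: abs_mult mult_left_mono\<close>)
  then have "modular M g (\<lambda>\<omega>. c * f \<omega>) \<le> modular M g (\<lambda>\<omega>. c * h \<omega>)"
    by (rule modular_solid[OF g])
  then show ?thesis using orlicz_funI[OF f(1) c(1)] c(2) le_less_trans by blast
qed

lemma orlicz_fun_add:
  assumes g: "even_convex g" and f: "f \<in> orlicz_fun M g" and h: "h \<in> orlicz_fun M g"
  shows "(\<lambda>\<omega>. f \<omega> + h \<omega>) \<in> orlicz_fun M g"
proof -
  obtain c where c: "0 < c" "modular M g (\<lambda>\<omega>. c * f \<omega>) < \<infinity>" "f \<in> borel_measurable M"
    using f by (rule orlicz_funE)
  obtain d where d: "0 < d" "modular M g (\<lambda>\<omega>. d * h \<omega>) < \<infinity>" "h \<in> borel_measurable M"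
    using h by (rule orlicz_funE)
  define e where "e = min c d"
  have e: "0 < e" "e \<le> c" "e \<le> d" using c d by (auto simp: e_def)
  have "modular M g (\<lambda>\<omega>. e * f \<omega>) \<le> modular M g (\<lambda>\<omega>. c * f \<omega>)"
    "modular M g (\<lambda>\<omega>. e * h \<omega>) \<le> modular M g (\<lambda>\<omega>. d * h \<omega>)"
    using e by (intro modular_solid[OF g] AE_I2; simp add: abs_mult mult_right_mono)+
  then have fin: "modular M g (\<lambda>\<omega>. e * f \<omega>) < \<infinity>" "modular M g (\<lambda>\<omega>. e * h \<omega>) < \<infinity>"
    using c d by (auto intro: le_less_trans)
  have "modular M g (\<lambda>\<omega>. (1/2) * (e * f \<omega>) + (1/2) * (e * h \<omega>))
      \<le> max (modular M g (\<lambda>\<omega>. e * f \<omega>)) (modular M g (\<lambda>\<omega>. e * h \<omega>))"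
    using c d by (intro modular_convex_le[OF g]) auto
  also have "\<dots> < \<infinity>" using fin by simp
  finally have "modular M g (\<lambda>\<omega>. (e / 2) * (f \<omega> + h \<omega>)) < \<infinity>" by (simp add: algebra_simps add_divide_distrib)
  then show ?thesis using c d e by (intro orlicz_funI[of _ _ "e / 2"]) auto
qed

lemma orlicz_fun_abs:
  assumes g: "even_convex g" and f: "f \<in> orlicz_fun M g"
  shows "(\<lambda>\<omega>. \<bar>f \<omega>\<bar>) \<in> orlicz_fun M g"
  by (rule orlicz_fun_solid[OF g f]) (use f in \<open>auto simp: orlicz_fun_def\<close>)

lemma orlicz_fun_scale:
  assumes g: "even_convex g" and f: "f \<in> orlicz_fun M g"
  shows "(\<lambda>\<omega>. c * f \<omega>) \<in> orlicz_fun M g"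
proof (cases "c = 0")
  case True
  then show ?thesis
    by (intro orlicz_fun_solid[OF g f]) auto
next
  case False
  obtain d where d: "0 < d" "modular M g (\<lambda>\<omega>. d * f \<omega>) < \<infinity>" "f \<in> borel_measurable M"
    using f by (rule orlicz_funE)
  have "modular M g (\<lambda>\<omega>. (d / \<bar>c\<bar>) * (c * f \<omega>)) \<le> modular M g (\<lambda>\<omega>. d * f \<omega>)"
    using False d by (intro modular_solid[OF g] AE_I2) (simp add: abs_mult)
  then show ?thesis
    using d False by (intro orlicz_funI[of _ _ "d / \<bar>c\<bar>"]) (auto intro: le_less_trans)
qed

lemma orlicz_fun_ball:
  assumes g: "even_convex g" and f: "f \<in> orlicz_fun M g"
  obtains c where "0 < c" "modular M g (\<lambda>\<omega>. c * f \<omega>) \<le> 1"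
proof -
  obtain c where c: "0 < c" "modular M g (\<lambda>\<omega>. c * f \<omega>) < \<infinity>" "f \<in> borel_measurable M"
    using f by (rule orlicz_funE)
  obtain r where r: "modular M g (\<lambda>\<omega>. c * f \<omega>) = ennreal r" "0 \<le> r"
    using c(2) by (cases "modular M g (\<lambda>\<omega>. c * f \<omega>)") auto
  define t where "t = 1 / (1 + r)"
  have t: "0 < t" "t \<le> 1" "t * r \<le> 1" using r by (auto simp: t_def field_simps)
  have "modular M g (\<lambda>\<omega>. t * (c * f \<omega>)) \<le> ennreal t * ennreal r"
    unfolding r(1)[symmetric] using t c(3) by (intro modular_scale_le[OF g]) auto
  also have "\<dots> \<le> 1" using t r by (simp add: ennreal_mult[symmetric] ennreal_le_1)
  finally show ?thesis using that[of "t * c"] t c by (simp add: mult.assoc)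
qed

lemma superlinear_scale:
  assumes "superlinear g" "0 < c"
  shows "superlinear (\<lambda>y. g (c * y))"
  unfolding superlinear_def
proof
  fix K
  obtain T where T: "\<And>y. (K / c) * \<bar>y\<bar> \<le> g y + T" using superlinearD[OF assms(1)] by blast
  have "K * \<bar>y\<bar> \<le> g (c * y) + T" for y
    using T[of "c * y"] assms(2) by (simp add: abs_mult)
  then show "\<exists>T. \<forall>y. K * \<bar>y\<bar> \<le> g (c * y) + T" by blast
qed

lemma modular_comp_scale: "modular M (\<lambda>y. g (c * y)) f = modular M g (\<lambda>\<omega>. c * f \<omega>)"
  by (simp add: modular_def)

text \<open>As \<open>g\<close> is even, continuous and increasing in |y|, its value at the supremum
  is the supremum of its values, which is at most their sum. This is how summable modulars produce
  an order bound inside the Orlicz space.\<close>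

lemma AE_dominated_sup:
  fixes w :: "nat \<Rightarrow> 'a \<Rightarrow> real"
  assumes g: "even_convex g" and [measurable]: "\<And>j. w j \<in> borel_measurable M"
    and lim: "AE \<omega> in M. (\<lambda>j. w j \<omega>) \<longlonglongrightarrow> 0"
    and \<sigma>: "0 < \<sigma>" and le: "(\<Sum>j. modular M g (\<lambda>\<omega>. \<sigma> * w j \<omega>)) < \<infinity>"
  obtains z where "z \<in> orlicz_fun M g" "AE \<omega> in M. \<forall>j. \<bar>w j \<omega>\<bar> \<le> z \<omega>"
proof -
  define H where "H \<omega> = (\<Sum>j. ennreal (g (\<sigma> * w j \<omega>)))" for \<omega>
  \<comment> \<open>\<open>enn2real\<close> would turn an infinite supremum into 0; this is
    harmless, since the sequence is bounded wherever it converges.\<close>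
  define z where "z \<omega> = enn2real (SUP j. ennreal \<bar>w j \<omega>\<bar>)" for \<omega>
  have [measurable]: "z \<in> borel_measurable M" unfolding z_def by measurable
  have gm [measurable]: "\<And>j. (\<lambda>\<omega>. g (\<sigma> * w j \<omega>)) \<in> borel_measurable M"
    by (intro even_convex_measurable[OF g]) auto
  have *: "(\<forall>j. \<bar>w j \<omega>\<bar> \<le> z \<omega>) \<and> ennreal (g (\<sigma> * z \<omega>)) \<le> H \<omega>" if l: "(\<lambda>j. w j \<omega>) \<longlonglongrightarrow> 0" for \<omega>
  proof -
    obtain B where B: "\<And>j. \<bar>w j \<omega>\<bar> \<le> B"
      using convergent_imp_Bseq[of "\<lambda>j. w j \<omega>"] l by (auto simp: convergent_def Bseq_def)
    have "(SUP j. ennreal \<bar>w j \<omega>\<bar>) \<le> ennreal B" using B by (intro SUP_least ennreal_leI) auto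
    then have z: "(SUP j. ennreal \<bar>w j \<omega>\<bar>) = ennreal (z \<omega>)"
      unfolding z_def by (metis ennreal_enn2real ennreal_less_top le_less_trans)
    have z0: "0 \<le> z \<omega>" by (simp add: z_def)
    have w_le: "\<bar>w j \<omega>\<bar> \<le> z \<omega>" for j
    proof -
      have "ennreal \<bar>w j \<omega>\<bar> \<le> ennreal (z \<omega>)" unfolding z[symmetric] by (rule SUP_upper) simp
      then show ?thesis using z0 by simp
    qed
    have "ennreal (g (\<sigma> * z \<omega>)) \<le> H \<omega>"
    proof (cases "H \<omega>")
      case (real h)
      have h: "g (\<sigma> * w j \<omega>) \<le> h" for j
      proof -
        have "ennreal (g (\<sigma> * w j \<omega>)) \<le> H \<omega>"
          unfolding H_def using sum_le_suminf[of "\<lambda>j. ennreal (g (\<sigma> * w j \<omega>))" "{j}"] by simp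
        then show ?thesis using real by simp
      qed
      have "g (\<sigma> * z \<omega>) \<le> h"
      proof (cases "z \<omega> = 0")
        case True
        then show ?thesis using even_convexD(2)[OF g] real by simp
      next
        case False
        then have zp: "0 < z \<omega>" using z0 by simp
        have "((\<lambda>y. g (\<sigma> * y)) \<longlongrightarrow> g (\<sigma> * z \<omega>)) (at_left (z \<omega>))"
          by (intro even_convex_tendsto[OF g] tendsto_intros)
        moreover have "eventually (\<lambda>y. g (\<sigma> * y) \<le> h) (at_left (z \<omega>))"
          unfolding eventually_at_left[OF zp]
        proof (intro exI[of _ 0] conjI allI impI)
          fix y assume y: "0 < y" "y < z \<omega>"
          then have "ennreal y < (SUP j. ennreal \<bar>w j \<omega>\<bar>)" unfolding z by (simp add: ennreal_less_iff)
          then obtain j where "ennreal y < ennreal \<bar>w j \<omega>\<bar>" unfolding less_SUP_iff by blast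
          then have "y < \<bar>w j \<omega>\<bar>" using y by (simp add: ennreal_less_iff)
          then have "g (\<sigma> * y) \<le> g (\<sigma> * w j \<omega>)"
            using \<sigma> y by (intro even_convex_mono[OF g]) (simp add: abs_mult)
          then show "g (\<sigma> * y) \<le> h" using h order_trans by blast
        qed (fact zp)
        ultimately show ?thesis by (rule tendsto_upperbound) simp
      qed
      then show ?thesis using real by (simp add: ennreal_leI)
    qed simp
    then show ?thesis using w_le by blast
  qed
  have "modular M g (\<lambda>\<omega>. \<sigma> * z \<omega>) \<le> (\<integral>\<^sup>+\<omega>. H \<omega> \<partial>M)"
    unfolding modular_def using lim * by (intro nn_integral_mono_AE) auto
  also have "\<dots> = (\<Sum>j. modular M g (\<lambda>\<omega>. \<sigma> * w j \<omega>))"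
    unfolding H_def modular_def by (intro nn_integral_suminf) auto
  finally have "z \<in> orlicz_fun M g" using \<sigma> le by (intro orlicz_funI[of _ _ \<sigma>]) auto
  moreover have "AE \<omega> in M. \<forall>j. \<bar>w j \<omega>\<bar> \<le> z \<omega>" using lim * by auto
  ultimately show ?thesis using that by blast
qed

section \<open>Convex sets closed under dominated almost sure limits\<close>

text \<open>The hard implication in terms of functions: \<open>A\<close> will consist of all
  representatives of a translate of \<open>C\<close>, and \<open>A_closed\<close> is the closedness
  of \<open>C\<close> within order intervals, in sequential form.\<close>

locale dominated_closed = prob_space M for M :: "'a measure" +
  fixes \<Phi> :: "real \<Rightarrow> real" and A :: "('a \<Rightarrow> real) set"
  assumes young: "young_function \<Phi>" and Delta2: "Delta2 \<Phi>"
    and A_orlicz: "A \<subseteq> orlicz_fun M (young_conjugate \<Phi>)"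
    and A_convex: "\<And>f g u v. f \<in> A \<Longrightarrow> g \<in> A \<Longrightarrow> 0 \<le> u \<Longrightarrow> 0 \<le> v \<Longrightarrow> u + v = 1 \<Longrightarrow>
      (\<lambda>\<omega>. u * f \<omega> + v * g \<omega>) \<in> A"
    and A_closed: "\<And>f f0 z. (\<And>k::nat. f k \<in> A) \<Longrightarrow> f0 \<in> borel_measurable M \<Longrightarrow>
      z \<in> orlicz_fun M (young_conjugate \<Phi>) \<Longrightarrow> (\<And>k. AE \<omega> in M. \<bar>f k \<omega>\<bar> \<le> z \<omega>) \<Longrightarrow>
      AE \<omega> in M. (\<lambda>k. f k \<omega>) \<longlonglongrightarrow> f0 \<omega> \<Longrightarrow> f0 \<in> A"
begin

abbreviation F :: "real \<Rightarrow> real" where "F \<equiv> young_conjugate \<Phi>"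

lemma F_ec: "even_convex F" using young by (rule even_convex_young_conjugate)
lemma F_superlinear: "superlinear F" using young by (rule young_conjugate_superlinear)
lemma A_measurable: "f \<in> A \<Longrightarrow> f \<in> borel_measurable M" using A_orlicz by (auto simp: orlicz_fun_def)

lemma F_scale_ec: "even_convex (\<lambda>y. F (c * y))"
  by (rule even_convex_comp_scale[OF F_ec])

text \<open>Perturbations leading from \<open>f\<close>, which need not be in \<open>A\<close>, into
  \<open>A\<close>. The modular is bounded at the doubled scale because the overlap term of
  \<open>even_convex_midpoint_min\<close> lives there and needs an integrable majorant.\<close>

definition near :: "('a \<Rightarrow> real) \<Rightarrow> real \<Rightarrow> ('a \<Rightarrow> real) set" where
  "near f \<sigma> = {u \<in> borel_measurable M. (\<lambda>\<omega>. f \<omega> + u \<omega>) \<in> A \<and> modular M F (\<lambda>\<omega>. 2 * \<sigma> * u \<omega>) \<le> 1}"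

text \<open>A level \<open>r\<close> of the modular attained by perturbations that are at the same
  time arbitrarily small in L1. The L1 smallness survives every lowering of \<open>r\<close> and
  always provides perturbations tending to 0 almost surely, hence with vanishing overlap.\<close>

definition reachable :: "('a \<Rightarrow> real) \<Rightarrow> real \<Rightarrow> real \<Rightarrow> bool" where
  "reachable f \<sigma> r \<longleftrightarrow> 0 \<le> r \<and> (\<forall>\<epsilon>>0. \<exists>u\<in>near f \<sigma>. (\<integral>\<^sup>+\<omega>. ennreal \<bar>u \<omega>\<bar> \<partial>M) \<le> ennreal \<epsilon> \<and>
     modular M F (\<lambda>\<omega>. \<sigma> * u \<omega>) \<le> ennreal r)"

lemma near_midpoint:
  assumes "u \<in> near f \<sigma>" "v \<in> near f \<sigma>"
  shows "(\<lambda>\<omega>. (u \<omega> + v \<omega>) / 2) \<in> near f \<sigma>"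
proof -
  have [measurable]: "u \<in> borel_measurable M" "v \<in> borel_measurable M" using assms by (auto simp: near_def)
  have "(\<lambda>\<omega>. (1/2) * (f \<omega> + u \<omega>) + (1/2) * (f \<omega> + v \<omega>)) \<in> A"
    using assms by (intro A_convex) (auto simp: near_def)
  also have "(\<lambda>\<omega>. (1/2) * (f \<omega> + u \<omega>) + (1/2) * (f \<omega> + v \<omega>)) = (\<lambda>\<omega>. f \<omega> + (u \<omega> + v \<omega>) / 2)"
    by (auto simp: field_simps)
  finally have 1: "(\<lambda>\<omega>. f \<omega> + (u \<omega> + v \<omega>) / 2) \<in> A" .
  have "modular M F (\<lambda>\<omega>. (1/2) * (2 * \<sigma> * u \<omega>) + (1/2) * (2 * \<sigma> * v \<omega>)) \<le> 1"
    using assms by (intro modular_convex_le[OF F_ec]) (auto simp: near_def)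
  also have "(\<lambda>\<omega>. (1/2) * (2 * \<sigma> * u \<omega>) + (1/2) * (2 * \<sigma> * v \<omega>)) = (\<lambda>\<omega>. 2 * \<sigma> * ((u \<omega> + v \<omega>) / 2))"
    by (auto simp: field_simps)
  finally show ?thesis using 1 by (simp add: near_def)
qed

text \<open>Averaging two elements whose large parts almost do not overlap contracts the modular by \<open>q\<close>.\<close>

lemma reachable_contract:
  assumes q: "0 < q" "0 \<le> K" "\<And>y. F (2/3 * y) \<le> 2/3 * q * F y + K * \<bar>y\<bar>"
    and \<sigma>: "0 < \<sigma>" and r: "reachable f \<sigma> r" and \<delta>: "0 < \<delta>"
  shows "reachable f \<sigma> (q * r + \<delta>)"
  unfolding reachable_def
proof (intro conjI allI impI)
  have r0: "0 \<le> r" using r by (simp add: reachable_def)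
  then show "0 \<le> q * r + \<delta>" using q \<delta> by simp
  fix \<epsilon> :: real assume \<epsilon>: "0 < \<epsilon>"
  \<comment> \<open>The linear error of the contraction is paid for by the L1 norms: this choice
    gives K * \<sigma> * e \<le> \<delta> / 2. The 1 in the denominator covers K = 0.\<close>
  define e where "e = min \<epsilon> (\<delta> / (2 * (K * \<sigma> + 1)))"
  have K1: "0 < K * \<sigma> + 1" using q \<sigma> by (simp add: add_nonneg_pos)
  have e: "0 < e" "e \<le> \<epsilon>" using \<epsilon> \<delta> K1 by (auto simp: e_def)
  have "(K * \<sigma> + 1) * e \<le> (K * \<sigma> + 1) * (\<delta> / (2 * (K * \<sigma> + 1)))"
    using K1 by (intro mult_left_mono) (auto simp: e_def)
  also have "\<dots> = \<delta> / 2"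
  proof -
    have "X * (\<delta> / (2 * X)) = \<delta> / 2" if "0 < X" for X :: real using that by simp
    then show ?thesis using K1 by blast
  qed
  finally have e\<delta>: "K * \<sigma> * e \<le> \<delta> / 2" using e by (simp add: distrib_right)
  \<comment> \<open>The geometric factors make the L1 norms summable, so that \<open>u n\<close>
    tends to 0 almost surely and not only in L1.\<close>
  have "\<exists>u\<in>near f \<sigma>. (\<integral>\<^sup>+\<omega>. ennreal \<bar>u \<omega>\<bar> \<partial>M) \<le> ennreal (e * (1/2)^n) \<and>
     modular M F (\<lambda>\<omega>. \<sigma> * u \<omega>) \<le> ennreal r" for n
    using r e unfolding reachable_def by simp
  then obtain u where u: "\<And>n::nat. u n \<in> near f \<sigma>"
      "\<And>n. (\<integral>\<^sup>+\<omega>. ennreal \<bar>u n \<omega>\<bar> \<partial>M) \<le> ennreal (e * (1/2)^n)"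
      "\<And>n. modular M F (\<lambda>\<omega>. \<sigma> * u n \<omega>) \<le> ennreal r" by metis
  have um [measurable]: "u n \<in> borel_measurable M" for n using u(1) by (simp add: near_def)
  have ue: "(\<integral>\<^sup>+\<omega>. ennreal \<bar>u n \<omega>\<bar> \<partial>M) \<le> ennreal e" for n
  proof -
    have "e * (1/2)^n \<le> e * 1" using e by (intro mult_left_mono) (auto simp: power_le_one)
    then show ?thesis using order_trans[OF u(2)[of n] ennreal_leI] by simp
  qed
  have Fm [measurable]: "(\<lambda>\<omega>. F (c * u n \<omega>)) \<in> borel_measurable M" for n c
    by (intro even_convex_measurable[OF F_ec]) auto
  have lim: "AE \<omega> in M. (\<lambda>n. u n \<omega>) \<longlonglongrightarrow> 0"
    using u(2) e by (intro AE_tendsto_0_abs[where e="\<lambda>n. e * (1/2)^n"]) (auto intro!: summable_mult summable_geometric)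
  \<comment> \<open>The overlap of \<open>u 0\<close> with \<open>u n\<close>. With
    \<open>u 0\<close> fixed it tends to 0 almost surely and is dominated by
    \<open>F (2 * \<sigma> * u 0 \<omega>)\<close>, integrable by \<open>near\<close>; so a single
    late \<open>n\<close> suffices.\<close>
  define mn where "mn n \<omega> = min (F (2 * \<sigma> * u 0 \<omega>)) (F (2 * \<sigma> * u n \<omega>))" for n \<omega>
  have [measurable]: "mn n \<in> borel_measurable M" for n unfolding mn_def by measurable
  have "(\<lambda>n. \<integral>\<^sup>+\<omega>. ennreal (mn n \<omega>) \<partial>M) \<longlonglongrightarrow> (\<integral>\<^sup>+\<omega>. 0 \<partial>M)"
  proof (rule nn_integral_dominated_convergence[where w="\<lambda>\<omega>. ennreal (F (2 * \<sigma> * u 0 \<omega>))"])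
    show "AE \<omega> in M. (\<lambda>n. ennreal (mn n \<omega>)) \<longlonglongrightarrow> 0"
      using lim
    proof eventually_elim
      case (elim \<omega>)
      have "(\<lambda>n. mn n \<omega>) \<longlonglongrightarrow> min (F (2 * \<sigma> * u 0 \<omega>)) (F (2 * \<sigma> * 0))"
        unfolding mn_def by (intro tendsto_intros even_convex_tendsto[OF F_ec] elim)
      then have "(\<lambda>n. mn n \<omega>) \<longlonglongrightarrow> 0"
        using even_convexD(2)[OF F_ec] even_convex_nonneg[OF F_ec] by (simp add: min_absorb2)
      then show ?case using tendsto_ennrealI[of _ 0] by fastforce
    qed
    have "(\<integral>\<^sup>+\<omega>. ennreal (F (2 * \<sigma> * u 0 \<omega>)) \<partial>M) \<le> 1"
      using u(1)[of 0] by (simp add: near_def modular_def)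
    then show "(\<integral>\<^sup>+\<omega>. ennreal (F (2 * \<sigma> * u 0 \<omega>)) \<partial>M) < \<infinity>"
      using ennreal_one_less_top le_less_trans by (metis infinity_ennreal_def)
    show "AE \<omega> in M. ennreal (mn j \<omega>) \<le> ennreal (F (2 * \<sigma> * u 0 \<omega>))" for j
      by (intro AE_I2 ennreal_leI) (simp add: mn_def)
  qed auto
  then have "eventually (\<lambda>n. (\<integral>\<^sup>+\<omega>. ennreal (mn n \<omega>) \<partial>M) < ennreal \<delta>) sequentially"
    using \<delta> by (intro order_tendstoD(2)[where y="\<integral>\<^sup>+\<omega>. 0 \<partial>M"]) auto
  then obtain n where n: "(\<integral>\<^sup>+\<omega>. ennreal (mn n \<omega>) \<partial>M) < ennreal \<delta>"
    by (auto simp: eventually_sequentially)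
  define v where "v \<omega> = (u 0 \<omega> + u n \<omega>) / 2" for \<omega>
  have v_near: "v \<in> near f \<sigma>" unfolding v_def using u(1) by (intro near_midpoint)
  have F0: "0 \<le> F y" for y by (rule even_convex_nonneg[OF F_ec])
  have "(\<integral>\<^sup>+\<omega>. ennreal \<bar>v \<omega>\<bar> \<partial>M) \<le> (\<integral>\<^sup>+\<omega>. ennreal (1/2) * ennreal \<bar>u 0 \<omega>\<bar> + ennreal (1/2) * ennreal \<bar>u n \<omega>\<bar> \<partial>M)"
  proof (rule nn_integral_mono)
    fix \<omega>
    have "\<bar>v \<omega>\<bar> \<le> (1/2) * \<bar>u 0 \<omega>\<bar> + (1/2) * \<bar>u n \<omega>\<bar>" by (simp add: v_def)
    then have "ennreal \<bar>v \<omega>\<bar> \<le> ennreal ((1/2) * \<bar>u 0 \<omega>\<bar> + (1/2) * \<bar>u n \<omega>\<bar>)" by (rule ennreal_leI)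
    also have "\<dots> = ennreal ((1/2) * \<bar>u 0 \<omega>\<bar>) + ennreal ((1/2) * \<bar>u n \<omega>\<bar>)" by (intro ennreal_plus) auto
    also have "\<dots> = ennreal (1/2) * ennreal \<bar>u 0 \<omega>\<bar> + ennreal (1/2) * ennreal \<bar>u n \<omega>\<bar>"
      by (intro arg_cong2[where f="(+)"] ennreal_mult) auto
    finally show "ennreal \<bar>v \<omega>\<bar> \<le> ennreal (1/2) * ennreal \<bar>u 0 \<omega>\<bar> + ennreal (1/2) * ennreal \<bar>u n \<omega>\<bar>" .
  qed
  also have "\<dots> = ennreal (1/2) * (\<integral>\<^sup>+\<omega>. ennreal \<bar>u 0 \<omega>\<bar> \<partial>M) + ennreal (1/2) * (\<integral>\<^sup>+\<omega>. ennreal \<bar>u n \<omega>\<bar> \<partial>M)"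
    by (subst nn_integral_add) (auto simp: nn_integral_cmult)
  also have "\<dots> \<le> ennreal (1/2) * ennreal e + ennreal (1/2) * ennreal e"
    using ue by (intro add_mono mult_left_mono) auto
  also have "\<dots> = ennreal (1/2 * e) + ennreal (1/2 * e)"
    using e by (intro arg_cong2[where f="(+)"] ennreal_mult[symmetric]) auto
  also have "\<dots> = ennreal e" using e by (simp flip: ennreal_plus)
  also have "\<dots> \<le> ennreal \<epsilon>" using e by (intro ennreal_leI)
  finally have v1: "(\<integral>\<^sup>+\<omega>. ennreal \<bar>v \<omega>\<bar> \<partial>M) \<le> ennreal \<epsilon>" .
  \<comment> \<open>\<open>c1\<close> is 3/4 * (2/3 * q), so that two modulars of at most r add up
    to q * r.\<close>
  define c1 where "c1 = q / 2"
  define c2 where "c2 = 3/4 * (K * \<sigma>)"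
  have c: "0 \<le> c1" "0 \<le> c2" using q \<sigma> by (auto simp: c1_def c2_def)
  have pt: "F (\<sigma> * v \<omega>) \<le> c1 * F (\<sigma> * u 0 \<omega>) + c1 * F (\<sigma> * u n \<omega>)
      + (c2 * \<bar>u 0 \<omega>\<bar> + c2 * \<bar>u n \<omega>\<bar>) + 1/4 * mn n \<omega>" for \<omega>
  proof -
    have "F (\<sigma> * v \<omega>) = F ((\<sigma> * u 0 \<omega> + \<sigma> * u n \<omega>) / 2)" by (simp add: v_def algebra_simps)
    also have "\<dots> \<le> 3/4 * F (2/3 * (\<sigma> * u 0 \<omega>)) + 3/4 * F (2/3 * (\<sigma> * u n \<omega>)) +
        1/4 * min (F (2 * (\<sigma> * u 0 \<omega>))) (F (2 * (\<sigma> * u n \<omega>)))"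
      by (rule even_convex_midpoint_min[OF F_ec])
    also have "\<dots> \<le> 3/4 * (2/3 * q * F (\<sigma> * u 0 \<omega>) + K * \<bar>\<sigma> * u 0 \<omega>\<bar>) +
        3/4 * (2/3 * q * F (\<sigma> * u n \<omega>) + K * \<bar>\<sigma> * u n \<omega>\<bar>) + 1/4 * mn n \<omega>"
      unfolding mn_def by (intro add_mono mult_left_mono q(3)) (auto simp: mult.assoc)
    also have "\<dots> = c1 * F (\<sigma> * u 0 \<omega>) + c1 * F (\<sigma> * u n \<omega>)
      + (c2 * \<bar>u 0 \<omega>\<bar> + c2 * \<bar>u n \<omega>\<bar>) + 1/4 * mn n \<omega>"
      using \<sigma> by (simp add: c1_def c2_def abs_mult algebra_simps)
    finally show ?thesis .
  qed
  have mn0: "0 \<le> mn n \<omega>" for \<omega> using F0 by (simp add: mn_def)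
  have "modular M F (\<lambda>\<omega>. \<sigma> * v \<omega>) \<le> (\<integral>\<^sup>+\<omega>. ennreal c1 * ennreal (F (\<sigma> * u 0 \<omega>)) + ennreal c1 * ennreal (F (\<sigma> * u n \<omega>))
      + (ennreal c2 * ennreal \<bar>u 0 \<omega>\<bar> + ennreal c2 * ennreal \<bar>u n \<omega>\<bar>) + ennreal (1/4) * ennreal (mn n \<omega>) \<partial>M)"
    unfolding modular_def
  proof (rule nn_integral_mono)
    fix \<omega>
    have "ennreal (F (\<sigma> * v \<omega>)) \<le> ennreal (c1 * F (\<sigma> * u 0 \<omega>) + c1 * F (\<sigma> * u n \<omega>)
      + (c2 * \<bar>u 0 \<omega>\<bar> + c2 * \<bar>u n \<omega>\<bar>) + 1/4 * mn n \<omega>)" using pt by (rule ennreal_leI)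
    also have "\<dots> = ennreal (c1 * F (\<sigma> * u 0 \<omega>)) + ennreal (c1 * F (\<sigma> * u n \<omega>))
      + (ennreal (c2 * \<bar>u 0 \<omega>\<bar>) + ennreal (c2 * \<bar>u n \<omega>\<bar>)) + ennreal (1/4 * mn n \<omega>)"
      using c F0 mn0 by (simp add: ennreal_plus)
    also have "\<dots> = ennreal c1 * ennreal (F (\<sigma> * u 0 \<omega>)) + ennreal c1 * ennreal (F (\<sigma> * u n \<omega>))
      + (ennreal c2 * ennreal \<bar>u 0 \<omega>\<bar> + ennreal c2 * ennreal \<bar>u n \<omega>\<bar>) + ennreal (1/4) * ennreal (mn n \<omega>)"
      using c F0 mn0 by (intro arg_cong2[where f="(+)"] ennreal_mult) auto
    finally show "ennreal (F (\<sigma> * v \<omega>)) \<le> ennreal c1 * ennreal (F (\<sigma> * u 0 \<omega>)) + ennreal c1 * ennreal (F (\<sigma> * u n \<omega>))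
      + (ennreal c2 * ennreal \<bar>u 0 \<omega>\<bar> + ennreal c2 * ennreal \<bar>u n \<omega>\<bar>) + ennreal (1/4) * ennreal (mn n \<omega>)" .
  qed
  also have "\<dots> = ennreal c1 * modular M F (\<lambda>\<omega>. \<sigma> * u 0 \<omega>) + ennreal c1 * modular M F (\<lambda>\<omega>. \<sigma> * u n \<omega>)
      + (ennreal c2 * (\<integral>\<^sup>+\<omega>. ennreal \<bar>u 0 \<omega>\<bar> \<partial>M) + ennreal c2 * (\<integral>\<^sup>+\<omega>. ennreal \<bar>u n \<omega>\<bar> \<partial>M))
      + ennreal (1/4) * (\<integral>\<^sup>+\<omega>. ennreal (mn n \<omega>) \<partial>M)"
    unfolding modular_def by (simp add: nn_integral_add nn_integral_cmult)
  also have "\<dots> \<le> ennreal c1 * ennreal r + ennreal c1 * ennreal r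
      + (ennreal c2 * ennreal e + ennreal c2 * ennreal e) + ennreal (1/4) * ennreal \<delta>"
    using u(3) ue n by (intro add_mono mult_left_mono) auto
  also have "\<dots> = ennreal (c1 * r) + ennreal (c1 * r) + (ennreal (c2 * e) + ennreal (c2 * e)) + ennreal (1/4 * \<delta>)"
    using c r0 e \<delta> by (intro arg_cong2[where f="(+)"] ennreal_mult[symmetric]) auto
  also have "\<dots> = ennreal (c1 * r + c1 * r + (c2 * e + c2 * e) + 1/4 * \<delta>)"
    using c r0 e \<delta> by (simp flip: ennreal_plus)
  \<comment> \<open>Exact budget: 2 * c2 * e = 3/2 * (K * \<sigma> * e) \<le> 3/4 * \<delta>, and
    the overlap takes the remaining \<delta> / 4.\<close>
  also have "\<dots> \<le> ennreal (q * r + \<delta>)"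
    using e\<delta> by (intro ennreal_leI) (simp add: c1_def c2_def field_simps)
  finally have "modular M F (\<lambda>\<omega>. \<sigma> * v \<omega>) \<le> ennreal (q * r + \<delta>)" .
  then show "\<exists>u\<in>near f \<sigma>. (\<integral>\<^sup>+\<omega>. ennreal \<bar>u \<omega>\<bar> \<partial>M) \<le> ennreal \<epsilon> \<and>
     modular M F (\<lambda>\<omega>. \<sigma> * u \<omega>) \<le> ennreal (q * r + \<delta>)"
    using v_near v1 by blast
qed

text \<open>The contraction need not be iterated: the infimum of the reachable levels satisfies Inf
  R \<le> q * x for every level x, hence Inf R \<le> q * Inf R, and q < 1 forces it to be at most
  0.\<close>

lemma reachable_small:
  assumes \<sigma>: "0 < \<sigma>" and r: "reachable f \<sigma> 1" and \<epsilon>: "0 < \<epsilon>"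
  shows "\<exists>u\<in>near f \<sigma>. (\<integral>\<^sup>+\<omega>. ennreal \<bar>u \<omega>\<bar> \<partial>M) \<le> ennreal \<epsilon> \<and> modular M F (\<lambda>\<omega>. \<sigma> * u \<omega>) \<le> ennreal \<epsilon>"
proof -
  obtain q K where q: "0 < q" "q < 1" "0 \<le> K" "\<And>y. F (2/3 * y) \<le> 2/3 * q * F y + K * \<bar>y\<bar>"
    using young_conjugate_contract[OF young Delta2] by blast
  define R where "R = Collect (reachable f \<sigma>)"
  have bdd: "bdd_below R" by (auto simp: R_def reachable_def bdd_below_def)
  have ne: "R \<noteq> {}" using r by (auto simp: R_def)
  have "Inf R \<le> q * x + d" if "x \<in> R" "0 < d" for x d
    using that reachable_contract[OF q(1,3,4) \<sigma>, of f x d] bdd by (intro cInf_lower) (auto simp: R_def)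
  then have le: "Inf R \<le> q * x" if "x \<in> R" for x
    using that by (meson field_le_epsilon)
  have "Inf R / q \<le> x" if "x \<in> R" for x
    using le[OF that] q(1) by (simp add: pos_divide_le_eq mult.commute)
  then have "Inf R / q \<le> Inf R" using ne by (intro cInf_greatest) auto
  then have "Inf R * (1 - q) \<le> 0" using q by (simp add: field_simps)
  then have "Inf R \<le> 0" using q by (simp add: mult_le_0_iff)
  then have "Inf R < \<epsilon>" using \<epsilon> by simp
  then obtain x where "x \<in> R" "x < \<epsilon>" using cInf_lessD[OF ne] by blast
  then obtain u where "u \<in> near f \<sigma>" "(\<integral>\<^sup>+\<omega>. ennreal \<bar>u \<omega>\<bar> \<partial>M) \<le> ennreal \<epsilon>"
      "modular M F (\<lambda>\<omega>. \<sigma> * u \<omega>) \<le> ennreal x"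
    using \<epsilon> unfolding R_def reachable_def by blast
  moreover have "ennreal x \<le> ennreal \<epsilon>" using \<open>x < \<epsilon>\<close> by (intro ennreal_leI) simp
  ultimately show ?thesis using order_trans by blast
qed

lemma modular_bounded_closed:
  assumes f: "\<And>k. f k \<in> A" and f0 [measurable]: "f0 \<in> borel_measurable M"
    and lim: "AE \<omega> in M. (\<lambda>k. f k \<omega>) \<longlonglongrightarrow> f0 \<omega>"
    and s: "0 < s" and le: "\<And>k. modular M F (\<lambda>\<omega>. s * f k \<omega>) \<le> 1"
  shows "f0 \<in> A"
proof -
  have fm [measurable]: "f k \<in> borel_measurable M" for k using A_measurable f by blast
  have le0: "modular M F (\<lambda>\<omega>. s * f0 \<omega>) \<le> 1"
    using modular_Fatou[OF F_scale_ec fm lim _ tendsto_const] le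
    by (simp add: modular_comp_scale)
  have f0F: "f0 \<in> orlicz_fun M F"
    using le0 s by (intro orlicz_funI[OF f0 s]) (auto intro: le_less_trans)
  have neg0: "modular M F (\<lambda>\<omega>. s * - f0 \<omega>) \<le> 1"
    using le0 modular_solid[OF F_ec, where M=M and f="\<lambda>\<omega>. s * - f0 \<omega>" and h="\<lambda>\<omega>. s * f0 \<omega>"] by simp
  \<comment> \<open>A quarter of s, since 2 * \<sigma> * u k is then the average of s * f k and - s
    * f0, both of modular at most 1.\<close>
  define \<sigma> where "\<sigma> = s / 4"
  have \<sigma>: "0 < \<sigma>" using s by (simp add: \<sigma>_def)
  define u where "u k \<omega> = f k \<omega> - f0 \<omega>" for k \<omega>
  have [measurable]: "u k \<in> borel_measurable M" for k unfolding u_def by measurable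
  have u2: "modular M F (\<lambda>\<omega>. 2 * \<sigma> * u k \<omega>) \<le> 1" for k
  proof -
    have "modular M F (\<lambda>\<omega>. (1/2) * (s * f k \<omega>) + (1/2) * (s * - f0 \<omega>)) \<le> 1"
      using le neg0 by (intro modular_convex_le[OF F_ec]) auto
    also have "(\<lambda>\<omega>. (1/2) * (s * f k \<omega>) + (1/2) * (s * - f0 \<omega>)) = (\<lambda>\<omega>. 2 * \<sigma> * u k \<omega>)"
      by (auto simp: \<sigma>_def u_def field_simps)
    finally show ?thesis .
  qed
  have un: "u k \<in> near f0 \<sigma>" for k
    using u2 f by (simp add: near_def) (simp add: u_def)
  \<comment> \<open>Level 1 is the starting point of the contraction: the bound at scale 2 *
    \<sigma> provides the modular, and \<open>Vitali_modular\<close> the L1 smallness.\<close>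
  have "reachable f0 \<sigma> 1"
    unfolding reachable_def
  proof (intro conjI allI impI)
    fix \<epsilon> :: real assume "0 < \<epsilon>"
    have "AE \<omega> in M. (\<lambda>k. u k \<omega>) \<longlonglongrightarrow> 0"
      using lim by eventually_elim (simp add: u_def LIM_zero)
    then obtain k where "(\<integral>\<^sup>+\<omega>. ennreal \<bar>u k \<omega>\<bar> \<partial>M) \<le> ennreal \<epsilon>"
      using Vitali_modular[OF F_scale_ec[of "2 * \<sigma>"] superlinear_scale[OF F_superlinear], of u \<epsilon>] u2 \<open>0 < \<epsilon>\<close> \<sigma>
      by (auto simp: modular_comp_scale)
    moreover have "modular M F (\<lambda>\<omega>. \<sigma> * u k \<omega>) \<le> 1"
      using \<sigma> by (intro order_trans[OF modular_solid[OF F_ec] u2[of k]] AE_I2) (simp add: abs_mult)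
    ultimately show "\<exists>u\<in>near f0 \<sigma>. (\<integral>\<^sup>+\<omega>. ennreal \<bar>u \<omega>\<bar> \<partial>M) \<le> ennreal \<epsilon> \<and>
        modular M F (\<lambda>\<omega>. \<sigma> * u \<omega>) \<le> ennreal 1"
      using un by auto
  qed simp
  then have "\<exists>w\<in>near f0 \<sigma>. (\<integral>\<^sup>+\<omega>. ennreal \<bar>w \<omega>\<bar> \<partial>M) \<le> ennreal ((1/2)^j) \<and>
      modular M F (\<lambda>\<omega>. \<sigma> * w \<omega>) \<le> ennreal ((1/2)^j)" for j
    using \<sigma> by (intro reachable_small) auto
  then obtain w where w: "\<And>j::nat. w j \<in> near f0 \<sigma>" "\<And>j. (\<integral>\<^sup>+\<omega>. ennreal \<bar>w j \<omega>\<bar> \<partial>M) \<le> ennreal ((1/2)^j)"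
      "\<And>j. modular M F (\<lambda>\<omega>. \<sigma> * w j \<omega>) \<le> ennreal ((1/2)^j)" by metis
  have wm [measurable]: "w j \<in> borel_measurable M" for j using w(1) by (simp add: near_def)
  have limw: "AE \<omega> in M. (\<lambda>j. w j \<omega>) \<longlonglongrightarrow> 0"
    using w(2) by (intro AE_tendsto_0_abs[where e="\<lambda>j. (1/2)^j"]) (auto intro!: summable_geometric)
  have "(\<Sum>j. modular M F (\<lambda>\<omega>. \<sigma> * w j \<omega>)) \<le> (\<Sum>j. ennreal ((1/2)^j))"
    using w(3) by (intro suminf_le) auto
  also have "\<dots> < \<infinity>" by (simp add: suminf_ennreal2 summable_geometric ennreal_less_top)
  finally obtain z where z: "z \<in> orlicz_fun M F" "AE \<omega> in M. \<forall>j. \<bar>w j \<omega>\<bar> \<le> z \<omega>"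
    using AE_dominated_sup[OF F_ec wm limw \<sigma>] by blast
  show ?thesis
  proof (rule A_closed[where f="\<lambda>j \<omega>. f0 \<omega> + w j \<omega>" and z="\<lambda>\<omega>. \<bar>f0 \<omega>\<bar> + z \<omega>"])
    show "(\<lambda>\<omega>. f0 \<omega> + w j \<omega>) \<in> A" for j using w(1) by (simp add: near_def)
    show "(\<lambda>\<omega>. \<bar>f0 \<omega>\<bar> + z \<omega>) \<in> orlicz_fun M F"
      by (intro orlicz_fun_add[OF F_ec] orlicz_fun_abs[OF F_ec] f0F z)
    show "AE \<omega> in M. \<bar>f0 \<omega> + w j \<omega>\<bar> \<le> \<bar>f0 \<omega>\<bar> + z \<omega>" for j
      using z(2)
    proof eventually_elim
      case (elim \<omega>)
      then have "\<bar>w j \<omega>\<bar> \<le> z \<omega>" by blast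
      then show ?case by linarith
    qed
    show "AE \<omega> in M. (\<lambda>k. f0 \<omega> + w k \<omega>) \<longlonglongrightarrow> f0 \<omega>"
      using limw
    proof eventually_elim
      case (elim \<omega>)
      then have "(\<lambda>k. f0 \<omega> + w k \<omega>) \<longlonglongrightarrow> f0 \<omega> + 0" by (intro tendsto_intros)
      then show ?case by simp
    qed
  qed (fact f0)
qed

end

subsection \<open>The Krein--Smulian induction\<close>

lemma modular_max_le:
  assumes "even_convex g" "even_convex h" "f \<in> borel_measurable M"
  shows "modular M (\<lambda>y. max (g y) (h y)) f \<le> modular M g f + modular M h f"
proof -
  have [measurable]: "(\<lambda>\<omega>. g (f \<omega>)) \<in> borel_measurable M" "(\<lambda>\<omega>. h (f \<omega>)) \<in> borel_measurable M"
    using assms by (auto intro: even_convex_measurable)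
  have "modular M (\<lambda>y. max (g y) (h y)) f \<le> (\<integral>\<^sup>+\<omega>. ennreal (g (f \<omega>)) + ennreal (h (f \<omega>)) \<partial>M)"
    unfolding modular_def by (intro nn_integral_mono) (simp add: max_def)
  also have "\<dots> = modular M g f + modular M h f"
    unfolding modular_def by (intro nn_integral_add) auto
  finally show ?thesis .
qed

context dominated_closed
begin

text \<open>If every scale 4^k failed, there would be \<open>f k\<close> in \<open>A\<close> with L1
  norms of order 4^-k and bounded modulars. Summability makes them tend to 0 almost surely, and
  \<open>modular_bounded_closed\<close> puts 0 into \<open>A\<close>. The scale R starts the
  induction below.\<close>

lemma exists_scale:
  assumes 0: "(\<lambda>_. 0) \<notin> A"
  shows "\<exists>R>0. \<forall>f\<in>A. 1 < modular M F (\<lambda>\<omega>. R * f \<omega>)"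
proof (rule ccontr)
  assume neg: "\<not> ?thesis"
  have "\<exists>f\<in>A. modular M F (\<lambda>\<omega>. 4^k * f \<omega>) \<le> 1" for k :: nat
  proof -
    have "(4::real)^k > 0" by simp
    then show ?thesis using neg not_less by blast
  qed
  then obtain f where f: "\<And>k. f k \<in> A" "\<And>k::nat. modular M F (\<lambda>\<omega>. 4^k * f k \<omega>) \<le> 1" by metis
  have fm [measurable]: "f k \<in> borel_measurable M" for k using f A_measurable by blast
  obtain T where T: "0 \<le> T" "\<And>y. 1 * \<bar>y\<bar> \<le> F y + T" using superlinearD[OF F_superlinear] by blast
  have L1: "(\<integral>\<^sup>+\<omega>. ennreal \<bar>f k \<omega>\<bar> \<partial>M) \<le> ennreal ((1 + T) * (1/4)^k)" for k
  proof -
    have "4^k * \<bar>y\<bar> \<le> F (4^k * y) + T" for y using T(2)[of "4^k * y"] by (simp add: abs_mult)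
    moreover have "modular M (\<lambda>y. F (4^k * y)) (f k) \<le> ennreal 1"
      using f(2)[of k] by (simp add: modular_comp_scale)
    ultimately have "(\<integral>\<^sup>+\<omega>. ennreal \<bar>f k \<omega>\<bar> \<partial>M) \<le> ennreal ((1 + T) / 4^k)"
      by (intro nn_integral_le_modular[OF F_scale_ec, of "4^k" "4^k" T] T(1) fm) simp_all
    then show ?thesis by (simp add: power_divide)
  qed
  have "AE \<omega> in M. (\<lambda>k. f k \<omega>) \<longlonglongrightarrow> 0"
    using T by (intro AE_tendsto_0_abs[OF fm L1]) (auto intro!: summable_mult summable_geometric)
  moreover have "modular M F (\<lambda>\<omega>. 1 * f k \<omega>) \<le> 1" for k
  proof (rule order_trans[OF modular_solid[OF F_ec] f(2)[of k]], rule AE_I2)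
    fix \<omega>
    have "1 * \<bar>f k \<omega>\<bar> \<le> 4^k * \<bar>f k \<omega>\<bar>" by (intro mult_right_mono) auto
    then show "\<bar>1 * f k \<omega>\<bar> \<le> \<bar>4^k * f k \<omega>\<bar>" by (simp add: abs_mult)
  qed
  ultimately have "(\<lambda>_. 0) \<in> A"
    by (intro modular_bounded_closed[of f "\<lambda>_. 0" 1]) (simp_all add: f(1))
  then show False using 0 by blast
qed

text \<open>The compactness step of the Krein--Smulian argument: \<open>max l (F (s * y))\<close> is the limit of the
  functions in the conclusion as \<open>c\<close> tends to infinity.\<close>

lemma gauge_step:
  assumes l: "even_convex l" "\<And>y. \<bar>y\<bar> \<le> l y" and s: "0 < s'" "s' \<le> s"
    and sep: "\<And>f. f \<in> A \<Longrightarrow> 1 < modular M (\<lambda>y. max (l y) (F (s * y))) f"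
  shows "\<exists>c::nat. \<forall>f\<in>A. 1 < modular M (\<lambda>y. max (max (l y) (conjugate_on {- real c..real c} \<Phi> (s * y))) (F (s' * y))) f"
proof (rule ccontr)
  define h where "h c = conjugate_on {- real c..real c} \<Phi>" for c :: nat
  \<comment> \<open>The truncations increase with \<open>c\<close>, so the sets \<open>D c\<close>
    decrease. The term \<open>F (s' * y)\<close> stays untruncated: it is the modular bound that
    \<open>modular_bounded_closed\<close> needs to keep the limit in \<open>A\<close>.\<close>
  define g where "g c y = max (max (l y) (h c (s * y))) (F (s' * y))" for c :: nat and y
  assume "\<not> ?thesis"
  then have ex: "\<exists>f\<in>A. modular M (g c) f \<le> 1" for c
    unfolding g_def h_def using not_less by blast
  have h_ec: "even_convex (h c)" for c
    unfolding h_def by (rule even_convex_conjugate_on[OF young]) auto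
  have g_ec: "even_convex (g c)" for c
    unfolding g_def by (intro even_convex_max l even_convex_comp_scale h_ec F_ec)
  define D where "D c = {f \<in> A. modular M (g c) f \<le> 1}" for c
  have "D (Suc c) \<subseteq> D c" for c
  proof -
    have "h c y \<le> h (Suc c) y" for y unfolding h_def by (rule conjugate_on_mono[OF young]) auto
    then have "g c y \<le> g (Suc c) y" for y unfolding g_def by (intro max.mono order_refl)
    then have "modular M (g c) f \<le> modular M (g (Suc c)) f" for f by (intro modular_mono) auto
    then show ?thesis unfolding D_def using order_trans by blast
  qed
  then have dec: "decseq D" by (simp add: decseq_Suc_iff)
  obtain f f0 where f: "\<And>k. f k \<in> D k" and f0: "f0 \<in> borel_measurable M"
    and lim: "AE \<omega> in M. (\<lambda>k. f k \<omega>) \<longlonglongrightarrow> f0 \<omega>"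
  proof (rule decreasing_convex_AE_convergent[of D 1])
    show "D c \<noteq> {}" for c using ex unfolding D_def by blast
    fix c u assume u: "u \<in> D c"
    show "u \<in> borel_measurable M" using u A_measurable by (simp add: D_def)
    have "(\<integral>\<^sup>+\<omega>. ennreal \<bar>u \<omega>\<bar> \<partial>M) \<le> modular M (g c) u"
      unfolding modular_def g_def using l(2) by (intro nn_integral_mono ennreal_leI) (simp add: le_max_iff_disj)
    also have "\<dots> \<le> ennreal 1" using u by (simp add: D_def)
    finally show "(\<integral>\<^sup>+\<omega>. ennreal \<bar>u \<omega>\<bar> \<partial>M) \<le> ennreal 1" .
    fix v assume v: "v \<in> D c"
    have "(\<lambda>\<omega>. (1/2) * u \<omega> + (1/2) * v \<omega>) \<in> A"
      using u v unfolding D_def by (intro A_convex) auto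
    moreover have "modular M (g c) (\<lambda>\<omega>. (1/2) * u \<omega> + (1/2) * v \<omega>) \<le> 1"
      using u v A_measurable unfolding D_def by (intro modular_convex_le[OF g_ec]) auto
    ultimately have "(\<lambda>\<omega>. (1/2) * u \<omega> + (1/2) * v \<omega>) \<in> D c" unfolding D_def by blast
    then show "(\<lambda>\<omega>. (u \<omega> + v \<omega>) / 2) \<in> D c" by (simp add: add_divide_distrib)
  qed (use dec in auto)
  have fA: "f k \<in> A" for k using f by (simp add: D_def)
  have fm: "f k \<in> borel_measurable M" for k using fA A_measurable by blast
  have f0A: "f0 \<in> A"
  proof (rule modular_bounded_closed[OF fA f0 lim s(1)])
    fix k
    have "modular M F (\<lambda>\<omega>. s' * f k \<omega>) \<le> modular M (g k) (f k)"
      by (intro modular_mono) (auto simp: g_def)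
    then show "modular M F (\<lambda>\<omega>. s' * f k \<omega>) \<le> 1" using f[of k] unfolding D_def by auto
  qed
  \<comment> \<open>Two limits in this order: first k with c fixed, where all
    \<open>f (k + c)\<close> lie in \<open>D c\<close>; afterwards c, which restores the full
    conjugate and contradicts \<open>sep\<close>.\<close>
  have gc: "modular M (g c) f0 \<le> 1" for c
  proof (rule modular_Fatou[OF g_ec, of "\<lambda>k. f (k + c)"])
    show "AE \<omega> in M. (\<lambda>k. f (k + c) \<omega>) \<longlonglongrightarrow> f0 \<omega>"
      using lim by eventually_elim (rule LIMSEQ_ignore_initial_segment)
    have "D (k + c) \<subseteq> D c" for k using dec by (simp add: decseq_def)
    then show "modular M (g c) (f (k + c)) \<le> 1" for k using f[of "k + c"] unfolding D_def by blast
  qed (auto intro: fm)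
  have "modular M (\<lambda>y. max (l y) (F (s * y))) f0 \<le> 1"
    unfolding modular_def
  proof (rule nn_integral_Fatou_le[where h="\<lambda>c \<omega>. g c (f0 \<omega>)"])
    show "(\<lambda>\<omega>. g c (f0 \<omega>)) \<in> borel_measurable M" for c by (rule even_convex_measurable[OF g_ec f0])
    show "AE \<omega> in M. (\<lambda>c. g c (f0 \<omega>)) \<longlonglongrightarrow> max (l (f0 \<omega>)) (F (s * f0 \<omega>))"
    proof (rule AE_I2)
      fix \<omega>
      let ?y = "f0 \<omega>"
      have "F (s' * ?y) \<le> F (s * ?y)"
        using s by (intro even_convex_mono[OF F_ec]) (simp add: abs_mult mult_right_mono)
      then have "max (max (l ?y) (F (s * ?y))) (F (s' * ?y)) = max (l ?y) (F (s * ?y))" by simp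
      moreover have "(\<lambda>c. g c ?y) \<longlonglongrightarrow> max (max (l ?y) (F (s * ?y))) (F (s' * ?y))"
        unfolding g_def h_def by (intro tendsto_max tendsto_const conjugate_on_interval_tendsto[OF young])
      ultimately show "(\<lambda>c. g c ?y) \<longlonglongrightarrow> max (l ?y) (F (s * ?y))" by simp
    qed
    show "(\<integral>\<^sup>+\<omega>. ennreal (g c (f0 \<omega>)) \<partial>M) \<le> 1" for c using gc[of c] by (simp add: modular_def)
  qed simp
  then show False using sep[OF f0A] by simp
qed

text \<open>At stage n a gauge \<open>l n\<close> of linear growth separates only together with
  \<open>F (s n * y)\<close>; one step moves part of that term into the gauge and hands the rest to
  a smaller scale. The growth condition for every \<open>c\<close> is the aim: it makes \<Theta>
  integrable along all multiples of all elements of \<open>A\<close>.\<close>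

lemma gauge_exists:
  assumes 0: "(\<lambda>_. 0) \<notin> A"
  obtains \<Theta> where "even_convex \<Theta>" "\<And>y. \<bar>y\<bar> \<le> \<Theta> y"
    "\<And>c. 0 < c \<Longrightarrow> \<exists>a\<ge>0. \<forall>y. \<Theta> y \<le> a * \<bar>y\<bar> + F (c * y)"
    "\<And>f. f \<in> A \<Longrightarrow> ennreal (1/2) < modular M \<Theta> f"
proof -
  obtain R where R: "0 < R" "\<And>f. f \<in> A \<Longrightarrow> 1 < modular M F (\<lambda>\<omega>. R * f \<omega>)"
    using exists_scale[OF 0] by blast
  \<comment> \<open>Scales decreasing to 0, with \<open>s 0\<close> equal to R, so that
    \<open>exists_scale\<close> is the base case.\<close>
  define s where "s n = R / (real n + 1)" for n
  have s: "0 < s n" "s (Suc n) \<le> s n" for n using R by (auto simp: s_def field_simps)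
  have s_mono: "s k \<le> s n" if "n \<le> k" for n k using that R by (auto simp: s_def field_simps)
  have F_s: "F (s k * y) \<le> F (s n * y)" if "n \<le> k" for n k y
    using s_mono[OF that] s(1)[of k] s(1)[of n]
    by (intro even_convex_mono[OF F_ec]) (simp add: abs_mult mult_right_mono)
  have F0: "0 \<le> F y" for y by (rule even_convex_nonneg[OF F_ec])
  define P where "P n l \<longleftrightarrow> even_convex l \<and> (\<forall>y. \<bar>y\<bar> \<le> l y) \<and> (\<exists>a\<ge>0. \<forall>y. l y \<le> a * \<bar>y\<bar>) \<and>
    (\<forall>f\<in>A. 1 < modular M (\<lambda>y. max (l y) (F (s n * y))) f)" for n l
  \<comment> \<open>The upper half of \<open>Q\<close> records that at stage n the gauge rises at
    most to \<open>F (s n * y)\<close>. As the scales decrease, every later gauge, and so the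
    supremum, is bounded by the larger of \<open>l n y\<close> and
    \<open>F (s n * y)\<close>.\<close>
  define Q where "Q n l l' \<longleftrightarrow> (\<forall>y. l y \<le> l' y \<and> l' y \<le> max (l y) (F (s n * y)))"
    for n and l l' :: "real \<Rightarrow> real"
  have "\<exists>l. \<forall>n. P n (l n) \<and> Q n (l n) (l (Suc n))"
  proof (rule dependent_nat_choice)
    have "P 0 (\<lambda>y. \<bar>y\<bar>)"
      unfolding P_def
    proof (intro conjI even_convex_abs_fun allI ballI)
      show "\<exists>a\<ge>0. \<forall>y. \<bar>y\<bar> \<le> a * \<bar>y::real\<bar>" by (intro exI[of _ 1]) auto
      fix f assume "f \<in> A"
      then have "1 < modular M F (\<lambda>\<omega>. R * f \<omega>)" by (rule R(2))
      also have "\<dots> \<le> modular M (\<lambda>y. max \<bar>y\<bar> (F (s 0 * y))) f"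
        by (intro modular_mono) (auto simp: s_def)
      finally show "1 < modular M (\<lambda>y. max \<bar>y\<bar> (F (s 0 * y))) f" .
    qed auto
    then show "\<exists>l. P 0 l" by blast
  next
    fix l n assume l: "P n l"
    obtain a where a: "0 \<le> a" "\<And>y. l y \<le> a * \<bar>y\<bar>" using l by (auto simp: P_def)
    obtain c :: nat where c: "\<forall>f\<in>A. 1 < modular M
        (\<lambda>y. max (max (l y) (conjugate_on {- real c..real c} \<Phi> (s n * y))) (F (s (Suc n) * y))) f"
      using gauge_step[of l "s (Suc n)" "s n"] l s unfolding P_def by blast
    define l' where "l' y = max (l y) (conjugate_on {- real c..real c} \<Phi> (s n * y))" for y
    have "P (Suc n) l'"
      unfolding P_def
    proof (intro conjI allI)
      show "even_convex l'" unfolding l'_def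
        by (intro even_convex_max even_convex_comp_scale even_convex_conjugate_on[OF young])
          (use l in \<open>auto simp: P_def\<close>)
      show "\<bar>y\<bar> \<le> l' y" for y using l by (auto simp: P_def l'_def le_max_iff_disj)
      show "\<exists>a\<ge>0. \<forall>y. l' y \<le> a * \<bar>y\<bar>"
      proof (intro exI[of _ "a + real c * s n"] conjI allI)
        show "0 \<le> a + real c * s n" using a s(1)[of n] by simp
        fix y
        have "conjugate_on {- real c..real c} \<Phi> (s n * y) \<le> real c * \<bar>s n * y\<bar>"
          by (rule conjugate_on_interval_le[OF young]) simp
        also have "\<dots> = real c * s n * \<bar>y\<bar>" using s(1)[of n] by (simp add: abs_mult)
        finally have "conjugate_on {- real c..real c} \<Phi> (s n * y) \<le> real c * s n * \<bar>y\<bar>" .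
        moreover have "0 \<le> real c * s n * \<bar>y\<bar>" "0 \<le> a * \<bar>y\<bar>" using a s(1)[of n] by auto
        ultimately show "l' y \<le> (a + real c * s n) * \<bar>y\<bar>"
          using a(2)[of y] by (simp add: l'_def distrib_right)
      qed
      show "\<forall>f\<in>A. 1 < modular M (\<lambda>y. max (l' y) (F (s (Suc n) * y))) f"
        using c by (simp add: l'_def)
    qed
    moreover have "Q n l l'"
    proof -
      have "conjugate_on {- real c..real c} \<Phi> y \<le> F y" for y
        unfolding young_conjugate_eq by (rule conjugate_on_mono[OF young]) auto
      then show ?thesis unfolding Q_def l'_def by (intro allI conjI max.cobounded1 max.mono order_refl)
    qed
    ultimately show "\<exists>l'. P (Suc n) l' \<and> Q n l l'" by blast
  qed
  then obtain l where P: "\<And>n. P n (l n)" and Q: "\<And>n. Q n (l n) (l (Suc n))" by blast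
  have l_mono: "l n y \<le> l k y" if "n \<le> k" for n k y
    using that Q by (induction rule: dec_induct) (auto simp: Q_def intro: order_trans)
  have l_bound: "l k y \<le> max (l n y) (F (s n * y))" for n k y
  proof (cases "n \<le> k")
    case True
    then show ?thesis
    proof (induction rule: dec_induct)
      case (step k)
      then show ?case using Q[of k] F_s[OF step(1), of y] unfolding Q_def by (smt (verit))
    qed simp
  next
    case False
    then show ?thesis using l_mono[of k n y] by simp
  qed
  define \<Theta> where "\<Theta> y = (SUP n. l n y)" for y
  have bdd: "bdd_above (range (\<lambda>n. l n y))" for y using l_bound[of _ y 0] by (auto simp: bdd_above_def)
  have l_le: "l n y \<le> \<Theta> y" for n y unfolding \<Theta>_def using bdd by (rule cSUP_upper2) auto
  show ?thesis
  proof (rule that[of \<Theta>])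
    show ec: "even_convex \<Theta>" unfolding \<Theta>_def using P bdd by (intro even_convex_SUP) (auto simp: P_def)
    show "\<bar>y\<bar> \<le> \<Theta> y" for y using l_le[of 0 y] P[of 0] unfolding P_def using order_trans by blast
    show "\<exists>a\<ge>0. \<forall>y. \<Theta> y \<le> a * \<bar>y\<bar> + F (c * y)" if c: "0 < c" for c
    proof -
      obtain n :: nat where "R / c < real n" using reals_Archimedean2 by blast
      then have n: "s n \<le> c" using c R by (simp add: s_def field_simps)
      obtain a where a: "0 \<le> a" "\<And>y. l n y \<le> a * \<bar>y\<bar>" using P[of n] by (auto simp: P_def)
      have "\<Theta> y \<le> a * \<bar>y\<bar> + F (c * y)" for y
        unfolding \<Theta>_def
      proof (rule cSUP_least)
        fix k
        have "F (s n * y) \<le> F (c * y)"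
          using n s(1)[of n] c by (intro even_convex_mono[OF F_ec]) (simp add: abs_mult mult_right_mono)
        moreover have "0 \<le> a * \<bar>y\<bar>" using a by simp
        ultimately show "l k y \<le> a * \<bar>y\<bar> + F (c * y)"
          using l_bound[of k y n] a(2)[of y] F0[of "c * y"] by linarith
      qed simp
      then show ?thesis using a by blast
    qed
    \<comment> \<open>For a fixed f the remainder fades: once s n \<le> c / 2, the term
      \<open>F (s n * y)\<close> has modular at most 1/2 and leaves more than 1/2 of the separating
      bound 1 to \<Theta>.\<close>
    show "ennreal (1/2) < modular M \<Theta> f" if f: "f \<in> A" for f
    proof (rule ccontr)
      assume "\<not> ?thesis"
      then have le: "modular M \<Theta> f \<le> ennreal (1/2)" by simp
      have fm [measurable]: "f \<in> borel_measurable M" using f by (rule A_measurable)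
      obtain c where c: "0 < c" "modular M F (\<lambda>\<omega>. c * f \<omega>) \<le> 1"
        using orlicz_fun_ball[OF F_ec] A_orlicz f by blast
      obtain n :: nat where "R / (c / 2) < real n" using reals_Archimedean2 by blast
      then have n: "s n \<le> c / 2" using c R by (simp add: s_def field_simps)
      have "modular M F (\<lambda>\<omega>. s n * f \<omega>) \<le> modular M F (\<lambda>\<omega>. (1/2) * (c * f \<omega>))"
      proof (intro modular_solid[OF F_ec] AE_I2)
        fix \<omega>
        have "s n * \<bar>f \<omega>\<bar> \<le> c / 2 * \<bar>f \<omega>\<bar>" using n by (rule mult_right_mono) simp
        then show "\<bar>s n * f \<omega>\<bar> \<le> \<bar>(1/2) * (c * f \<omega>)\<bar>" using s(1)[of n] c(1) by (simp add: abs_mult)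
      qed
      also have "\<dots> \<le> ennreal (1/2) * modular M F (\<lambda>\<omega>. c * f \<omega>)"
        by (intro modular_scale_le[OF F_ec]) auto
      also have "\<dots> \<le> ennreal (1/2) * 1" using c by (intro mult_left_mono) auto
      finally have 1: "modular M F (\<lambda>\<omega>. s n * f \<omega>) \<le> ennreal (1/2)" by simp
      have "1 < modular M (\<lambda>y. max (l n y) (F (s n * y))) f" using P[of n] f by (simp add: P_def)
      also have "\<dots> \<le> modular M (l n) f + modular M (\<lambda>y. F (s n * y)) f"
        using P[of n] by (intro modular_max_le F_scale_ec fm) (simp add: P_def)
      also have "\<dots> \<le> modular M \<Theta> f + ennreal (1/2)"
        using 1 l_le by (intro add_mono modular_mono) (auto simp: modular_comp_scale)
      also have "\<dots> \<le> ennreal (1/2) + ennreal (1/2)" using le by (intro add_right_mono)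
      also have "\<dots> = 1" by (subst ennreal_plus[symmetric]) auto
      finally show False by simp
    qed
  qed
qed

end

subsection \<open>Separation by a smooth minimisation\<close>

text \<open>x + d and y - d are convex combinations of the end points x - d and y + d with exchanged
  weights, so the two convexity inequalities add up to the claim. For the smoothing below it says
  that the derivative increases.\<close>

lemma even_convex_difference_mono:
  assumes "even_convex g" "0 < d" "x \<le> y"
  shows "g (x + d) - g (x - d) \<le> g (y + d) - g (y - d)"
proof -
  define t where "t = 2 * d / (2 * d + (y - x))"
  have D: "0 < 2 * d + (y - x)" using assms by simp
  have t: "0 \<le> t" "t \<le> 1" using assms D by (auto simp: t_def)
  have td: "t * (2 * d + (y - x)) = 2 * d" using D by (simp add: t_def)
  have e: "(1 - t) * (x - d) + t * (y + d) = (x - d) + t * (2 * d + (y - x))"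
    "t * (x - d) + (1 - t) * (y + d) = (y + d) - t * (2 * d + (y - x))"
    by (simp_all add: algebra_simps)
  have "x + d = (1 - t) * (x - d) + t * (y + d)" "y - d = t * (x - d) + (1 - t) * (y + d)"
    unfolding e td by simp_all
  moreover have "g ((1 - t) * (x - d) + t * (y + d)) \<le> (1 - t) * g (x - d) + t * g (y + d)"
    "g (t * (x - d) + (1 - t) * (y + d)) \<le> t * g (x - d) + (1 - t) * g (y + d)"
    using t by (auto intro!: even_convexD(3)[OF assms(1)])
  ultimately have "g (x + d) + g (y - d) \<le> (1 - t) * g (x - d) + t * g (y + d) + (t * g (x - d) + (1 - t) * g (y + d))"
    by simp
  also have "\<dots> = g (x - d) + g (y + d)" by (simp add: algebra_simps)
  finally show ?thesis by simp
qed

text \<open>The smoothing is the average of \<open>\<Theta>\<close> over \<open>[y - d, y + d]\<close>, shifted to vanish at \<open>0\<close>.\<close>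

lemma even_convex_smoothing:
  assumes ec: "even_convex \<Theta>" and \<kappa>: "0 < \<kappa>"
  obtains G \<theta> b where "even_convex G" "\<And>y. (G has_real_derivative \<theta> y) (at y)"
    "\<theta> \<in> borel_measurable borel" "\<And>y. \<Theta> y \<le> G y + \<kappa>" "\<And>y. G y \<le> \<Theta> (2 * y) + b"
proof -
  note cont = even_convex_isCont[OF ec]
  have T0: "0 \<le> \<Theta> y" for y by (rule even_convex_nonneg[OF ec])
  obtain P where "\<forall>x::real. -\<infinity> < ereal x \<longrightarrow> ereal x < \<infinity> \<longrightarrow> (P has_vector_derivative \<Theta> x) (at x)"
    using einterval_antiderivative[of "-\<infinity>" "\<infinity>" \<Theta>] cont by auto
  then have P: "(P has_real_derivative \<Theta> x) (at x)" for x
    by (simp add: has_real_derivative_iff_has_vector_derivative)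
  \<comment> \<open>The shift subtracts \<open>H 0\<close>, which is at most
    \<open>\<Theta> d\<close>; convexity bounds this by d * \<Theta> 1, hence by \<kappa>. The 1 in
    the denominator covers \<Theta> 1 = 0.\<close>
  define d where "d = min 1 (\<kappa> / (\<Theta> 1 + 1))"
  have T1: "0 < \<Theta> 1 + 1" using T0[of 1] by simp
  have d: "0 < d" "d \<le> 1" using \<kappa> T1 by (auto simp: d_def)
  have "\<Theta> d \<le> d * \<Theta> 1" using even_convex_scale_le[OF ec, of d 1] d by simp
  also have "\<dots> \<le> \<kappa> / (\<Theta> 1 + 1) * (\<Theta> 1 + 1)"
  proof (rule mult_mono)
    show "d \<le> \<kappa> / (\<Theta> 1 + 1)" unfolding d_def by (rule min.cobounded2)
    show "0 \<le> \<kappa> / (\<Theta> 1 + 1)" using \<kappa> T1 by simp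
  qed (use T0[of 1] in simp_all)
  also have "\<dots> = \<kappa>" using T1 by simp
  finally have d\<kappa>: "\<Theta> d \<le> \<kappa>" .
  define \<theta> where "\<theta> y = (\<Theta> (y + d) - \<Theta> (y - d)) / (2 * d)" for y
  define H where "H y = (P (y + d) - P (y - d)) / (2 * d)" for y
  have dP: "((\<lambda>y. P (y + c)) has_real_derivative \<Theta> (y + c)) (at y)" for y c
    using P[of "y + c"] DERIV_shift by blast
  have dH: "(H has_real_derivative \<theta> y) (at y)" for y
    unfolding H_def \<theta>_def using dP[of d y] dP[of "- d" y]
    by (intro DERIV_cdivide DERIV_diff) auto
  have \<theta>_mono: "\<theta> x \<le> \<theta> y" if "x \<le> y" for x y
    unfolding \<theta>_def using even_convex_difference_mono[OF ec d(1) that] d by (intro divide_right_mono) auto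
  have H_convex: "convex_on UNIV H"
    by (rule convex_on_realI[OF _ dH]) (auto intro: \<theta>_mono)
  have \<theta>_odd: "\<theta> (- y) = - \<theta> y" for y
  proof -
    have "\<Theta> (- y - d) = \<Theta> (y + d)" "\<Theta> (- y + d) = \<Theta> (y - d)"
      using even_convexD(1)[OF ec, of "y + d"] even_convexD(1)[OF ec, of "y - d"] by simp_all
    then show ?thesis by (simp only: \<theta>_def minus_divide_left minus_diff_eq)
  qed
  have H_even: "H (- y) = H y" for y
  proof -
    have "((\<lambda>y. H (- y)) has_real_derivative (\<theta> (- x) * - 1)) (at x)" for x
      by (rule DERIV_chain2[OF dH]) (auto intro!: derivative_eq_intros)
    then have dd: "((\<lambda>y. H (- y) - H y) has_real_derivative (\<theta> (- x) * - 1 - \<theta> x)) (at x)" for x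
      by (intro DERIV_diff dH)
    have "((\<lambda>y. H (- y) - H y) has_real_derivative 0) (at x)" for x
      using dd[of x] \<theta>_odd[of x] by simp
    then have "H (- y) - H y = H (- 0) - H 0"
      using DERIV_isconst_all[of "\<lambda>y. H (- y) - H y"] by blast
    then show ?thesis by simp
  qed
  \<comment> \<open>\<open>D t\<close> is 2 * t times the excess of the mean of \<Theta> over
    [y - t, y + t] above \<open>\<Theta> y\<close>; midpoint convexity makes its derivative
    nonnegative.\<close>
  have lower: "\<Theta> y \<le> H y" for y
  proof -
    define D where "D t = P (y + t) - P (y - t) - 2 * t * \<Theta> y" for t
    have "\<exists>z. (D has_real_derivative z) (at t) \<and> 0 \<le> z" for t
    proof (intro exI conjI)
      have "((\<lambda>t. P (y + t)) has_real_derivative \<Theta> (y + t)) (at t)" using dP[of y t] by (simp add: add.commute)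
      moreover have "((\<lambda>t. P (y - t)) has_real_derivative \<Theta> (y - t) * - 1) (at t)"
        by (rule DERIV_chain2[OF P]) (auto intro!: derivative_eq_intros)
      ultimately show "(D has_real_derivative \<Theta> (y + t) - \<Theta> (y - t) * - 1 - 2 * \<Theta> y) (at t)"
        unfolding D_def by (auto intro!: derivative_eq_intros)
      have "\<Theta> (((y + t) + (y - t)) / 2) \<le> \<Theta> (y + t) / 2 + \<Theta> (y - t) / 2"
        by (rule even_convex_midpoint[OF ec])
      then show "0 \<le> \<Theta> (y + t) - \<Theta> (y - t) * - 1 - 2 * \<Theta> y" by simp
    qed
    then have "D 0 \<le> D d" using d by (intro DERIV_nonneg_imp_nondecreasing[of 0 d D]) auto
    then show ?thesis using d by (simp add: D_def H_def field_simps)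
  qed
  have upper: "H y \<le> \<Theta> (\<bar>y\<bar> + d)" for y
  proof -
    obtain z where z: "y - d < z" "z < y + d" "P (y + d) - P (y - d) = (y + d - (y - d)) * \<Theta> z"
      using MVT2[of "y - d" "y + d" P \<Theta>] P d by auto
    then have "H y = \<Theta> z" using d by (simp add: H_def)
    also have "\<dots> \<le> \<Theta> (\<bar>y\<bar> + d)" using z by (intro even_convex_mono[OF ec]) auto
    finally show ?thesis .
  qed
  show ?thesis
  proof (rule that[of "\<lambda>y. H y - H 0" \<theta> "\<Theta> (2 * d)"])
    have "convex_on UNIV (\<lambda>y. H y - H 0)"
      using convex_on_add[OF H_convex, of "\<lambda>_. - H 0"] by (simp add: convex_on_const)
    then show "even_convex (\<lambda>y. H y - H 0)" by (simp add: even_convex_def H_even)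
    show "((\<lambda>y. H y - H 0) has_real_derivative \<theta> y) (at y)" for y
      using DERIV_diff[OF dH DERIV_const] by simp
    show "\<theta> \<in> borel_measurable borel"
      unfolding \<theta>_def
      by (intro borel_measurable_divide borel_measurable_diff even_convex_measurable[OF ec]) auto
    show "\<Theta> y \<le> (H y - H 0) + \<kappa>" for y
      using lower[of y] upper[of 0] d\<kappa> by simp
    \<comment> \<open>|y| + d is the midpoint of 2 * |y| and 2 * d, which is the origin of the
      argument 2 * y and of the constant.\<close>
    show "H y - H 0 \<le> \<Theta> (2 * y) + \<Theta> (2 * d)" for y
    proof -
      have "(2 * \<bar>y\<bar> + 2 * d) / 2 = \<bar>y\<bar> + d" by simp
      then have "\<Theta> (\<bar>y\<bar> + d) \<le> \<Theta> (2 * \<bar>y\<bar>) / 2 + \<Theta> (2 * d) / 2"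
        using even_convex_midpoint[OF ec, of "2 * \<bar>y\<bar>" "2 * d"] by metis
      moreover have "\<Theta> (2 * \<bar>y\<bar>) = \<Theta> (2 * y)"
        using even_convex_abs[OF ec, of "2 * y"] by (simp add: abs_mult)
      ultimately show ?thesis
        using upper[of y] lower[of 0] T0[of 0] T0[of "2 * y"] T0[of "2 * d"] by linarith
    qed
  qed
qed

lemma difference_quotient_LIMSEQ:
  fixes G :: "real \<Rightarrow> real"
  assumes "(G has_real_derivative D) (at x)"
  shows "(\<lambda>n. real (Suc n) * (G (x + 1 / real (Suc n) * v) - G x)) \<longlonglongrightarrow> D * v"
proof -
  have "((\<lambda>t. G (x + t * v)) has_real_derivative D * v) (at 0)"
    by (rule DERIV_chain2[where f=G and g="\<lambda>t. x + t * v"])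
      (use assms in \<open>auto intro!: derivative_eq_intros\<close>)
  then have "((\<lambda>h. (G (x + h * v) - G x) / h) \<longlongrightarrow> D * v) (at 0)"
    by (simp add: DERIV_def)
  moreover have "filterlim (\<lambda>n. 1 / real (Suc n)) (at 0) sequentially"
    using LIMSEQ_inverse_real_of_nat by (auto simp: filterlim_at inverse_eq_divide)
  ultimately have "(\<lambda>n. (G (x + 1 / real (Suc n) * v) - G x) / (1 / real (Suc n))) \<longlonglongrightarrow> D * v"
    by (rule filterlim_compose)
  then show ?thesis by (simp add: mult.commute)
qed

lemma DERIV_tangent_below:
  fixes G :: "real \<Rightarrow> real"
  assumes "even_convex G" "\<And>y. (G has_real_derivative \<theta> y) (at y)"
  shows "G y + \<theta> y * (z - y) \<le> G z"
proof -
  obtain m where m: "\<And>z. G z \<ge> G y + m * (z - y)"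
    using assms(1) unfolding even_convex_def by (metis convex_supporting_line)
  have "((\<lambda>z. G z - (G y + m * (z - y))) has_real_derivative (\<theta> y - m)) (at y)"
    by (auto intro!: derivative_eq_intros assms(2))
  then have "\<theta> y - m = 0"
    by (rule DERIV_local_min[where d=1]) (use m in auto)
  then show ?thesis using m[of z] by simp
qed

context prob_space
begin

lemma integrable_of_modular:
  assumes "even_convex g" "f \<in> borel_measurable M" "modular M g f < \<infinity>"
  shows "integrable M (\<lambda>\<omega>. g (f \<omega>))"
  using assms even_convex_measurable[OF assms(1,2)] even_convex_nonneg[OF assms(1)]
  by (simp add: integrable_iff_bounded modular_def)

lemma modular_eq_integral:
  assumes "even_convex g" "integrable M (\<lambda>\<omega>. g (f \<omega>))"
  shows "modular M g f = ennreal (\<integral>\<omega>. g (f \<omega>) \<partial>M)"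
  unfolding modular_def using assms even_convex_nonneg[OF assms(1)] by (intro nn_integral_eq_integral) auto

lemma integrable_of_nn_le:
  fixes h :: "'a \<Rightarrow> real"
  assumes "h \<in> borel_measurable M" "\<And>\<omega>. 0 \<le> h \<omega>" "(\<integral>\<^sup>+\<omega>. ennreal (h \<omega>) \<partial>M) \<le> ennreal c" "0 \<le> c"
  shows "integrable M h" "(\<integral>\<omega>. h \<omega> \<partial>M) \<le> c"
proof -
  show i: "integrable M h"
    using assms le_less_trans[OF assms(3) ennreal_less_top] by (simp add: integrable_iff_bounded)
  then show "(\<integral>\<omega>. h \<omega> \<partial>M) \<le> c"
    using assms by (subst (asm) nn_integral_eq_integral) auto
qed

lemma orlicz_fun_integrable:
  assumes g: "even_convex g" "superlinear g" and f: "f \<in> orlicz_fun M g"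
  shows "integrable M f"
proof -
  obtain c where c: "0 < c" "modular M g (\<lambda>\<omega>. c * f \<omega>) \<le> 1" using orlicz_fun_ball[OF g(1) f] by blast
  have fm: "f \<in> borel_measurable M" using f by (simp add: orlicz_fun_def)
  obtain T where T: "0 \<le> T" "\<And>y. 1 * \<bar>y\<bar> \<le> g y + T" using superlinearD[OF g(2)] by blast
  have "c * \<bar>y\<bar> \<le> g (c * y) + T" for y using T(2)[of "c * y"] c by (simp add: abs_mult)
  moreover have "modular M (\<lambda>y. g (c * y)) f \<le> ennreal 1" using c by (simp add: modular_comp_scale)
  ultimately have "(\<integral>\<^sup>+\<omega>. ennreal \<bar>f \<omega>\<bar> \<partial>M) \<le> ennreal ((1 + T) / c)"
    using T c fm by (intro nn_integral_le_modular[OF even_convex_comp_scale[OF g(1)], of c c T]) simp_all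
  then show ?thesis using fm le_less_trans[OF _ ennreal_less_top]
    by (auto simp: integrable_iff_bounded)
qed

end

context dominated_closed
begin

text \<open>Some scale c gives \<open>f\<close> a finite modular, and the growth condition is used
  at c / k. Having it for every positive constant is what admits every multiple k.\<close>

lemma A_integrable_compose:
  assumes G: "even_convex G" "\<And>c. 0 < c \<Longrightarrow> \<exists>a b. \<forall>y. G y \<le> a * \<bar>y\<bar> + F (c * y) + b"
    and f: "f \<in> A" and k: "0 < k"
  shows "integrable M (\<lambda>\<omega>. G (k * f \<omega>))"
proof -
  have fF: "f \<in> orlicz_fun M F" using f A_orlicz by blast
  have fm [measurable]: "f \<in> borel_measurable M" using f by (rule A_measurable)
  obtain c where c: "0 < c" "modular M F (\<lambda>\<omega>. c * f \<omega>) < \<infinity>" using fF by (rule orlicz_funE)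
  obtain a b where ab: "\<And>y. G y \<le> a * \<bar>y\<bar> + F (c / k * y) + b" using G(2)[of "c / k"] c k by auto
  have Gm: "(\<lambda>\<omega>. G (k * f \<omega>)) \<in> borel_measurable M" by (intro even_convex_measurable[OF G(1)]) auto
  have "integrable M (\<lambda>\<omega>. F (c * f \<omega>))"
    using c by (intro integrable_of_modular[OF F_ec]) auto
  moreover have "integrable M f" by (rule orlicz_fun_integrable[OF F_ec F_superlinear fF])
  ultimately have "integrable M (\<lambda>\<omega>. a * (k * \<bar>f \<omega>\<bar>) + F (c * f \<omega>) + b)" by auto
  then show ?thesis
  proof (rule Bochner_Integration.integrable_bound[OF _ Gm], intro AE_I2)
    fix \<omega>
    have "G (k * f \<omega>) \<le> a * (k * \<bar>f \<omega>\<bar>) + F (c * f \<omega>) + b"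
      using ab[of "k * f \<omega>"] k by (simp add: abs_mult)
    then show "norm (G (k * f \<omega>)) \<le> norm (a * (k * \<bar>f \<omega>\<bar>) + F (c * f \<omega>) + b)"
      using even_convex_nonneg[OF G(1), of "k * f \<omega>"] by simp
  qed
qed

text \<open>The separating functional is the derivative of $f \mapsto E[G(f)]$ at a minimiser \<open>f0\<close>, which
  need not belong to \<open>A\<close>: it is only an almost sure limit of a minimising sequence. Fatou's lemma
  for difference quotients replaces uniform integrability.\<close>

lemma separation:
  assumes 0: "(\<lambda>_. 0) \<notin> A"
  shows "\<exists>\<eta>\<in>orlicz_fun M \<Phi>. \<exists>m>0. \<forall>f\<in>A. m \<le> (\<integral>\<omega>. \<eta> \<omega> * f \<omega> \<partial>M)"
proof (cases "A = {}")
  \<comment> \<open>Over an empty set the infimum taken in the other case has no meaning; here every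
    functional separates.\<close>
  case True
  have "(\<lambda>_. 0) \<in> orlicz_fun M \<Phi>"
    using even_convexD(2)[OF young_function_even_convex[OF young]]
    by (intro orlicz_funI[of _ _ 1]) (auto simp: modular_def)
  then show ?thesis using True by (auto intro!: exI[of _ 1])
next
  case False
  obtain \<Theta> where \<Theta>: "even_convex \<Theta>" "\<And>y. \<bar>y\<bar> \<le> \<Theta> y"
    "\<And>c. 0 < c \<Longrightarrow> \<exists>a\<ge>0. \<forall>y. \<Theta> y \<le> a * \<bar>y\<bar> + F (c * y)"
    "\<And>f. f \<in> A \<Longrightarrow> ennreal (1/2) < modular M \<Theta> f"
    using gauge_exists[OF 0] by blast
  \<comment> \<open>The smoothing may cost 1/4 of the lower bound 1/2 for \<Theta>, which leaves a
    positive infimum.\<close>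
  obtain G \<theta> b where G: "even_convex G" "\<And>y. (G has_real_derivative \<theta> y) (at y)"
    "\<theta> \<in> borel_measurable borel" "\<And>y. \<Theta> y \<le> G y + 1/4" "\<And>y. G y \<le> \<Theta> (2 * y) + b"
    using even_convex_smoothing[OF \<Theta>(1), of "1/4"] by auto
  have [measurable]: "\<theta> \<in> borel_measurable borel" by (fact G(3))
  have [measurable]: "G \<in> borel_measurable borel" using even_convex_measurable[OF G(1), of "\<lambda>x. x"] by simp
  have G0: "0 \<le> G y" for y by (rule even_convex_nonneg[OF G(1)])
  have tangent: "G y + \<theta> y * (z - y) \<le> G z" for y z by (rule DERIV_tangent_below[OF G(1,2)])
  have G_bound: "\<exists>a b. \<forall>y. G y \<le> a * \<bar>y\<bar> + F (c * y) + b" if c: "0 < c" for c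
  proof -
    obtain a where a: "\<And>y. \<Theta> y \<le> a * \<bar>y\<bar> + F (c / 2 * y)" using \<Theta>(3)[of "c / 2"] c by auto
    have "G y \<le> (2 * a) * \<bar>y\<bar> + F (c * y) + b" for y
      using G(5)[of y] a[of "2 * y"] by (simp add: abs_mult)
    then show ?thesis by blast
  qed
  note intG = A_integrable_compose[OF G(1) G_bound]
  have intG1: "integrable M (\<lambda>\<omega>. G (f \<omega>))" if "f \<in> A" for f using intG[OF _ that, of 1] by simp
  define J where "J f = (\<integral>\<omega>. G (f \<omega>) \<partial>M)" for f
  have J_ge: "1/4 \<le> J f" if f: "f \<in> A" for f
  proof -
    have fm [measurable]: "f \<in> borel_measurable M" using f by (rule A_measurable)
    have "ennreal (1/2) \<le> modular M \<Theta> f" using \<Theta>(4)[OF f] by simp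
    also have "\<dots> \<le> (\<integral>\<^sup>+\<omega>. ennreal (G (f \<omega>) + 1/4) \<partial>M)"
      unfolding modular_def using G(4) by (intro nn_integral_mono ennreal_leI)
    also have "\<dots> = ennreal (\<integral>\<omega>. G (f \<omega>) + 1/4 \<partial>M)"
      using G0 intG1[OF f] by (intro nn_integral_eq_integral) auto
    also have "(\<integral>\<omega>. G (f \<omega>) + 1/4 \<partial>M) = J f + 1/4" using intG1[OF f] by (simp add: J_def prob_space)
    finally have "1/2 \<le> J f + 1/4" using G0 by (subst (asm) ennreal_le_iff) (auto simp: J_def)
    then show ?thesis by simp
  qed
  define m where "m = (INF f\<in>A. J f)"
  have bdd: "bdd_below (J ` A)" using J_ge by (intro bdd_belowI2[of _ "1/4"])
  have m_le: "m \<le> J f" if "f \<in> A" for f unfolding m_def using that bdd by (intro cINF_lower)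
  have m_ge: "1/4 \<le> m" unfolding m_def using J_ge False by (intro cINF_greatest)
  define D where "D k = {f \<in> A. J f \<le> m + 1 / real (Suc k)}" for k
  have J_convex: "J (\<lambda>\<omega>. u * f \<omega> + v * g \<omega>) \<le> u * J f + v * J g"
    if "f \<in> A" "g \<in> A" "0 \<le> u" "0 \<le> v" "u + v = 1" for f g u v
  proof -
    have "J (\<lambda>\<omega>. u * f \<omega> + v * g \<omega>) \<le> (\<integral>\<omega>. u * G (f \<omega>) + v * G (g \<omega>) \<partial>M)"
      unfolding J_def using that intG1 A_convex[OF that] even_convexD(3)[OF G(1)]
      by (intro integral_mono) auto
    then show ?thesis unfolding J_def using that intG1 by simp
  qed
  obtain f f0 where f: "\<And>k. f k \<in> D k" and f0 [measurable]: "f0 \<in> borel_measurable M"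
    and lim: "AE \<omega> in M. (\<lambda>k. f k \<omega>) \<longlonglongrightarrow> f0 \<omega>"
  proof (rule decreasing_convex_AE_convergent[of D "m + 2"])
    show "D k \<noteq> {}" for k
    proof -
      have "Inf (J ` A) < m + 1 / real (Suc k)" by (simp add: m_def)
      then obtain y where "y \<in> J ` A" "y < m + 1 / real (Suc k)"
        using cInf_lessD[of "J ` A"] False by auto
      then show ?thesis unfolding D_def by (auto intro: less_imp_le)
    qed
    show "decseq D"
    proof (rule decseq_SucI)
      fix n
      have "1 / real (Suc (Suc n)) \<le> 1 / real (Suc n)" by (intro divide_left_mono) auto
      then show "D (Suc n) \<le> D n" unfolding D_def by auto
    qed
    fix k u assume u: "u \<in> D k"
    then have uA: "u \<in> A" by (simp add: D_def)
    show um: "u \<in> borel_measurable M" using uA by (rule A_measurable)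
    have "(\<integral>\<^sup>+\<omega>. ennreal \<bar>u \<omega>\<bar> \<partial>M) \<le> (\<integral>\<^sup>+\<omega>. ennreal (G (u \<omega>) + 1/4) \<partial>M)"
    proof (intro nn_integral_mono ennreal_leI)
      fix \<omega> show "\<bar>u \<omega>\<bar> \<le> G (u \<omega>) + 1/4" using \<Theta>(2)[of "u \<omega>"] G(4)[of "u \<omega>"] by linarith
    qed
    also have "\<dots> = ennreal (\<integral>\<omega>. G (u \<omega>) + 1/4 \<partial>M)"
      using G0 intG1[OF uA] by (intro nn_integral_eq_integral) auto
    also have "(\<integral>\<omega>. G (u \<omega>) + 1/4 \<partial>M) = J u + 1/4" using intG1[OF uA] by (simp add: J_def prob_space)
    also have "ennreal (J u + 1/4) \<le> ennreal (m + 2)"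
    proof (rule ennreal_leI)
      have "1 / real (Suc k) \<le> 1" "J u \<le> m + 1 / real (Suc k)" using u by (simp_all add: D_def)
      then show "J u + 1/4 \<le> m + 2" by linarith
    qed
    finally show "(\<integral>\<^sup>+\<omega>. ennreal \<bar>u \<omega>\<bar> \<partial>M) \<le> ennreal (m + 2)" .
    fix v assume v: "v \<in> D k"
    have "J (\<lambda>\<omega>. (1/2) * u \<omega> + (1/2) * v \<omega>) \<le> (1/2) * J u + (1/2) * J v"
      using u v by (intro J_convex) (auto simp: D_def)
    also have "\<dots> \<le> (1/2) * (m + 1 / real (Suc k)) + (1/2) * (m + 1 / real (Suc k))"
      using u v unfolding D_def by (intro add_mono mult_left_mono) auto
    finally have "J (\<lambda>\<omega>. (1/2) * u \<omega> + (1/2) * v \<omega>) \<le> m + 1 / real (Suc k)" by simp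
    moreover have "(\<lambda>\<omega>. (1/2) * u \<omega> + (1/2) * v \<omega>) \<in> A"
      using u v by (intro A_convex) (auto simp: D_def)
    ultimately have "(\<lambda>\<omega>. (1/2) * u \<omega> + (1/2) * v \<omega>) \<in> D k" unfolding D_def by blast
    then show "(\<lambda>\<omega>. (u \<omega> + v \<omega>) / 2) \<in> D k" by (simp add: add_divide_distrib)
  qed auto
  have fA: "f k \<in> A" and fJ: "J (f k) \<le> m + 1 / real (Suc k)" for k using f[of k] by (auto simp: D_def)
  have fm [measurable]: "f k \<in> borel_measurable M" for k using fA A_measurable by blast
  have m0: "0 \<le> m" using m_ge by simp
  have lim_m: "(\<lambda>k. m + 1 / real (Suc k)) \<longlonglongrightarrow> m"
    using tendsto_add[OF tendsto_const[of m] LIMSEQ_inverse_real_of_nat] by (simp add: inverse_eq_divide)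
  have "modular M G f0 \<le> ennreal m"
  proof (rule modular_Fatou[OF G(1) fm lim _ tendsto_ennrealI[OF lim_m]])
    show "modular M G (f k) \<le> ennreal (m + 1 / real (Suc k))" for k
      using fJ[of k] modular_eq_integral[OF G(1) intG1[OF fA]] by (simp add: J_def ennreal_leI)
  qed
  then have intf0: "integrable M (\<lambda>\<omega>. G (f0 \<omega>))" and Jf0: "J f0 \<le> m"
    unfolding J_def modular_def using integrable_of_nn_le[of "\<lambda>\<omega>. G (f0 \<omega>)" m] G0 m0 by auto
  define \<eta> where "\<eta> \<omega> = \<theta> (f0 \<omega>)" for \<omega>
  have [measurable]: "\<eta> \<in> borel_measurable M" unfolding \<eta>_def by measurable
  \<comment> \<open>The first-order condition at \<open>f0\<close>, with m - J f0 in place of 0: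
    Fatou only gives J f0 \<le> m, and the value may drop in the limit.\<close>
  have main: "integrable M (\<lambda>\<omega>. \<eta> \<omega> * (g \<omega> - f0 \<omega>)) \<and> m - J f0 \<le> (\<integral>\<omega>. \<eta> \<omega> * (g \<omega> - f0 \<omega>) \<partial>M)"
    if g: "g \<in> A" for g
  proof -
    have gm [measurable]: "g \<in> borel_measurable M" using g by (rule A_measurable)
    \<comment> \<open>The convexity gap is nonnegative, so Fatou carries it to the limit although J
      itself may drop there. Along \<open>f k\<close> the mixture stays in \<open>A\<close> and has
      J at least m, which produces m and not \<open>J f0\<close> on the right.\<close>
    have gap: "(\<integral>\<^sup>+\<omega>. ennreal ((1 - t) * G (f0 \<omega>) + t * G (g \<omega>) - G ((1 - t) * f0 \<omega> + t * g \<omega>)) \<partial>M)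
        \<le> ennreal (t * (J g - m))" if t: "0 \<le> t" "t \<le> 1" for t
    proof (rule nn_integral_Fatou_le[where
          h="\<lambda>k \<omega>. (1 - t) * G (f k \<omega>) + t * G (g \<omega>) - G ((1 - t) * f k \<omega> + t * g \<omega>)" and
          c="\<lambda>k. ennreal ((1 - t) * (m + 1 / real (Suc k)) + t * J g - m)"])
      show "(\<lambda>\<omega>. (1 - t) * G (f k \<omega>) + t * G (g \<omega>) - G ((1 - t) * f k \<omega> + t * g \<omega>)) \<in> borel_measurable M" for k
        by measurable
      show "AE \<omega> in M. (\<lambda>k. (1 - t) * G (f k \<omega>) + t * G (g \<omega>) - G ((1 - t) * f k \<omega> + t * g \<omega>))
          \<longlonglongrightarrow> (1 - t) * G (f0 \<omega>) + t * G (g \<omega>) - G ((1 - t) * f0 \<omega> + t * g \<omega>)"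
        using lim by eventually_elim (intro tendsto_intros even_convex_tendsto[OF G(1)])
      have "(\<lambda>k. (1 - t) * (m + 1 / real (Suc k)) + t * J g - m) \<longlonglongrightarrow> (1 - t) * m + t * J g - m"
        by (intro tendsto_intros lim_m)
      also have "(1 - t) * m + t * J g - m = t * (J g - m)" by (simp add: algebra_simps)
      finally show "(\<lambda>k. ennreal ((1 - t) * (m + 1 / real (Suc k)) + t * J g - m)) \<longlonglongrightarrow> ennreal (t * (J g - m))"
        by (rule tendsto_ennrealI)
      fix k
      have mixA: "(\<lambda>\<omega>. (1 - t) * f k \<omega> + t * g \<omega>) \<in> A" using t g fA by (intro A_convex) auto
      have ints: "integrable M (\<lambda>\<omega>. (1 - t) * G (f k \<omega>) + t * G (g \<omega>))"
        "integrable M (\<lambda>\<omega>. G ((1 - t) * f k \<omega> + t * g \<omega>))"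
        using intG1[OF fA] intG1[OF g] intG1[OF mixA] by auto
      have "(\<integral>\<^sup>+\<omega>. ennreal ((1 - t) * G (f k \<omega>) + t * G (g \<omega>) - G ((1 - t) * f k \<omega> + t * g \<omega>)) \<partial>M) =
         ennreal (\<integral>\<omega>. (1 - t) * G (f k \<omega>) + t * G (g \<omega>) - G ((1 - t) * f k \<omega> + t * g \<omega>) \<partial>M)"
        using ints t even_convexD(3)[OF G(1), of "1 - t" t] by (intro nn_integral_eq_integral) auto
      also have "(\<integral>\<omega>. (1 - t) * G (f k \<omega>) + t * G (g \<omega>) - G ((1 - t) * f k \<omega> + t * g \<omega>) \<partial>M) =
          (1 - t) * J (f k) + t * J g - J (\<lambda>\<omega>. (1 - t) * f k \<omega> + t * g \<omega>)"
        unfolding J_def using ints intG1[OF fA] intG1[OF g] by simp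
      also have "ennreal \<dots> \<le> ennreal ((1 - t) * (m + 1 / real (Suc k)) + t * J g - m)"
        using m_le[OF mixA] fJ[of k] t by (intro ennreal_leI diff_mono add_mono mult_left_mono) auto
      finally show "(\<integral>\<^sup>+\<omega>. ennreal ((1 - t) * G (f k \<omega>) + t * G (g \<omega>) - G ((1 - t) * f k \<omega> + t * g \<omega>)) \<partial>M)
        \<le> ennreal ((1 - t) * (m + 1 / real (Suc k)) + t * J g - m)" .
    qed
    define R where "R \<omega> = G (g \<omega>) - G (f0 \<omega>) - \<eta> \<omega> * (g \<omega> - f0 \<omega>)" for \<omega>
    have R0: "0 \<le> R \<omega>" for \<omega> using tangent[of "f0 \<omega>" "g \<omega>"] by (simp add: R_def \<eta>_def)
    have [measurable]: "R \<in> borel_measurable M" unfolding R_def by measurable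
    \<comment> \<open>The gap divided by t = 1 / (n + 1); as t tends to 0 it tends to the Bregman
      remainder \<open>R\<close>. The bound t * (J g - m) is divided likewise and becomes
      independent of n.\<close>
    define q where "q n \<omega> = G (g \<omega>) - G (f0 \<omega>) -
      real (Suc n) * (G (f0 \<omega> + 1 / real (Suc n) * (g \<omega> - f0 \<omega>)) - G (f0 \<omega>))" for n \<omega>
    have R_le: "(\<integral>\<^sup>+\<omega>. ennreal (R \<omega>) \<partial>M) \<le> ennreal (J g - m)"
    proof (rule nn_integral_Fatou_le[where h=q and c="\<lambda>_. ennreal (J g - m)"])
      show "q n \<in> borel_measurable M" for n unfolding q_def by measurable
      show "AE \<omega> in M. (\<lambda>n. q n \<omega>) \<longlonglongrightarrow> R \<omega>"
        unfolding q_def R_def \<eta>_def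
        by (intro AE_I2 tendsto_diff tendsto_const difference_quotient_LIMSEQ G(2))
      fix n
      define t where "t = 1 / real (Suc n)"
      have t: "0 < t" "t \<le> 1" "real (Suc n) * t = 1" by (auto simp: t_def)
      have q_eq: "q n \<omega> = real (Suc n) * ((1 - t) * G (f0 \<omega>) + t * G (g \<omega>) - G ((1 - t) * f0 \<omega> + t * g \<omega>))" for \<omega>
      proof -
        have e: "f0 \<omega> + t * (g \<omega> - f0 \<omega>) = (1 - t) * f0 \<omega> + t * g \<omega>" by (simp add: algebra_simps)
        define N where "N = real (Suc n)"
        define Z where "Z = G ((1 - t) * f0 \<omega> + t * g \<omega>)"
        have "q n \<omega> = G (g \<omega>) - G (f0 \<omega>) - N * (Z - G (f0 \<omega>))"
          unfolding q_def t_def[symmetric] e Z_def N_def by simp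
        also have "\<dots> = (N * t) * G (g \<omega>) - (N * t) * G (f0 \<omega>) - N * (Z - G (f0 \<omega>))"
          using t(3) unfolding N_def by simp
        also have "\<dots> = N * ((1 - t) * G (f0 \<omega>) + t * G (g \<omega>) - Z)" by (simp add: algebra_simps)
        finally show ?thesis unfolding N_def Z_def .
      qed
      have gap0: "0 \<le> (1 - t) * G (f0 \<omega>) + t * G (g \<omega>) - G ((1 - t) * f0 \<omega> + t * g \<omega>)" for \<omega>
        using even_convexD(3)[OF G(1), of "1 - t" t "f0 \<omega>" "g \<omega>"] t by simp
      have "(\<integral>\<^sup>+\<omega>. ennreal (q n \<omega>) \<partial>M) = ennreal (real (Suc n)) *
        (\<integral>\<^sup>+\<omega>. ennreal ((1 - t) * G (f0 \<omega>) + t * G (g \<omega>) - G ((1 - t) * f0 \<omega> + t * g \<omega>)) \<partial>M)"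
        unfolding q_eq using gap0 by (subst nn_integral_cmult[symmetric]) (auto simp: ennreal_mult' simp del: of_nat_Suc)
      also have "\<dots> \<le> ennreal (real (Suc n)) * ennreal (t * (J g - m))"
        using gap[of t] t by (intro mult_left_mono) auto
      also have "\<dots> = ennreal (real (Suc n) * (t * (J g - m)))"
        by (rule ennreal_mult'[symmetric]) simp
      also have "real (Suc n) * (t * (J g - m)) = J g - m" using t(3) by (simp add: mult.assoc[symmetric] del: of_nat_Suc)
      finally show "(\<integral>\<^sup>+\<omega>. ennreal (q n \<omega>) \<partial>M) \<le> ennreal (J g - m)" .
    qed simp
    have intR: "integrable M R" and IR: "(\<integral>\<omega>. R \<omega> \<partial>M) \<le> J g - m"
      using integrable_of_nn_le[OF _ R0 R_le] m_le[OF g] by auto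
    have eq: "\<eta> \<omega> * (g \<omega> - f0 \<omega>) = G (g \<omega>) - G (f0 \<omega>) - R \<omega>" for \<omega> by (simp add: R_def)
    show ?thesis
      unfolding eq using intR IR intG1[OF g] intf0 by (simp add: J_def)
  qed
  obtain g0 where g0: "g0 \<in> A" using False by blast
  have [measurable]: "g0 \<in> borel_measurable M" using g0 by (rule A_measurable)
  have \<eta>f0_ge: "G (f0 \<omega>) \<le> \<eta> \<omega> * f0 \<omega>" for \<omega>
    using tangent[of "f0 \<omega>" 0] even_convexD(2)[OF G(1)] by (simp add: \<eta>_def)
  \<comment> \<open>\<open>main\<close> controls \<eta> only on differences g - f0. The tangent at
    f0, evaluated at 2 * g0, has the slope term \<eta> * (2 * g0 - f0) = 2 * \<eta> * (g0 - f0) +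
    \<eta> * f0 and so isolates \<eta> * f0; this is where G must be integrable along 2 *
    g0.\<close>
  have int\<eta>f0: "integrable M (\<lambda>\<omega>. \<eta> \<omega> * f0 \<omega>)"
  proof (rule Bochner_Integration.integrable_bound)
    show "integrable M (\<lambda>\<omega>. G (2 * g0 \<omega>) - 2 * (\<eta> \<omega> * (g0 \<omega> - f0 \<omega>)))"
      using intG[OF _ g0, of 2] main[OF g0] by (intro Bochner_Integration.integrable_diff integrable_mult_right) auto
    show "AE \<omega> in M. norm (\<eta> \<omega> * f0 \<omega>) \<le> norm (G (2 * g0 \<omega>) - 2 * (\<eta> \<omega> * (g0 \<omega> - f0 \<omega>)))"
    proof (rule AE_I2)
      fix \<omega>
      have "G (f0 \<omega>) + \<eta> \<omega> * (2 * g0 \<omega> - f0 \<omega>) \<le> G (2 * g0 \<omega>)"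
        unfolding \<eta>_def by (rule tangent)
      then have "\<eta> \<omega> * f0 \<omega> \<le> G (2 * g0 \<omega>) - 2 * (\<eta> \<omega> * (g0 \<omega> - f0 \<omega>))"
        using G0[of "f0 \<omega>"] by (simp add: algebra_simps)
      moreover have "0 \<le> \<eta> \<omega> * f0 \<omega>" using \<eta>f0_ge[of \<omega>] G0[of "f0 \<omega>"] by linarith
      ultimately show "norm (\<eta> \<omega> * f0 \<omega>) \<le> norm (G (2 * g0 \<omega>) - 2 * (\<eta> \<omega> * (g0 \<omega> - f0 \<omega>)))" by simp
    qed
  qed measurable
  have "\<eta> \<in> orlicz_fun M \<Phi>"
  proof -
    obtain a b1 where ab: "\<And>y. G y \<le> a * \<bar>y\<bar> + F (1 * y) + b1" using G_bound[of 1] by auto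
    obtain T where T: "\<And>y. a * \<bar>y\<bar> \<le> F y + T" using superlinearD[OF F_superlinear] by blast
    have G_F: "G y \<le> F (2 * y) + (T + b1)" for y
      using ab[of y] T[of y] even_convex_scale_le[OF F_ec, of "1/2" "2 * y"] by simp
    \<comment> \<open>Young's equality at \<eta> / 2 and the tangent evaluated at y / 2 make
      \<open>F y\<close> cancel, which leaves \<Phi> (\<eta> / 2) below \<eta> * f0 plus a constant.
      The factor 1/2 gives the room needed to bound G (y / 2) by F y plus a constant.\<close>
    have bound: "\<Phi> (1/2 * \<eta> \<omega>) \<le> \<bar>\<eta> \<omega> * f0 \<omega>\<bar> + \<bar>T + b1\<bar>" for \<omega>
    proof -
      obtain y where y: "\<Phi> (1/2 * \<eta> \<omega>) + F y = (1/2 * \<eta> \<omega>) * y" using young_equality[OF young] by blast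
      have "G (f0 \<omega>) + \<eta> \<omega> * (y / 2 - f0 \<omega>) \<le> G (y / 2)" unfolding \<eta>_def by (rule tangent)
      also have "\<dots> \<le> F y + (T + b1)" using G_F[of "y / 2"] by simp
      finally have "\<eta> \<omega> * (y / 2) \<le> \<eta> \<omega> * f0 \<omega> + F y + (T + b1)"
        using G0[of "f0 \<omega>"] by (simp add: algebra_simps)
      then show ?thesis using y by (simp add: algebra_simps)
    qed
    note ec\<Phi> = young_function_even_convex[OF young]
    have "integrable M (\<lambda>\<omega>. \<Phi> (1/2 * \<eta> \<omega>))"
    proof (rule Bochner_Integration.integrable_bound)
      show "integrable M (\<lambda>\<omega>. \<bar>\<eta> \<omega> * f0 \<omega>\<bar> + \<bar>T + b1\<bar>)" using int\<eta>f0 by auto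
      show "(\<lambda>\<omega>. \<Phi> (1/2 * \<eta> \<omega>)) \<in> borel_measurable M" by (intro even_convex_measurable[OF ec\<Phi>]) auto
      show "AE \<omega> in M. norm (\<Phi> (1/2 * \<eta> \<omega>)) \<le> norm (\<bar>\<eta> \<omega> * f0 \<omega>\<bar> + \<bar>T + b1\<bar>)"
        using bound even_convex_nonneg[OF ec\<Phi>] by (intro AE_I2) (simp add: order_trans[OF _ abs_ge_self])
    qed
    then have "modular M \<Phi> (\<lambda>\<omega>. 1/2 * \<eta> \<omega>) < \<infinity>"
      by (subst modular_eq_integral[OF ec\<Phi>]) (auto simp: ennreal_less_top)
    then show ?thesis by (intro orlicz_funI[of _ _ "1/2"]) auto
  qed
  moreover have "m \<le> (\<integral>\<omega>. \<eta> \<omega> * g \<omega> \<partial>M)" if g: "g \<in> A" for g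
  proof -
    have "(\<integral>\<omega>. \<eta> \<omega> * g \<omega> \<partial>M) = (\<integral>\<omega>. \<eta> \<omega> * f0 \<omega> + \<eta> \<omega> * (g \<omega> - f0 \<omega>) \<partial>M)"
      by (intro Bochner_Integration.integral_cong) (auto simp: algebra_simps)
    also have "\<dots> = (\<integral>\<omega>. \<eta> \<omega> * f0 \<omega> \<partial>M) + (\<integral>\<omega>. \<eta> \<omega> * (g \<omega> - f0 \<omega>) \<partial>M)"
      using main[OF g] int\<eta>f0 by (intro Bochner_Integration.integral_add) auto
    \<comment> \<open>The tangent at f0, evaluated at 0, gives G (f0) \<le> \<eta> * f0, and this
      makes up exactly for the term - J f0 in \<open>main\<close>.\<close>
    also have "J f0 \<le> (\<integral>\<omega>. \<eta> \<omega> * f0 \<omega> \<partial>M)"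
      unfolding J_def using intf0 int\<eta>f0 \<eta>f0_ge by (intro integral_mono) auto
    moreover have "m - J f0 \<le> (\<integral>\<omega>. \<eta> \<omega> * (g \<omega> - f0 \<omega>) \<partial>M)" using main[OF g] by blast
    ultimately show ?thesis by linarith
  qed
  ultimately show ?thesis using m_ge by (intro bexI[of _ \<eta>] exI[of _ m]) auto
qed

end

subsection \<open>Passage to equivalence classes\<close>

lemma equiv_as_eq: "equiv (borel_measurable M) (as_eq M)"
proof (rule equivI)
  show "sym (as_eq M)" by (auto simp: as_eq_def sym_def)
  show "trans (as_eq M)"
  proof (rule transI)
    fix f g h assume fgh: "(f, g) \<in> as_eq M" "(g, h) \<in> as_eq M"
    then have "AE \<omega> in M. f \<omega> = g \<omega>" "AE \<omega> in M. g \<omega> = h \<omega>" by (auto simp: as_eq_def)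
    then have "AE \<omega> in M. f \<omega> = h \<omega>" by eventually_elim simp
    then show "(f, h) \<in> as_eq M" using fgh by (auto simp: as_eq_def)
  qed
qed (auto simp: as_eq_def refl_on_def)

lemma L0_class_in_L0: "f \<in> borel_measurable M \<Longrightarrow> L0_class M f \<in> L0 M"
  unfolding L0_class_def L0_def by (rule quotientI)

lemma rep_in:
  assumes "\<xi> \<in> L0 M"
  shows "rep \<xi> \<in> \<xi>"
  using assms in_quotient_imp_non_empty[OF equiv_as_eq]
  unfolding L0_def rep_def by (metis ex_in_conv someI_ex)

lemma rep_measurable:
  assumes "\<xi> \<in> L0 M"
  shows "rep \<xi> \<in> borel_measurable M"
  using rep_in[OF assms] in_quotient_imp_subset[OF equiv_as_eq] assms unfolding L0_def by blast

lemma L0_class_rep: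
  assumes "\<xi> \<in> L0 M"
  shows "L0_class M (rep \<xi>) = \<xi>"
  using rep_in[OF assms] assms equiv_as_eq unfolding L0_def L0_class_def
  by (metis Image_singleton_iff equiv_class_eq quotientE)

lemma L0_class_eq_iff:
  assumes "f \<in> borel_measurable M" "g \<in> borel_measurable M"
  shows "L0_class M f = L0_class M g \<longleftrightarrow> (AE \<omega> in M. f \<omega> = g \<omega>)"
  unfolding L0_class_def using eq_equiv_class_iff[OF equiv_as_eq assms] assms by (simp add: as_eq_def)

lemma rep_L0_class:
  assumes "f \<in> borel_measurable M"
  shows "AE \<omega> in M. rep (L0_class M f) \<omega> = f \<omega>"
  using L0_class_eq_iff[OF rep_measurable[OF L0_class_in_L0[OF assms]] assms]
    L0_class_rep[OF L0_class_in_L0[OF assms]] by simp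

lemma L0_combination:
  assumes [measurable]: "f \<in> borel_measurable M" "g \<in> borel_measurable M"
  shows "L0_add M (L0_scale M u (L0_class M f)) (L0_scale M v (L0_class M g)) =
    L0_class M (\<lambda>\<omega>. u * f \<omega> + v * g \<omega>)"
proof -
  have [measurable]: "rep (L0_class M f) \<in> borel_measurable M" "rep (L0_class M g) \<in> borel_measurable M"
    by (intro rep_measurable L0_class_in_L0 assms)+
  have [measurable]: "rep (L0_scale M u (L0_class M f)) \<in> borel_measurable M"
    "rep (L0_scale M v (L0_class M g)) \<in> borel_measurable M"
    unfolding L0_scale_def by (intro rep_measurable L0_class_in_L0; measurable)+
  have "AE \<omega> in M. rep (L0_scale M u (L0_class M f)) \<omega> = u * rep (L0_class M f) \<omega>"
    "AE \<omega> in M. rep (L0_scale M v (L0_class M g)) \<omega> = v * rep (L0_class M g) \<omega>"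
    unfolding L0_scale_def by (intro rep_L0_class; measurable)+
  moreover note rep_L0_class[OF assms(1)] rep_L0_class[OF assms(2)]
  ultimately have "AE \<omega> in M. rep (L0_scale M u (L0_class M f)) \<omega> + rep (L0_scale M v (L0_class M g)) \<omega>
      = u * f \<omega> + v * g \<omega>"
    by eventually_elim simp
  then show ?thesis
    unfolding L0_add_def by (subst L0_class_eq_iff) (auto intro: borel_measurable_add)
qed

lemma orlicz_fun_cong_AE:
  assumes "AE \<omega> in M. f \<omega> = h \<omega>" "f \<in> borel_measurable M" "h \<in> orlicz_fun M g"
  shows "f \<in> orlicz_fun M g"
proof -
  obtain c where c: "0 < c" "modular M g (\<lambda>\<omega>. c * h \<omega>) < \<infinity>" using assms(3) by (rule orlicz_funE)
  have "modular M g (\<lambda>\<omega>. c * f \<omega>) = modular M g (\<lambda>\<omega>. c * h \<omega>)"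
    using assms(1) by (intro modular_cong_AE) auto
  then show ?thesis using c assms(2) by (intro orlicz_funI[of _ _ c]) auto
qed

lemma orlicz_space_iff:
  assumes g: "even_convex g"
  shows "\<xi> \<in> orlicz_space M g \<longleftrightarrow> \<xi> \<in> L0 M \<and> rep \<xi> \<in> orlicz_fun M g"
proof
  assume "\<xi> \<in> orlicz_space M g"
  then obtain c \<zeta> where c: "0 < c" and \<zeta>: "\<zeta> \<in> L0 M" "modular M g (rep \<zeta>) \<le> 1" and \<xi>: "\<xi> = L0_scale M c \<zeta>"
    by (auto simp: orlicz_space_def orlicz_ball_def modular_def)
  have [measurable]: "rep \<zeta> \<in> borel_measurable M" using \<zeta> by (simp add: rep_measurable)
  have m: "(\<lambda>\<omega>. c * rep \<zeta> \<omega>) \<in> borel_measurable M" by measurable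
  have \<xi>0: "\<xi> \<in> L0 M" unfolding \<xi> L0_scale_def by (rule L0_class_in_L0[OF m])
  have "modular M g (\<lambda>\<omega>. 1 * rep \<zeta> \<omega>) < \<infinity>" using \<zeta>(2) by (auto intro: le_less_trans)
  then have "rep \<zeta> \<in> orlicz_fun M g" by (intro orlicz_funI[of _ _ 1]) auto
  then have "(\<lambda>\<omega>. c * rep \<zeta> \<omega>) \<in> orlicz_fun M g" by (rule orlicz_fun_scale[OF g])
  moreover have "AE \<omega> in M. rep \<xi> \<omega> = c * rep \<zeta> \<omega>" unfolding \<xi> L0_scale_def by (rule rep_L0_class[OF m])
  ultimately have "rep \<xi> \<in> orlicz_fun M g" by (intro orlicz_fun_cong_AE[OF _ rep_measurable[OF \<xi>0]])
  with \<xi>0 show "\<xi> \<in> L0 M \<and> rep \<xi> \<in> orlicz_fun M g" by blast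
next
  assume \<xi>: "\<xi> \<in> L0 M \<and> rep \<xi> \<in> orlicz_fun M g"
  then obtain c where c: "0 < c" "modular M g (\<lambda>\<omega>. c * rep \<xi> \<omega>) \<le> 1" using orlicz_fun_ball[OF g] by blast
  have [measurable]: "rep \<xi> \<in> borel_measurable M" using \<xi> by (simp add: rep_measurable)
  have m: "(\<lambda>\<omega>. c * rep \<xi> \<omega>) \<in> borel_measurable M" by measurable
  define \<zeta> where "\<zeta> = L0_class M (\<lambda>\<omega>. c * rep \<xi> \<omega>)"
  have \<zeta>0: "\<zeta> \<in> L0 M" unfolding \<zeta>_def by (rule L0_class_in_L0[OF m])
  have [measurable]: "rep \<zeta> \<in> borel_measurable M" using \<zeta>0 by (rule rep_measurable)
  have ae: "AE \<omega> in M. rep \<zeta> \<omega> = c * rep \<xi> \<omega>" unfolding \<zeta>_def by (rule rep_L0_class[OF m])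
  have "modular M g (rep \<zeta>) \<le> 1" using c(2) modular_cong_AE[OF ae] by simp
  then have "\<zeta> \<in> orlicz_ball M g" using \<zeta>0 by (simp add: orlicz_ball_def modular_def)
  moreover have "L0_scale M (1 / c) \<zeta> = \<xi>"
  proof -
    have "AE \<omega> in M. 1 / c * rep \<zeta> \<omega> = rep \<xi> \<omega>" using ae by eventually_elim (use c in simp)
    then have "L0_scale M (1 / c) \<zeta> = L0_class M (rep \<xi>)"
      unfolding L0_scale_def by (subst L0_class_eq_iff) auto
    then show ?thesis using \<xi> L0_class_rep by blast
  qed
  ultimately show "\<xi> \<in> orlicz_space M g" unfolding orlicz_space_def using c(1)
    by (intro UN_I[of "1 / c"]) (auto intro: rev_image_eqI)
qed

lemma L0_class_in_orlicz_space_iff: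
  assumes g: "even_convex g" and f: "f \<in> borel_measurable M"
  shows "L0_class M f \<in> orlicz_space M g \<longleftrightarrow> f \<in> orlicz_fun M g"
proof -
  have ae: "AE \<omega> in M. rep (L0_class M f) \<omega> = f \<omega>" using f by (rule rep_L0_class)
  then have ae': "AE \<omega> in M. f \<omega> = rep (L0_class M f) \<omega>" by eventually_elim simp
  show ?thesis
    using orlicz_fun_cong_AE[OF ae] orlicz_fun_cong_AE[OF ae' f] f
    by (auto simp: orlicz_space_iff[OF g] L0_class_in_L0 rep_measurable)
qed

lemma orlicz_duality_integrable:
  assumes \<Phi>: "young_function \<Phi>" and f: "f \<in> orlicz_fun M \<Phi>" and h: "h \<in> orlicz_fun M (young_conjugate \<Phi>)"
  shows "integrable M (\<lambda>\<omega>. f \<omega> * h \<omega>)"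
proof -
  note ec = young_function_even_convex[OF \<Phi>] even_convex_young_conjugate[OF \<Phi>]
  obtain c where c: "0 < c" "modular M \<Phi> (\<lambda>\<omega>. c * f \<omega>) < \<infinity>" and [measurable]: "f \<in> borel_measurable M"
    using f by (rule orlicz_funE)
  obtain d where d: "0 < d" "modular M (young_conjugate \<Phi>) (\<lambda>\<omega>. d * h \<omega>) < \<infinity>"
    and [measurable]: "h \<in> borel_measurable M"
    using h by (rule orlicz_funE)
  have [measurable]: "(\<lambda>\<omega>. \<Phi> (c * f \<omega>)) \<in> borel_measurable M" "(\<lambda>\<omega>. young_conjugate \<Phi> (d * h \<omega>)) \<in> borel_measurable M"
    by (intro even_convex_measurable[OF ec(1)] even_convex_measurable[OF ec(2)]; measurable)+
  have "integrable M (\<lambda>\<omega>. \<Phi> (c * f \<omega>))" "integrable M (\<lambda>\<omega>. young_conjugate \<Phi> (d * h \<omega>))"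
    using c d even_convex_nonneg[OF ec(1)] even_convex_nonneg[OF ec(2)]
    by (auto simp: integrable_iff_bounded modular_def)
  then have "integrable M (\<lambda>\<omega>. 1 / (c * d) * (\<Phi> (c * f \<omega>) + young_conjugate \<Phi> (d * h \<omega>)))" by auto
  then show ?thesis
  proof (rule Bochner_Integration.integrable_bound)
    show "AE \<omega> in M. norm (f \<omega> * h \<omega>) \<le> norm (1 / (c * d) * (\<Phi> (c * f \<omega>) + young_conjugate \<Phi> (d * h \<omega>)))"
    proof (rule AE_I2)
      fix \<omega>
      have "(c * d) * \<bar>f \<omega> * h \<omega>\<bar> = \<bar>(c * f \<omega>) * (d * h \<omega>)\<bar>" using c d by (simp add: abs_mult)
      also have "\<dots> \<le> \<Phi> (c * f \<omega>) + young_conjugate \<Phi> (d * h \<omega>)" by (rule young_inequality[OF \<Phi>])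
      finally have "\<bar>f \<omega> * h \<omega>\<bar> \<le> 1 / (c * d) * (\<Phi> (c * f \<omega>) + young_conjugate \<Phi> (d * h \<omega>))"
        using c d by (simp add: pos_le_divide_eq mult.commute)
      then show "norm (f \<omega> * h \<omega>) \<le> norm (1 / (c * d) * (\<Phi> (c * f \<omega>) + young_conjugate \<Phi> (d * h \<omega>)))"
        unfolding real_norm_def by (rule order_trans[OF _ abs_ge_self])
    qed
  qed measurable
qed

section \<open>Sequences in the weak topology and in the topology of convergence in
  probability\<close>

text \<open>It suffices to test the subbasis: the property of eventually capturing \<open>y\<close>,
  whenever \<open>x\<close> belongs to the set, is stable under the finite intersections and the
  unions that generate the topology.\<close>

lemma eventually_in_topology_generated_by:
  assumes "openin (topology_generated_by \<S>) U" "x \<in> U"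
    and "\<And>B. B \<in> \<S> \<Longrightarrow> x \<in> B \<Longrightarrow> eventually (\<lambda>n. y n \<in> B) F"
  shows "eventually (\<lambda>n. y n \<in> U) F"
proof -
  have "generate_topology_on \<S> U" using assms(1) by (simp add: openin_topology_generated_by_iff)
  then show ?thesis using assms(2)
  proof induction
    case (Int a b)
    then show ?case by (auto intro: eventually_conj)
  next
    case (UN K)
    then obtain k where "k \<in> K" "x \<in> k" by blast
    then have "eventually (\<lambda>n. y n \<in> k) F" using UN by blast
    then show ?case by (rule eventually_mono) (use \<open>k \<in> K\<close> in blast)
  qed (use assms(3) in auto)
qed

text \<open>The generating family has to cover \<open>E\<close>, which takes at least one
  functional: the class of 0 together with \<open>UNIV\<close> yields \<open>E\<close>
  itself.\<close>

lemma topspace_weak_topology: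
  assumes g: "even_convex g"
  shows "topspace (weak_topology M E (orlicz_space M g)) = E"
proof -
  have "L0_class M (\<lambda>_. 0) \<in> orlicz_space M g"
    using even_convexD(2)[OF g]
    by (subst L0_class_in_orlicz_space_iff[OF g]) (auto intro!: orlicz_funI[of _ _ 1] simp: modular_def)
  then have "E \<in> {{\<xi> \<in> E. pairing M \<eta> \<xi> \<in> U} | \<eta> U. \<eta> \<in> orlicz_space M g \<and> open U}"
  proof (intro CollectI exI conjI)
    show "E = {\<xi> \<in> E. pairing M (L0_class M (\<lambda>_. 0)) \<xi> \<in> UNIV}" by simp
  qed auto
  then show ?thesis unfolding weak_topology_def topology_generated_by_topspace by blast
qed

context prob_space
begin

lemma topspace_L0_topology: "topspace (L0_topology M) = L0 M"
proof
  show "topspace (L0_topology M) \<subseteq> L0 M" using openin_L0_topology openin_topspace by blast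
  have "openin (L0_topology M) (L0 M)" unfolding openin_L0_topology using zero_less_one by blast
  then show "L0 M \<subseteq> topspace (L0_topology M)" by (rule openin_subset)
qed

lemma AE_limit_in_L0_closed:
  assumes S: "closedin (L0_topology M) S" and \<xi>: "\<And>n. \<xi> n \<in> S" and g: "g \<in> borel_measurable M"
    and lim: "AE \<omega> in M. (\<lambda>n. rep (\<xi> n) \<omega>) \<longlonglongrightarrow> g \<omega>"
  shows "L0_class M g \<in> S"
proof (rule ccontr)
  assume neg: "L0_class M g \<notin> S"
  have op: "openin (L0_topology M) (L0 M - S)" and SL: "S \<subseteq> L0 M"
    using S by (auto simp: closedin_def topspace_L0_topology)
  define \<gamma> where "\<gamma> = L0_class M g"
  have \<gamma>: "\<gamma> \<in> L0 M - S" using neg g by (simp add: \<gamma>_def L0_class_in_L0)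
  obtain \<epsilon> where \<epsilon>: "\<epsilon> > 0"
    "\<And>\<eta>. \<eta> \<in> L0 M \<Longrightarrow> measure M {\<omega> \<in> space M. \<bar>rep \<eta> \<omega> - rep \<gamma> \<omega>\<bar> > \<epsilon>} < \<epsilon> \<Longrightarrow> \<eta> \<in> L0 M - S"
    using op \<gamma> unfolding openin_L0_topology by blast
  have [measurable]: "rep \<gamma> \<in> borel_measurable M" "rep (\<xi> n) \<in> borel_measurable M" for n
    using \<gamma> \<xi> SL by (auto intro!: rep_measurable)
  define B where "B n = {\<omega> \<in> space M. \<bar>rep (\<xi> n) \<omega> - rep \<gamma> \<omega>\<bar> > \<epsilon>}" for n
  have [measurable]: "B n \<in> sets M" for n unfolding B_def by measurable
  have "(\<lambda>n. \<integral>\<omega>. indicator (B n) \<omega> \<partial>M :: real) \<longlonglongrightarrow> (\<integral>\<omega>. 0 \<partial>M)"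
  proof (rule integral_dominated_convergence[where w="\<lambda>_. 1"])
    show "AE \<omega> in M. (\<lambda>n. indicator (B n) \<omega> :: real) \<longlonglongrightarrow> 0"
      using lim rep_L0_class[OF g]
    proof eventually_elim
      case (elim \<omega>)
      then have "(\<lambda>n. \<bar>rep (\<xi> n) \<omega> - rep \<gamma> \<omega>\<bar>) \<longlonglongrightarrow> 0"
        by (simp add: \<gamma>_def LIM_zero tendsto_rabs_zero)
      then have "eventually (\<lambda>n. \<bar>rep (\<xi> n) \<omega> - rep \<gamma> \<omega>\<bar> < \<epsilon>) sequentially"
        using \<epsilon>(1) by (rule order_tendstoD(2))
      then have "eventually (\<lambda>n. indicator (B n) \<omega> = (0::real)) sequentially"
        by eventually_elim (simp add: B_def)
      then show ?case by (rule tendsto_eventually)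
    qed
  qed (auto simp: indicator_def)
  then have "(\<lambda>n. measure M (B n)) \<longlonglongrightarrow> 0" by simp
  then have "eventually (\<lambda>n. measure M (B n) < \<epsilon>) sequentially"
    using \<epsilon>(1) by (rule order_tendstoD(2))
  then obtain n where "measure M (B n) < \<epsilon>" by (auto simp: eventually_sequentially)
  then have "\<xi> n \<in> L0 M - S" using \<epsilon>(2)[of "\<xi> n"] \<xi> SL unfolding B_def by blast
  then show False using \<xi> by blast
qed

text \<open>Radii 2^-n yield a sequence in \<open>S\<close> that converges in probability fast
  enough for Borel-Cantelli, hence almost surely. So closedness only has to be tested on almost
  surely convergent sequences.\<close>

lemma L0_closedI:
  assumes SL: "S \<subseteq> L0 M"
    and seq: "\<And>\<xi> \<gamma>. (\<And>n::nat. \<xi> n \<in> S) \<Longrightarrow> \<gamma> \<in> L0 M \<Longrightarrow>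
      AE \<omega> in M. (\<lambda>n. rep (\<xi> n) \<omega>) \<longlonglongrightarrow> rep \<gamma> \<omega> \<Longrightarrow> \<gamma> \<in> S"
  shows "closedin (L0_topology M) S"
proof (rule ccontr)
  assume "\<not> ?thesis"
  then have "\<not> openin (L0_topology M) (L0 M - S)"
    using SL by (simp add: closedin_def topspace_L0_topology)
  then obtain \<gamma> where \<gamma>: "\<gamma> \<in> L0 M - S"
    "\<And>\<epsilon>. \<epsilon> > 0 \<Longrightarrow> \<exists>\<eta>\<in>L0 M. measure M {\<omega> \<in> space M. \<bar>rep \<eta> \<omega> - rep \<gamma> \<omega>\<bar> > \<epsilon>} < \<epsilon> \<and> \<eta> \<notin> L0 M - S"
    unfolding openin_L0_topology by blast
  have "\<exists>\<eta>\<in>S. measure M {\<omega> \<in> space M. \<bar>rep \<eta> \<omega> - rep \<gamma> \<omega>\<bar> > (1/2)^n} < (1/2)^n" for n :: nat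
    using \<gamma>(2)[of "(1/2)^n"] by auto
  then have "\<exists>\<xi>. \<forall>n::nat. \<xi> n \<in> S \<and>
      measure M {\<omega> \<in> space M. \<bar>rep (\<xi> n) \<omega> - rep \<gamma> \<omega>\<bar> > (1/2)^n} < (1/2)^n"
    by (intro choice) blast
  then obtain \<xi> where \<xi>: "\<And>n::nat. \<xi> n \<in> S"
    "\<And>n. measure M {\<omega> \<in> space M. \<bar>rep (\<xi> n) \<omega> - rep \<gamma> \<omega>\<bar> > (1/2)^n} < (1/2)^n" by blast
  have [measurable]: "rep \<gamma> \<in> borel_measurable M" "rep (\<xi> n) \<in> borel_measurable M" for n
    using \<gamma>(1) \<xi>(1) SL by (auto intro!: rep_measurable)
  have "AE \<omega> in M. eventually (\<lambda>n. \<omega> \<in> space M - {\<omega> \<in> space M. \<bar>rep (\<xi> n) \<omega> - rep \<gamma> \<omega>\<bar> > (1/2)^n}) sequentially"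
  proof (rule borel_cantelli_AE1)
    show "summable (\<lambda>n. measure M {\<omega> \<in> space M. \<bar>rep (\<xi> n) \<omega> - rep \<gamma> \<omega>\<bar> > (1/2)^n})"
    proof (rule summable_comparison_test'[of "\<lambda>n. (1/2::real)^n" 0])
      show "summable (\<lambda>n. (1/2::real)^n)" by (rule summable_geometric) simp
      show "norm (measure M {\<omega> \<in> space M. \<bar>rep (\<xi> n) \<omega> - rep \<gamma> \<omega>\<bar> > (1/2)^n}) \<le> (1/2)^n" for n
        using less_imp_le[OF \<xi>(2)[of n]] by simp
    qed
  qed (auto simp: less_top[symmetric])
  then have "AE \<omega> in M. (\<lambda>n. rep (\<xi> n) \<omega>) \<longlonglongrightarrow> rep \<gamma> \<omega>"
  proof eventually_elim
    case (elim \<omega>)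
    then have "eventually (\<lambda>n. norm (rep (\<xi> n) \<omega> - rep \<gamma> \<omega>) \<le> (1/2)^n) sequentially"
      by eventually_elim auto
    moreover have "(\<lambda>n. (1/2::real)^n) \<longlonglongrightarrow> 0" by (rule LIMSEQ_realpow_zero) auto
    ultimately have "(\<lambda>n. rep (\<xi> n) \<omega> - rep \<gamma> \<omega>) \<longlonglongrightarrow> 0"
      by (rule Lim_null_comparison)
    then show ?case by (rule LIM_zero_cancel)
  qed
  then have "\<gamma> \<in> S" by (rule seq[OF \<xi>(1) DiffD1[OF \<gamma>(1)]])
  then show False using \<gamma>(1) by blast
qed

lemma order_interval_iff:
  "\<xi> \<in> order_interval M \<zeta> \<longleftrightarrow> \<xi> \<in> L0 M \<and> (AE \<omega> in M. \<bar>rep \<xi> \<omega>\<bar> \<le> rep \<zeta> \<omega>)"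
proof -
  have "\<bar>a\<bar> \<le> b \<longleftrightarrow> - b \<le> a \<and> a \<le> b" for a b :: real by auto
  then show ?thesis by (simp add: order_interval_def)
qed

section \<open>The two implications between weak and order interval closedness\<close>

lemma weakly_closed_imp_order_interval_closed:
  assumes \<Phi>: "young_function \<Phi>" and C: "C \<subseteq> orlicz_space M (young_conjugate \<Phi>)"
    and cl: "closedin (weak_topology M (orlicz_space M (young_conjugate \<Phi>)) (orlicz_space M \<Phi>)) C"
    and \<zeta>: "\<zeta> \<in> orlicz_space M (young_conjugate \<Phi>)"
  shows "closedin (L0_topology M) (C \<inter> order_interval M \<zeta>)"
proof (rule L0_closedI)
  show "C \<inter> order_interval M \<zeta> \<subseteq> L0 M" by (auto simp: order_interval_iff)
  note ec = young_function_even_convex[OF \<Phi>] and ecF = even_convex_young_conjugate[OF \<Phi>]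
  let ?E = "orlicz_space M (young_conjugate \<Phi>)"
  have \<zeta>F: "rep \<zeta> \<in> orlicz_fun M (young_conjugate \<Phi>)" using \<zeta> by (simp add: orlicz_space_iff[OF ecF])
  fix \<xi> \<gamma>
  assume \<xi>: "\<And>n::nat. \<xi> n \<in> C \<inter> order_interval M \<zeta>" and \<gamma>: "\<gamma> \<in> L0 M"
    and lim: "AE \<omega> in M. (\<lambda>n. rep (\<xi> n) \<omega>) \<longlonglongrightarrow> rep \<gamma> \<omega>"
  have \<xi>L: "\<xi> n \<in> L0 M" for n using \<xi> by (auto simp: order_interval_iff)
  have [measurable]: "rep \<gamma> \<in> borel_measurable M" "rep (\<xi> n) \<in> borel_measurable M" for n
    using \<gamma> \<xi>L by (auto intro: rep_measurable)
  have dom: "AE \<omega> in M. \<forall>n. \<bar>rep (\<xi> n) \<omega>\<bar> \<le> rep \<zeta> \<omega>"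
    using \<xi> by (simp add: AE_all_countable order_interval_iff)
  have \<gamma>_le: "AE \<omega> in M. \<bar>rep \<gamma> \<omega>\<bar> \<le> rep \<zeta> \<omega>"
    using dom lim
  proof eventually_elim
    case (elim \<omega>)
    show ?case by (rule LIMSEQ_le_const2[OF tendsto_rabs[OF elim(2)]]) (use elim(1) in auto)
  qed
  then have \<gamma>I: "\<gamma> \<in> order_interval M \<zeta>" using \<gamma> by (simp add: order_interval_iff)
  have "AE \<omega> in M. \<bar>rep \<gamma> \<omega>\<bar> \<le> \<bar>rep \<zeta> \<omega>\<bar>" using \<gamma>_le by eventually_elim simp
  then have "rep \<gamma> \<in> orlicz_fun M (young_conjugate \<Phi>)" by (intro orlicz_fun_solid[OF ecF \<zeta>F]) auto
  then have \<gamma>E: "\<gamma> \<in> ?E" using \<gamma> by (simp add: orlicz_space_iff[OF ecF])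
  have "\<gamma> \<in> C"
  proof (rule ccontr)
    assume "\<gamma> \<notin> C"
    have "openin (weak_topology M ?E (orlicz_space M \<Phi>)) (?E - C)"
      using cl by (simp add: closedin_def topspace_weak_topology[OF ec])
    then have "eventually (\<lambda>n. \<xi> n \<in> ?E - C) sequentially"
      unfolding weak_topology_def
    proof (rule eventually_in_topology_generated_by)
      show "\<gamma> \<in> ?E - C" using \<gamma>E \<open>\<gamma> \<notin> C\<close> by blast
      fix B assume "B \<in> {{\<xi> \<in> ?E. pairing M \<eta> \<xi> \<in> U} | \<eta> U. \<eta> \<in> orlicz_space M \<Phi> \<and> open U}" and "\<gamma> \<in> B"
      then obtain \<eta> U where B: "B = {\<xi> \<in> ?E. pairing M \<eta> \<xi> \<in> U}" and \<eta>: "\<eta> \<in> orlicz_space M \<Phi>"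
        and U: "open U" "pairing M \<eta> \<gamma> \<in> U" by blast
      have \<eta>\<Phi>: "rep \<eta> \<in> orlicz_fun M \<Phi>" using \<eta> by (simp add: orlicz_space_iff[OF ec])
      then have [measurable]: "rep \<eta> \<in> borel_measurable M" by (simp add: orlicz_fun_def)
      have "(\<lambda>n. pairing M \<eta> (\<xi> n)) \<longlonglongrightarrow> pairing M \<eta> \<gamma>"
        unfolding pairing_def
      proof (rule integral_dominated_convergence[where w="\<lambda>\<omega>. \<bar>rep \<eta> \<omega> * rep \<zeta> \<omega>\<bar>"])
        show "integrable M (\<lambda>\<omega>. \<bar>rep \<eta> \<omega> * rep \<zeta> \<omega>\<bar>)"
          using orlicz_duality_integrable[OF \<Phi> \<eta>\<Phi> \<zeta>F] by (rule integrable_abs)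
        show "AE \<omega> in M. (\<lambda>n. rep \<eta> \<omega> * rep (\<xi> n) \<omega>) \<longlonglongrightarrow> rep \<eta> \<omega> * rep \<gamma> \<omega>"
          using lim by eventually_elim (intro tendsto_intros)
        show "AE \<omega> in M. norm (rep \<eta> \<omega> * rep (\<xi> n) \<omega>) \<le> \<bar>rep \<eta> \<omega> * rep \<zeta> \<omega>\<bar>" for n
          using dom
        proof eventually_elim
          case (elim \<omega>)
          then have "\<bar>rep (\<xi> n) \<omega>\<bar> \<le> \<bar>rep \<zeta> \<omega>\<bar>" by (meson abs_ge_self order_trans)
          then show ?case by (simp add: abs_mult mult_left_mono)
        qed
      qed measurable
      then have "eventually (\<lambda>n. pairing M \<eta> (\<xi> n) \<in> U) sequentially"
        using U by (rule topological_tendstoD)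
      then show "eventually (\<lambda>n. \<xi> n \<in> B) sequentially"
        using \<xi> C unfolding B by (auto elim!: eventually_mono)
    qed
    then obtain n where "\<xi> n \<in> ?E - C" by (auto simp: eventually_sequentially)
    then show False using \<xi> by blast
  qed
  then show "\<gamma> \<in> C \<inter> order_interval M \<zeta>" using \<gamma>I by blast
qed

text \<open>An order bound z for the functions f k becomes the order bound z + |h| for the
  translates f k + h. The closedness hypothesis is therefore used in the single order interval given
  by the class of z + |h|.\<close>

lemma dominated_closed_translate:
  assumes \<Phi>: "young_function \<Phi>" "Delta2 \<Phi>" and C: "C \<subseteq> orlicz_space M (young_conjugate \<Phi>)"
    and conv: "L0_convex M C"
    and cl: "\<And>\<zeta>. \<zeta> \<in> orlicz_space M (young_conjugate \<Phi>) \<Longrightarrow> closedin (L0_topology M) (C \<inter> order_interval M \<zeta>)"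
    and h: "h \<in> orlicz_fun M (young_conjugate \<Phi>)"
  shows "dominated_closed M \<Phi> {f \<in> borel_measurable M. L0_class M (\<lambda>\<omega>. f \<omega> + h \<omega>) \<in> C}"
proof (unfold_locales)
  note ecF = even_convex_young_conjugate[OF \<Phi>(1)]
  let ?F = "young_conjugate \<Phi>" and ?A = "{f \<in> borel_measurable M. L0_class M (\<lambda>\<omega>. f \<omega> + h \<omega>) \<in> C}"
  have hm [measurable]: "h \<in> borel_measurable M" using h by (simp add: orlicz_fun_def)
  show "young_function \<Phi>" "Delta2 \<Phi>" by fact+
  show "?A \<subseteq> orlicz_fun M ?F"
  proof
    fix f assume f: "f \<in> ?A"
    then have [measurable]: "f \<in> borel_measurable M" by simp
    have m: "(\<lambda>\<omega>. f \<omega> + h \<omega>) \<in> borel_measurable M" by measurable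
    have "(\<lambda>\<omega>. f \<omega> + h \<omega>) \<in> orlicz_fun M ?F"
      using f C L0_class_in_orlicz_space_iff[OF ecF m] by blast
    from orlicz_fun_add[OF ecF this orlicz_fun_scale[OF ecF h, of "-1"]]
    show "f \<in> orlicz_fun M ?F" by simp
  qed
  show "(\<lambda>\<omega>. u * f \<omega> + v * g \<omega>) \<in> ?A" if "f \<in> ?A" "g \<in> ?A" "0 \<le> u" "0 \<le> v" "u + v = 1" for f g u v
  proof -
    have [measurable]: "f \<in> borel_measurable M" "g \<in> borel_measurable M" using that by auto
    have "L0_add M (L0_scale M u (L0_class M (\<lambda>\<omega>. f \<omega> + h \<omega>))) (L0_scale M v (L0_class M (\<lambda>\<omega>. g \<omega> + h \<omega>))) \<in> C"
      using conv that unfolding L0_convex_def by blast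
    also have "L0_add M (L0_scale M u (L0_class M (\<lambda>\<omega>. f \<omega> + h \<omega>))) (L0_scale M v (L0_class M (\<lambda>\<omega>. g \<omega> + h \<omega>)))
        = L0_class M (\<lambda>\<omega>. u * (f \<omega> + h \<omega>) + v * (g \<omega> + h \<omega>))"
      by (rule L0_combination) measurable
    also have "(\<lambda>\<omega>. u * (f \<omega> + h \<omega>) + v * (g \<omega> + h \<omega>)) = (\<lambda>\<omega>. u * f \<omega> + v * g \<omega> + h \<omega>)"
    proof
      fix \<omega>
      have "u * (f \<omega> + h \<omega>) + v * (g \<omega> + h \<omega>) = u * f \<omega> + v * g \<omega> + (u + v) * h \<omega>" by (simp add: algebra_simps)
      then show "u * (f \<omega> + h \<omega>) + v * (g \<omega> + h \<omega>) = u * f \<omega> + v * g \<omega> + h \<omega>" using that by simp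
    qed
    finally show ?thesis by simp
  qed
  fix f :: "nat \<Rightarrow> 'a \<Rightarrow> real" and f0 z :: "'a \<Rightarrow> real"
  assume f: "\<And>k. f k \<in> ?A" and f0 [measurable]: "f0 \<in> borel_measurable M" and z: "z \<in> orlicz_fun M ?F"
    and dom: "\<And>k. AE \<omega> in M. \<bar>f k \<omega>\<bar> \<le> z \<omega>" and lim: "AE \<omega> in M. (\<lambda>k. f k \<omega>) \<longlonglongrightarrow> f0 \<omega>"
  have [measurable]: "f k \<in> borel_measurable M" "z \<in> borel_measurable M" for k
    using f z by (auto simp: orlicz_fun_def)
  define \<zeta> where "\<zeta> = L0_class M (\<lambda>\<omega>. z \<omega> + \<bar>h \<omega>\<bar>)"
  have zm: "(\<lambda>\<omega>. z \<omega> + \<bar>h \<omega>\<bar>) \<in> borel_measurable M" by measurable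
  have \<zeta>: "\<zeta> \<in> orlicz_space M ?F"
    unfolding \<zeta>_def L0_class_in_orlicz_space_iff[OF ecF zm]
    by (intro orlicz_fun_add[OF ecF] orlicz_fun_abs[OF ecF] z h)
  define \<xi> where "\<xi> k = L0_class M (\<lambda>\<omega>. f k \<omega> + h \<omega>)" for k
  have ae: "AE \<omega> in M. rep (\<xi> k) \<omega> = f k \<omega> + h \<omega>" for k
    unfolding \<xi>_def by (rule rep_L0_class) measurable
  have "L0_class M (\<lambda>\<omega>. f0 \<omega> + h \<omega>) \<in> C \<inter> order_interval M \<zeta>"
  proof (rule AE_limit_in_L0_closed[OF cl[OF \<zeta>], of \<xi>])
    show "\<xi> k \<in> C \<inter> order_interval M \<zeta>" for k
    proof
      show "\<xi> k \<in> C" using f by (simp add: \<xi>_def)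
      have "\<xi> k \<in> L0 M" unfolding \<xi>_def by (rule L0_class_in_L0) measurable
      moreover have "AE \<omega> in M. \<bar>rep (\<xi> k) \<omega>\<bar> \<le> rep \<zeta> \<omega>"
        using dom[of k] ae[of k] rep_L0_class[OF zm] unfolding \<zeta>_def[symmetric]
        by eventually_elim simp
      ultimately show "\<xi> k \<in> order_interval M \<zeta>" by (simp add: order_interval_iff)
    qed
    have "AE \<omega> in M. \<forall>k. rep (\<xi> k) \<omega> = f k \<omega> + h \<omega>" using ae by (simp add: AE_all_countable)
    with lim show "AE \<omega> in M. (\<lambda>k. rep (\<xi> k) \<omega>) \<longlonglongrightarrow> f0 \<omega> + h \<omega>"
    proof eventually_elim
      case (elim \<omega>)
      have "(\<lambda>k. f k \<omega> + h \<omega>) \<longlonglongrightarrow> f0 \<omega> + h \<omega>" by (intro tendsto_intros elim(1))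
      then show ?case using elim(2) by simp
    qed
  qed measurable
  then show "f0 \<in> ?A" by simp
qed

lemma order_interval_closed_imp_weakly_closed:
  assumes \<Phi>: "young_function \<Phi>" "Delta2 \<Phi>" and C: "C \<subseteq> orlicz_space M (young_conjugate \<Phi>)"
    and conv: "L0_convex M C"
    and cl: "\<And>\<zeta>. \<zeta> \<in> orlicz_space M (young_conjugate \<Phi>) \<Longrightarrow> closedin (L0_topology M) (C \<inter> order_interval M \<zeta>)"
  shows "closedin (weak_topology M (orlicz_space M (young_conjugate \<Phi>)) (orlicz_space M \<Phi>)) C"
proof -
  note ec = young_function_even_convex[OF \<Phi>(1)] and ecF = even_convex_young_conjugate[OF \<Phi>(1)]
  let ?F = "young_conjugate \<Phi>"
  let ?E = "orlicz_space M ?F"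
  let ?W = "weak_topology M ?E (orlicz_space M \<Phi>)"
  have "\<exists>U. openin ?W U \<and> \<xi>0 \<in> U \<and> U \<subseteq> ?E - C" if \<xi>0: "\<xi>0 \<in> ?E - C" for \<xi>0
  proof -
    define h where "h = rep \<xi>0"
    have \<xi>0L: "\<xi>0 \<in> L0 M" and h: "h \<in> orlicz_fun M ?F"
      using \<xi>0 by (auto simp: h_def orlicz_space_iff[OF ecF])
    have [measurable]: "h \<in> borel_measurable M" using h by (simp add: orlicz_fun_def)
    define A where "A = {f \<in> borel_measurable M. L0_class M (\<lambda>\<omega>. f \<omega> + h \<omega>) \<in> C}"
    interpret A: dominated_closed M \<Phi> A
      unfolding A_def by (rule dominated_closed_translate[OF \<Phi> C conv cl h])
    have "(\<lambda>_. 0) \<notin> A" using \<xi>0 L0_class_rep[OF \<xi>0L] by (simp add: A_def h_def)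
    then obtain e m where e: "e \<in> orlicz_fun M \<Phi>" and m: "0 < m" "\<And>f. f \<in> A \<Longrightarrow> m \<le> (\<integral>\<omega>. e \<omega> * f \<omega> \<partial>M)"
      using A.separation by blast
    have em [measurable]: "e \<in> borel_measurable M" using e by (simp add: orlicz_fun_def)
    define \<eta> where "\<eta> = L0_class M e"
    have \<eta>: "\<eta> \<in> orlicz_space M \<Phi>" using e L0_class_in_orlicz_space_iff[OF ec em] by (simp add: \<eta>_def)
    have \<eta>L: "\<eta> \<in> L0 M" unfolding \<eta>_def by (rule L0_class_in_L0[OF em])
    have pair: "pairing M \<eta> \<xi> = (\<integral>\<omega>. e \<omega> * rep \<xi> \<omega> \<partial>M)" if "\<xi> \<in> L0 M" for \<xi>
    proof -
      have [measurable]: "rep \<xi> \<in> borel_measurable M" "rep \<eta> \<in> borel_measurable M"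
        using that \<eta>L by (auto intro: rep_measurable)
      show ?thesis
        unfolding pairing_def
      proof (rule integral_cong_AE)
        show "AE \<omega> in M. rep \<eta> \<omega> * rep \<xi> \<omega> = e \<omega> * rep \<xi> \<omega>"
          using rep_L0_class[OF em] unfolding \<eta>_def by eventually_elim simp
      qed measurable
    qed
    \<comment> \<open>An open half space. Separation of the translate gives E[e * (\<xi> - \<xi>0)]
      \<ge> m for every \<xi> in \<open>C\<close>, so a pairing smaller than the one at \<xi>0 plus
      m excludes membership in \<open>C\<close>.\<close>
    define U where "U = {\<xi> \<in> ?E. pairing M \<eta> \<xi> \<in> {..<pairing M \<eta> \<xi>0 + m}}"
    have "openin ?W U"
      unfolding weak_topology_def
    proof (intro topology_generated_by_Basis CollectI exI conjI)
      show "U = {\<xi> \<in> ?E. pairing M \<eta> \<xi> \<in> {..<pairing M \<eta> \<xi>0 + m}}" by (rule U_def)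
    qed (use \<eta> in auto)
    moreover have "\<xi>0 \<in> U" using \<xi>0 m by (simp add: U_def)
    moreover have "\<xi> \<notin> C" if \<xi>: "\<xi> \<in> U" for \<xi>
    proof
      assume \<xi>C: "\<xi> \<in> C"
      have \<xi>L: "\<xi> \<in> L0 M" and \<xi>F: "rep \<xi> \<in> orlicz_fun M ?F"
        using \<xi>C C by (auto simp: orlicz_space_iff[OF ecF])
      have [measurable]: "rep \<xi> \<in> borel_measurable M" using \<xi>L by (rule rep_measurable)
      have "(\<lambda>\<omega>. rep \<xi> \<omega> - h \<omega>) \<in> A" using \<xi>C L0_class_rep[OF \<xi>L] by (simp add: A_def)
      then have "m \<le> (\<integral>\<omega>. e \<omega> * (rep \<xi> \<omega> - h \<omega>) \<partial>M)" by (rule m(2))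
      also have "\<dots> = (\<integral>\<omega>. e \<omega> * rep \<xi> \<omega> - e \<omega> * h \<omega> \<partial>M)" by (simp add: right_diff_distrib)
      also have "\<dots> = (\<integral>\<omega>. e \<omega> * rep \<xi> \<omega> \<partial>M) - (\<integral>\<omega>. e \<omega> * h \<omega> \<partial>M)"
        using orlicz_duality_integrable[OF \<Phi>(1) e] \<xi>F h by (intro Bochner_Integration.integral_diff) auto
      also have "\<dots> = pairing M \<eta> \<xi> - pairing M \<eta> \<xi>0"
        using pair[OF \<xi>L] pair[OF \<xi>0L] by (simp add: h_def)
      finally show False using \<xi> by (simp add: U_def)
    qed
    ultimately show ?thesis unfolding U_def by blast
  qed
  then have "openin ?W (?E - C)" by (subst openin_subopen) blast
  then show ?thesis using C by (simp add: closedin_def topspace_weak_topology[OF ec])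
qed

end

theorem theorem4p1:
  fixes M :: "'a measure" and \<Phi> :: "real \<Rightarrow> real" and C :: "('a \<Rightarrow> real) set set"
  assumes "prob_space M"
    and "young_function \<Phi>"
    and "Delta2 \<Phi>"
    and "C \<subseteq> orlicz_space M (young_conjugate \<Phi>)"
    and "L0_convex M C"
  shows "closedin (weak_topology M (orlicz_space M (young_conjugate \<Phi>)) (orlicz_space M \<Phi>)) C \<longleftrightarrow>
    (\<forall>\<zeta>\<in>orlicz_space M (young_conjugate \<Phi>). closedin (L0_topology M) (C \<inter> order_interval M \<zeta>))"
proof -
  interpret prob_space M by fact
  show ?thesis
    using weakly_closed_imp_order_interval_closed[OF assms(2,4)]
      order_interval_closed_imp_weakly_closed[OF assms(2-5)] by blast
qed

end
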